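(* There exists a randomized algorithm that, given probe access to a finite graph $G=(V,E)$ with maximum degree $\Delta\ge1$, an integer $q$ satisfying $q\ge65\Delta$, and a nonempty subset $\Lambda\subseteq V$, outputs a perfect sample $X\in[q]^\Lambda$ distributed exactly according to $\mu_\Lambda$, where $\mu$ denotes the uniform distribution over all proper $q$-colorings of $G$, in expected time $O(\Delta^2q\cdot|\Lambda|)$.
   Context: A proper $q$-coloring of a finite simple graph $G=(V,E)$ is a map $\sigma:V\to[q]$ with $\sigma(u)\ne\sigma(v)$ for all $(u,v)\in E$. For a distribution $\mu$ on $[q]^V$ and $\Lambda\subseteq V$, the marginal is $\mu_\Lambda(\tau)=\sum_{\sigma\in[q]^V:\sigma_\Lambda=\tau}\mu(\sigma)$ for $\tau\in[q]^\Lambda$. Probe access: for each $v\in V$ each neighbor of $v$ can be accessed in $O(1)$ time. Computational model: unit-cost arithmetic, comparisons and dictionary operations; the vertices carry a known fixed ordering; elementary random draws (uniform from $[0,1]$, or uniform from an explicitly stored list) cost $O(1)$. The constant hidden in $O(\cdot)$ is absolute; in particular the time does not depend on $|V|$. *)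

theory Defs
  imports "HOL-Probability.Probability"
begin

text \<open>Vertices are natural numbers; their numerical order is the fixed ordering of the vertices
  known to the algorithm. The vertex set is an arbitrary finite set of labels.\<close>

definition simple_graph :: "nat set \<Rightarrow> nat set set \<Rightarrow> bool" where
  "simple_graph V E \<longleftrightarrow> finite V \<and> E \<subseteq> {{u, v} | u v. u \<in> V \<and> v \<in> V \<and> u \<noteq> v}"

definition neighbors :: "nat set set \<Rightarrow> nat \<Rightarrow> nat set" where
  "neighbors E v = {u. {u, v} \<in> E}"

definition max_degree :: "nat set \<Rightarrow> nat set set \<Rightarrow> nat" where
  "max_degree V E = Max ((\<lambda>v. card (neighbors E v)) ` V)"

definition proper_colorings :: "nat set \<Rightarrow> nat set set \<Rightarrow> nat \<Rightarrow> (nat \<Rightarrow> nat) set" where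
  "proper_colorings V E q =
     {\<sigma> \<in> V \<rightarrow>\<^sub>E {1..q}. \<forall>u v. {u, v} \<in> E \<longrightarrow> \<sigma> u \<noteq> \<sigma> v}"

definition uniform_coloring :: "nat set \<Rightarrow> nat set set \<Rightarrow> nat \<Rightarrow> (nat \<Rightarrow> nat) pmf" where
  "uniform_coloring V E q = pmf_of_set (proper_colorings V E q)"

definition marginal ::
  "nat set \<Rightarrow> nat \<Rightarrow> (nat \<Rightarrow> nat) pmf \<Rightarrow> nat set \<Rightarrow> (nat \<Rightarrow> nat) \<Rightarrow> real" where
  "marginal V q \<mu> \<Lambda> \<tau> = (\<Sum>\<sigma> | \<sigma> \<in> V \<rightarrow>\<^sub>E {1..q} \<and> restrict \<sigma> \<Lambda> = \<tau>. pmf \<mu> \<sigma>)"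

text \<open>The order in which the neighbors of a vertex are listed is arbitrary.\<close>

definition adjacency_lists :: "nat set set \<Rightarrow> (nat \<Rightarrow> nat list) \<Rightarrow> bool" where
  "adjacency_lists E adj \<longleftrightarrow> (\<forall>v. distinct (adj v) \<and> set (adj v) = neighbors E v)"

text \<open>
  An algorithm is a finite program over real-valued registers and finitely many named
  dictionaries, whose keys are tuples of numbers. Numeric constants are integers, so that a
  program cannot carry an infinite amount of advice. The arithmetic is that of the field of real
  numbers; there is no rounding operation.
\<close>

datatype expr =
    Num int
  | Reg string
  | Lookup string "expr list"
  | Plus expr expr
  | Minus expr expr
  | Times expr expr
  | Divide expr expr

datatype test =
    Less expr expr
  | Equal expr expr
  | Member string "expr list"
  | Neg test
  | Conj test test

datatype cmd =
    Assign string expr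
  | Insert string "expr list" expr
  | Delete string "expr list"
  | Probe string expr expr
  | DrawUnit string
  | DrawList string string expr
  | If test "cmd list" "cmd list"
  | While test "cmd list"

record store =
  reg :: "string \<Rightarrow> real"
  dict :: "string \<Rightarrow> real list \<Rightarrow> real option"

text \<open>Looking up an absent key yields 0; presence is decided by \<open>Member\<close>.\<close>

fun eval :: "store \<Rightarrow> expr \<Rightarrow> real" where
  "eval s (Num k) = of_int k"
| "eval s (Reg x) = reg s x"
| "eval s (Lookup d ks) = (case dict s d (map (eval s) ks) of None \<Rightarrow> 0 | Some r \<Rightarrow> r)"
| "eval s (Plus a b) = eval s a + eval s b"
| "eval s (Minus a b) = eval s a - eval s b"
| "eval s (Times a b) = eval s a * eval s b"
| "eval s (Divide a b) = eval s a / eval s b"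

fun holds :: "store \<Rightarrow> test \<Rightarrow> bool" where
  "holds s (Less a b) \<longleftrightarrow> eval s a < eval s b"
| "holds s (Equal a b) \<longleftrightarrow> eval s a = eval s b"
| "holds s (Member d ks) \<longleftrightarrow> dict s d (map (eval s) ks) \<noteq> None"
| "holds s (Neg t) \<longleftrightarrow> \<not> holds s t"
| "holds s (Conj t u) \<longleftrightarrow> holds s t \<and> holds s u"

definition set_reg :: "string \<Rightarrow> real \<Rightarrow> store \<Rightarrow> store" where
  "set_reg x r s = s\<lparr>reg := (reg s)(x := r)\<rparr>"

definition set_dict :: "string \<Rightarrow> real list \<Rightarrow> real option \<Rightarrow> store \<Rightarrow> store" where
  "set_dict d k r s = s\<lparr>dict := (dict s)(d := (dict s d)(k := r))\<rparr>"

text \<open>The only access to the graph: the answer to a probe \<open>(a, b)\<close> is the \<open>b\<close>-th neighbor of the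
  vertex \<open>a\<close> (counting from 0), or \<open>-1\<close> if there is none.\<close>

definition probe :: "(nat \<Rightarrow> nat list) \<Rightarrow> real \<Rightarrow> real \<Rightarrow> real" where
  "probe adj a b =
     (let v = nat \<lfloor>a\<rfloor>; i = nat \<lfloor>b\<rfloor> in
      if a = real v \<and> b = real i \<and> i < length (adj v) then real (adj v ! i) else -1)"

text \<open>The uniform index in \<open>{..<n}\<close> determined by a uniform \<open>u \<in> [0,1]\<close>; the minimum only matters
  for \<open>u = 1\<close>.\<close>

definition uniform_index :: "nat \<Rightarrow> real \<Rightarrow> nat" where
  "uniform_index n u = min (nat \<lfloor>u * real n\<rfloor>) (n - 1)"

text \<open>
  A configuration consists of the commands still to be executed, the store, and a random tape from
  which each draw consumes one entry. \<open>DrawList x d e\<close> draws uniformly from the list stored in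
  dictionary \<open>d\<close> at the keys \<open>[0], \<dots>, [n - 1]\<close>, where \<open>n\<close> is the value of \<open>e\<close>.
  Every step has unit cost. This counts elementary operations up to a constant factor, since the
  expressions and tests of a fixed program have bounded size.
\<close>

type_synonym config = "cmd list \<times> store \<times> real stream"

fun step :: "(nat \<Rightarrow> nat list) \<Rightarrow> config \<Rightarrow> config" where
  "step adj ([], s, \<omega>) = ([], s, \<omega>)"
| "step adj (Assign x e # cs, s, \<omega>) = (cs, set_reg x (eval s e) s, \<omega>)"
| "step adj (Insert d ks e # cs, s, \<omega>) =
     (cs, set_dict d (map (eval s) ks) (Some (eval s e)) s, \<omega>)"
| "step adj (Delete d ks # cs, s, \<omega>) = (cs, set_dict d (map (eval s) ks) None s, \<omega>)"
| "step adj (Probe x a b # cs, s, \<omega>) = (cs, set_reg x (probe adj (eval s a) (eval s b)) s, \<omega>)"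
| "step adj (DrawUnit x # cs, s, \<omega>) = (cs, set_reg x (shd \<omega>) s, stl \<omega>)"
| "step adj (DrawList x d e # cs, s, \<omega>) =
     (cs, set_reg x (case dict s d [real (uniform_index (nat \<lfloor>eval s e\<rfloor>) (shd \<omega>))] of
                       None \<Rightarrow> 0 | Some r \<Rightarrow> r) s, stl \<omega>)"
| "step adj (If t c c' # cs, s, \<omega>) = ((if holds s t then c else c') @ cs, s, \<omega>)"
| "step adj (While t c # cs, s, \<omega>) = (if holds s t then c @ While t c # cs else cs, s, \<omega>)"

definition tape_space :: "real stream measure" where
  "tape_space = stream_space (uniform_measure lborel {0..1})"

text \<open>The input: the number of colors, and the set \<open>\<Lambda>\<close> as an explicitly stored list together with
  its length. All other registers are 0 and all other dictionaries are empty.\<close>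

definition initial_store :: "nat \<Rightarrow> nat list \<Rightarrow> store" where
  "initial_store q vs =
     \<lparr>reg = (\<lambda>_. 0)(''q'' := real q, ''m'' := real (length vs)),
      dict = (\<lambda>_. Map.empty)
        (''Lambda'' := map_of (map (\<lambda>i. ([real i], real (vs ! i))) [0..<length vs]))\<rparr>"

definition config_after ::
  "cmd list \<Rightarrow> (nat \<Rightarrow> nat list) \<Rightarrow> nat \<Rightarrow> nat list \<Rightarrow> real stream \<Rightarrow> nat \<Rightarrow> config" where
  "config_after P adj q vs \<omega> n = (step adj ^^ n) (P, initial_store q vs, \<omega>)"

text \<open>The number of steps until no command is left; it is \<open>\<infinity>\<close> (the infimum of the empty set) if
  the program does not halt.\<close>

definition running_time ::
  "cmd list \<Rightarrow> (nat \<Rightarrow> nat list) \<Rightarrow> nat \<Rightarrow> nat list \<Rightarrow> real stream \<Rightarrow> ennreal" where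
  "running_time P adj q vs \<omega> = (INF n \<in> {n. fst (config_after P adj q vs \<omega> n) = []}. of_nat n)"

text \<open>The program halts, and its dictionary \<open>out\<close> is then exactly the map \<open>\<tau>\<close> with domain \<open>\<Lambda>\<close>.\<close>

definition outputs ::
  "cmd list \<Rightarrow> (nat \<Rightarrow> nat list) \<Rightarrow> nat \<Rightarrow> nat list \<Rightarrow> real stream \<Rightarrow> (nat \<Rightarrow> nat) \<Rightarrow> bool" where
  "outputs P adj q vs \<omega> \<tau> \<longleftrightarrow>
     (\<exists>n s \<omega>'. config_after P adj q vs \<omega> n = ([], s, \<omega>') \<and>
        dict s ''out'' = map_of (map (\<lambda>v. ([real v], real (\<tau> v))) vs))"

end

theory Submission
  imports Defs
begin

text \<open>
  A vertex \<open>v\<close> of a partially colored graph receives the color \<open>c\<close> with some probability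
  \<open>r \<le> 1 / (q - \<Delta>)\<close>. Hence the question whether \<open>v\<close> is colored \<open>c\<close> can be answered in the negative,
  without looking at the graph, with probability \<open>1 - 2 / q\<close>, and otherwise by a Bernoulli
  experiment of success probability \<open>s = r * q / 2\<close>, which is run as follows. Delete \<open>v\<close>, and write
  \<open>B\<close> for the random set of colors on the former neighbors of \<open>v\<close>. Then \<open>r\<close> is
  \<open>P(c \<notin> B) / (q * (1 - t))\<close>, where \<open>t\<close> is the probability that a uniform color lies in \<open>B\<close>, so
  \<open>s = P(c \<notin> B) / 2 + t * s\<close>: with probability \<open>1/2\<close> ask the neighbors one after the other
  whether they are colored \<open>c\<close>, with probability \<open>t\<close> start over, and fail otherwise. Since \<open>B\<close> is
  covered by the first occurrences of its colors, the event of probability \<open>t\<close> is the disjoint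
  union over the neighbors \<open>w\<close> of the events that \<open>w\<close> has the uniform color and no earlier neighbor
  has it; for a single \<open>w\<close> this is simulated by choosing \<open>w\<close> with probability \<open>2 / q\<close> and running the
  Bernoulli experiment of \<open>w\<close> itself instead of its question. All questions are asked recursively
  in the smaller graph, conditioned on the answers so far. A question thus leads to a recursive
  experiment with probability \<open>2 / q\<close> and an experiment asks about \<open>\<Delta>\<close> questions, so the recursion
  is subcritical. A vertex is sampled by running the experiment for uniform colors until one
  succeeds.

  Each answer is exact, so the probability of a prescribed output is a martingale along the run of
  the machine; together with a potential function that drops by one per step in expectation this
  gives both claims.
\<close>

section \<open>Random tapes\<close>

text \<open>No recursion is unfolded anywhere: \<open>marg\<close>, \<open>accept\<close>,
  \<open>pass\<close> and \<open>win\<close> are quotients of numbers of colorings, defined without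
  reference to the machine, and each mode is checked against them by a one-step identity. The
  obstacle is that questions are asked while outer checks are suspended halfway. A frame therefore
  records a removed vertex together with a color forbidden at an initial segment of its neighbors,
  which covers suspended checks and colored vertices alike. The success probability of a suspended
  experiment is affine in that of the one it waits for, so expectations pass through the whole
  stack. Scaling marginals by \<open>q / 2\<close> keeps them at most 1 and lets a uniform color
  succeed with probability exactly 1/2, hence two attempts per vertex on average. Since nothing can
  be rounded, the quotients \<open>n div 4\<close> are tabulated by counting before sampling starts.
  This costs \<open>O(q)\<close>; sampling takes \<open>O(\<Delta> * |\<Lambda>|)\<close> expected
  iterations of at most 29 steps each.\<close>

lemma nn_integral_finite_range:
  assumes f: "f \<in> measurable M (count_space UNIV)" and A: "finite A" "\<And>x. x \<in> space M \<Longrightarrow> f x \<in> A"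
  shows "(\<integral>\<^sup>+ x. g (f x) \<partial>M) = (\<Sum>a\<in>A. g a * emeasure M {x \<in> space M. f x = a})"
proof -
  have "g (f x) = (\<Sum>a\<in>A. g a * indicator {x \<in> space M. f x = a} x)" if "x \<in> space M" for x
  proof -
    have "(\<Sum>a\<in>A. g a * indicator {x \<in> space M. f x = a} x) = (\<Sum>a\<in>A. if a = f x then g a else 0)"
      using that by (intro sum.cong) (auto simp: indicator_def)
    also have "\<dots> = g (f x)" using A that by simp
    finally show ?thesis by simp
  qed
  then have "(\<integral>\<^sup>+ x. g (f x) \<partial>M) =
      (\<integral>\<^sup>+ x. (\<Sum>a\<in>A. g a * indicator {x \<in> space M. f x = a} x) \<partial>M)"
    by (rule nn_integral_cong)
  also have "\<dots> = (\<Sum>a\<in>A. g a * emeasure M {x \<in> space M. f x = a})"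
  proof -
    have "{x \<in> space M. f x = a} \<in> sets M" for a
      using measurable_sets[OF f, of "{a}"] by (simp add: vimage_def Int_def conj_commute)
    then show ?thesis by (simp add: nn_integral_sum nn_integral_cmult)
  qed
  finally show ?thesis .
qed

abbreviation unit_measure :: "real measure" where
  "unit_measure \<equiv> uniform_measure lborel {0..1}"

lemma prob_space_unit: "prob_space unit_measure"
  by (rule prob_space_uniform_measure) simp_all

lemma prob_space_tape: "prob_space tape_space"
  unfolding tape_space_def by (rule prob_space.prob_space_stream_space[OF prob_space_unit])

lemma emeasure_unit: "A \<in> sets borel \<Longrightarrow> emeasure unit_measure A = emeasure lborel ({0..1} \<inter> A)"
  by (simp add: divide_ennreal_def)

lemma space_tape [simp]: "space tape_space = UNIV"
  by (simp add: tape_space_def space_stream_space)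

text \<open>The outcomes of a uniform real that the machine distinguishes.\<close>

definition tag :: "nat \<Rightarrow> real \<Rightarrow> nat" where
  "tag q u = (if u * real q < 2 then 0 else if 2 * u < 1 then 1 else if 4 * u < 3 then 2 else 3)"

text \<open>A single real serves all modes: a slot only asks whether the outcome is 0, a round only
  whether it is at most 1 or at most 2. The thresholds are nested because \<open>2 / q\<close> is at
  most 1/2 for \<open>q \<ge> 4\<close>.\<close>

definition tag_prob :: "nat \<Rightarrow> nat \<Rightarrow> real" where
  "tag_prob q t = (if t = 0 then 2 / real q else if t = 1 then 1/2 - 2 / real q else 1/4)"

lemma measurable_tag [measurable]: "tag q \<in> measurable borel (count_space UNIV)"
  unfolding tag_def by measurable

lemma measurable_uniform_index [measurable]: "uniform_index q \<in> measurable borel (count_space UNIV)"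
  unfolding uniform_index_def by measurable

lemma tag_less: "tag q u < 4" by (simp add: tag_def)

lemma uniform_index_less: "q > 0 \<Longrightarrow> uniform_index q u < q" by (simp add: uniform_index_def)

lemma emeasure_tag:
  assumes "q \<ge> 4" "t < 4"
  shows "emeasure unit_measure {u. tag q u = t} = ennreal (tag_prob q t)"
proof -
  define c where "c = 2 / real q"
  have c: "0 < c" "c \<le> 1 / 2" using assms by (auto simp: c_def field_simps)
  have m: "{u. tag q u = t} \<in> sets borel"
    using measurable_sets[OF measurable_tag, of "{t}" q] by (simp add: vimage_def)
  have tag: "tag q u = (if u < c then 0 else if 2 * u < 1 then 1 else if 4 * u < 3 then 2 else 3)" for u
    using assms(1) by (simp add: tag_def c_def field_simps)
  have prob: "tag_prob q t = (if t = 0 then c else if t = 1 then 1/2 - c else 1/4)" for t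
    by (simp add: tag_prob_def c_def)
  consider "t = 0" | "t = 1" | "t = 2" | "t = 3" using assms(2) by linarith
  then have "emeasure lborel ({0..1} \<inter> {u. tag q u = t}) = ennreal (tag_prob q t)"
  proof cases
    case 1
    have "{0..1} \<inter> {u. tag q u = t} = {0..<c}" using c by (auto simp: tag 1)
    then show ?thesis using c 1 by (simp add: prob)
  next
    case 2
    have "{0..1} \<inter> {u. tag q u = t} = {c..<1/2}" using c by (auto simp: tag 2)
    then show ?thesis using c 2 by (simp add: prob)
  next
    case 3
    have "{0..1} \<inter> {u. tag q u = t} = {1/2..<3/4}" using c by (auto simp: tag 3)
    then show ?thesis using 3 by (simp add: prob)
  next
    case 4
    have "{0..1} \<inter> {u. tag q u = t} = {3/4..1}" using c by (auto simp: tag 4)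
    then show ?thesis using 4 by (simp add: prob)
  qed
  then show ?thesis using emeasure_unit[OF m] by simp
qed

lemma emeasure_uniform_index:
  assumes "n < q"
  shows "emeasure unit_measure {u. uniform_index q u = n} = ennreal (1 / real q)"
proof -
  have q: "real q > 0" using assms by simp
  have m: "{u. uniform_index q u = n} \<in> sets borel"
    using measurable_sets[OF measurable_uniform_index, of "{n}" q] by (simp add: vimage_def)
  \<comment> \<open>Strict upper bounds on the floor are strict upper bounds on \<open>u\<close>, so
    the preimage of an index is an interval.\<close>
  have fl: "nat \<lfloor>u * real q\<rfloor> < k \<longleftrightarrow> u < real k / real q" if "u \<ge> 0" for u k
  proof -
    have "nat \<lfloor>u * real q\<rfloor> < k \<longleftrightarrow> u * real q < real k"
      using that q by (simp add: nat_less_iff floor_less_iff)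
    then show ?thesis using q by (simp add: field_simps)
  qed
  define a b where "a = real n / real q" and "b = real (Suc n) / real q"
  have ab: "0 \<le> a" "a \<le> b" "b \<le> 1" "b - a = 1 / real q"
    using assms by (auto simp: a_def b_def field_simps)
  have "emeasure lborel ({0..1} \<inter> {u. uniform_index q u = n}) = ennreal (1 / real q)"
  \<comment> \<open>The last index also absorbs \<open>u = 1\<close> through the minimum, so its
    interval is closed on the right.\<close>
  proof (cases "n = q - 1")
    case True
    have idx: "uniform_index q u = n \<longleftrightarrow> \<not> nat \<lfloor>u * real q\<rfloor> < n" for u
    proof -
      have "min k (q - 1) = n \<longleftrightarrow> \<not> k < n" for k :: nat using True by linarith
      then show ?thesis by (simp only: uniform_index_def)
    qed
    have "uniform_index q u = n \<longleftrightarrow> a \<le> u" if "0 \<le> u" for u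
      unfolding idx fl[OF that] a_def by (rule not_less)
    then have "u \<in> {0..1} \<inter> {u. uniform_index q u = n} \<longleftrightarrow> u \<in> {a..1}" for u
      using ab(1) by (cases "0 \<le> u") auto
    then have "{0..1} \<inter> {u. uniform_index q u = n} = {a..1}" by blast
    moreover have "b = 1" using True assms by (auto simp: b_def)
    ultimately show ?thesis using ab by simp
  next
    case False
    have idx: "uniform_index q u = n \<longleftrightarrow> \<not> nat \<lfloor>u * real q\<rfloor> < n \<and> nat \<lfloor>u * real q\<rfloor> < Suc n" for u
    proof -
      have "min k (q - 1) = n \<longleftrightarrow> \<not> k < n \<and> k < Suc n" for k :: nat using False assms by linarith
      then show ?thesis by (simp only: uniform_index_def)
    qed
    have "uniform_index q u = n \<longleftrightarrow> a \<le> u \<and> u < b" if "0 \<le> u" for u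
      unfolding idx fl[OF that] a_def b_def by (simp only: not_less)
    then have "u \<in> {0..1} \<inter> {u. uniform_index q u = n} \<longleftrightarrow> u \<in> {a..<b}" for u
      using ab(1,3) by (cases "0 \<le> u") auto
    then have "{0..1} \<inter> {u. uniform_index q u = n} = {a..<b}" by blast
    then show ?thesis using ab by simp
  qed
  then show ?thesis using emeasure_unit[OF m] by simp
qed

definition draw3 :: "nat \<Rightarrow> real stream \<Rightarrow> nat \<times> nat \<times> nat" where
  "draw3 q \<omega> = (tag q (shd \<omega>), uniform_index q (shd (stl \<omega>)), uniform_index q (shd (stl (stl \<omega>))))"

definition stl3 :: "real stream \<Rightarrow> real stream" where
  "stl3 \<omega> = stl (stl (stl \<omega>))"

lemma measurable_shd_tape [measurable]: "shd \<in> borel_measurable tape_space"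
proof -
  have "measurable tape_space borel = measurable tape_space unit_measure"
    by (rule measurable_cong_sets) simp_all
  then show ?thesis unfolding tape_space_def using measurable_shd by blast
qed

lemma measurable_stl_tape [measurable]: "stl \<in> measurable tape_space tape_space"
  unfolding tape_space_def by (rule measurable_stl)

lemma measurable_draw3 [measurable]: "draw3 q \<in> measurable tape_space (count_space UNIV)"
proof -
  have "(\<lambda>\<omega>. (\<lambda>a b c. (a, b, c)) (tag q (shd \<omega>)) (uniform_index q (shd (stl \<omega>)))
      (uniform_index q (shd (stl (stl \<omega>))))) \<in> measurable tape_space (count_space UNIV)"
    by measurable
  then show ?thesis by (simp add: draw3_def[abs_def])
qed

lemma measurable_stl3 [measurable]: "stl3 \<in> measurable tape_space tape_space"
  unfolding stl3_def[abs_def] by measurable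

lemma nn_integral_tape:
  assumes "f \<in> borel_measurable tape_space"
  shows "(\<integral>\<^sup>+ \<omega>. f \<omega> \<partial>tape_space) = (\<integral>\<^sup>+ u. (\<integral>\<^sup>+ \<omega>. f (u ## \<omega>) \<partial>tape_space) \<partial>unit_measure)"
  using assms unfolding tape_space_def
  by (rule prob_space.nn_integral_stream_space[OF prob_space_unit])

text \<open>A machine step consumes three tape entries and leaves a tape with the original
  distribution, so its integral is a finite average over the draws. Measurability for each fixed
  draw suffices because there are only countably many.\<close>

lemma nn_integral_draw3:
  assumes q: "q \<ge> 4" and F: "\<And>d. F d \<in> borel_measurable tape_space"
  shows "(\<integral>\<^sup>+ \<omega>. F (draw3 q \<omega>) (stl3 \<omega>) \<partial>tape_space) =
    (\<Sum>t<4. \<Sum>n1<q. \<Sum>n2<q. ennreal (tag_prob q t / (real q)\<^sup>2) * (\<integral>\<^sup>+ \<omega>. F (t, n1, n2) \<omega> \<partial>tape_space))"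
proof -
  let ?I = "\<lambda>d. \<integral>\<^sup>+ \<omega>. F d \<omega> \<partial>tape_space"
  have index: "(\<integral>\<^sup>+ u. g (uniform_index q u) \<partial>unit_measure) = (\<Sum>n<q. g n * ennreal (1 / real q))" for g
    using q by (subst nn_integral_finite_range[of _ _ "{..<q}"])
      (auto simp: uniform_index_less emeasure_uniform_index[simplified])
  have tag: "(\<integral>\<^sup>+ u. g (tag q u) \<partial>unit_measure) = (\<Sum>t<4. g t * ennreal (tag_prob q t))" for g
    using q by (subst nn_integral_finite_range[of _ _ "{..<4}"])
      (auto simp: tag_less emeasure_tag[simplified])
  have meas [measurable]: "(\<lambda>\<omega>. F (g \<omega>) (h \<omega>)) \<in> borel_measurable tape_space"
    if "g \<in> measurable tape_space (count_space UNIV)" "h \<in> measurable tape_space tape_space" for g h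
    using measurable_compose[OF that(2) F] that(1) by (rule measurable_compose_countable)
  let ?u = "uniform_index q"
  define J where "J t n1 = (\<Sum>n2<q. ?I (t, n1, n2) * ennreal (1 / real q))" for t n1
  define K where "K t = (\<Sum>n1<q. J t n1 * ennreal (1 / real q))" for t
  have third: "(\<integral>\<^sup>+ \<omega>. F (t, n1, ?u (shd \<omega>)) (stl \<omega>) \<partial>tape_space) = J t n1" for t n1
  proof -
    have "(\<lambda>\<omega>. F (t, n1, ?u (shd \<omega>)) (stl \<omega>)) \<in> borel_measurable tape_space"
      by (rule meas) measurable
    then show ?thesis unfolding J_def by (subst nn_integral_tape) (auto intro: index)
  qed
  have second: "(\<integral>\<^sup>+ \<omega>. F (t, ?u (shd \<omega>), ?u (shd (stl \<omega>))) (stl (stl \<omega>)) \<partial>tape_space) = K t" for t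
  proof -
    have "(\<lambda>\<omega>. (\<lambda>a b. (t, a, b)) (?u (shd \<omega>)) (?u (shd (stl \<omega>)))) \<in> measurable tape_space (count_space UNIV)"
      by measurable
    then have "(\<lambda>\<omega>. F (t, ?u (shd \<omega>), ?u (shd (stl \<omega>))) (stl (stl \<omega>))) \<in> borel_measurable tape_space"
      by (intro meas) measurable
    then show ?thesis unfolding K_def by (subst nn_integral_tape) (auto simp: third intro: index)
  qed
  have "(\<lambda>\<omega>. F (draw3 q \<omega>) (stl3 \<omega>)) \<in> borel_measurable tape_space"
    by (rule meas) measurable
  then have "(\<integral>\<^sup>+ \<omega>. F (draw3 q \<omega>) (stl3 \<omega>) \<partial>tape_space) = (\<integral>\<^sup>+ u. K (tag q u) \<partial>unit_measure)"
    by (subst nn_integral_tape) (auto simp: draw3_def stl3_def second)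
  also have "\<dots> = (\<Sum>t<4. K t * ennreal (tag_prob q t))" by (rule tag)
  also have "\<dots> = (\<Sum>t<4. \<Sum>n1<q. \<Sum>n2<q. ennreal (tag_prob q t / (real q)\<^sup>2) * ?I (t, n1, n2))"
  proof -
    have "0 \<le> tag_prob q t" for t using q by (auto simp: tag_prob_def field_simps)
    then have "ennreal (tag_prob q t / (real q)\<^sup>2) = ennreal (1 / real q) * ennreal (1 / real q) * ennreal (tag_prob q t)" for t
      by (simp add: ennreal_mult[symmetric] power2_eq_square)
    then show ?thesis by (simp add: K_def J_def sum_distrib_left sum_distrib_right mult_ac)
  qed
  finally show ?thesis .
qed

section \<open>Partial colorings\<close>

text \<open>In \<open>Frame v c x f j\<close> the vertex \<open>v\<close> is removed from the graph and the color \<open>x\<close> is forbidden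
  at its first \<open>j\<close> neighbors. The experiment at \<open>v\<close> is about the color \<open>c\<close>; it is in its final check
  (with \<open>x = c\<close>) if \<open>f = 0\<close>, and it tests whether the neighbor with index \<open>f - 1\<close> is the first one
  of color \<open>x\<close> if \<open>f > 0\<close>.\<close>

datatype frame = Frame (fv: nat) (fc: nat) (fx: nat) (ff: nat) (fj: nat)

definition pins :: "frame list \<Rightarrow> nat set" where
  "pins I = fv ` set I"

lemma pins_simps [simp]: "pins [] = {}" "pins (h # I) = insert (fv h) (pins I)"
  by (auto simp: pins_def)

lemma finite_pins [simp]: "finite (pins I)"
  by (simp add: pins_def)

locale coloring_instance =
  fixes V :: "nat set" and E :: "nat set set" and adj :: "nat \<Rightarrow> nat list" and q \<Delta> :: nat
  assumes graph: "simple_graph V E" and lists: "adjacency_lists E adj"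
    and degree: "\<Delta> = max_degree V E" and degree_pos: "\<Delta> \<ge> 1" and colors: "q \<ge> 65 * \<Delta>"
begin

abbreviation deg :: "nat \<Rightarrow> nat" where "deg v \<equiv> length (adj v)"

lemma q_pos: "q > 0" using degree_pos colors by simp

lemma finite_V: "finite V" using graph by (simp add: simple_graph_def)

lemma distinct_adj: "distinct (adj v)" using lists by (simp add: adjacency_lists_def)

lemma adj_iff: "w \<in> set (adj v) \<longleftrightarrow> {v, w} \<in> E"
  using lists by (auto simp: adjacency_lists_def neighbors_def insert_commute)

lemma adj_sym: "w \<in> set (adj v) \<longleftrightarrow> v \<in> set (adj w)"
  by (simp add: adj_iff insert_commute)

lemma edgeD: assumes "{u, w} \<in> E" shows "u \<in> V" "w \<in> V" "u \<noteq> w"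
  using assms graph by (auto simp: simple_graph_def doubleton_eq_iff)

lemma adj_V: assumes "w \<in> set (adj v)" shows "w \<in> V" "v \<in> V" "w \<noteq> v"
  using edgeD assms adj_iff by blast+

lemma deg_le: "deg v \<le> \<Delta>"
proof (cases "v \<in> V")
  case True
  have "deg v = card (neighbors E v)"
    using lists by (metis adjacency_lists_def distinct_card)
  also have "\<dots> \<le> \<Delta>"
    unfolding degree max_degree_def using True finite_V by (intro Max_ge) auto
  finally show ?thesis .
next
  case False
  then have "adj v = []" using adj_V(2) by (metis list.set_intros(1) neq_Nil_conv)
  then show ?thesis by simp
qed

definition blocks :: "frame \<Rightarrow> nat \<Rightarrow> bool" where
  "blocks h w \<longleftrightarrow> w \<in> set (take (fj h) (adj (fv h)))"

definition cols :: "frame list \<Rightarrow> (nat \<Rightarrow> nat) set" where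
  "cols I = {\<sigma> \<in> (V - pins I) \<rightarrow>\<^sub>E {1..q}.
     (\<forall>u \<in> V - pins I. \<forall>w \<in> V - pins I. {u, w} \<in> E \<longrightarrow> \<sigma> u \<noteq> \<sigma> w) \<and>
     (\<forall>h \<in> set I. \<forall>w \<in> V - pins I. blocks h w \<longrightarrow> \<sigma> w \<noteq> fx h)}"

definition ncol :: "frame list \<Rightarrow> nat" where "ncol I = card (cols I)"

definition admits :: "frame list \<Rightarrow> nat \<Rightarrow> nat \<Rightarrow> bool" where
  "admits I w a \<longleftrightarrow> a \<in> {1..q} \<and> (\<forall>h \<in> set I. blocks h w \<longrightarrow> fx h \<noteq> a)"

text \<open>A colored vertex is a removed vertex whose color is forbidden at all of its neighbors;
  hence \<open>ncol\<close> also counts the extensions of a partial coloring.\<close>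

definition full :: "nat \<Rightarrow> nat \<Rightarrow> frame" where "full w a = Frame w a a 0 (deg w)"

lemma finite_cols [simp]: "finite (cols I)"
proof -
  have "finite ((V - pins I) \<rightarrow>\<^sub>E {1..q})" using finite_V by (intro finite_PiE) auto
  then show ?thesis by (rule rev_finite_subset) (auto simp: cols_def)
qed

lemma blocks_full: "blocks (full w a) u \<longleftrightarrow> {w, u} \<in> E"
  by (simp add: blocks_def full_def adj_iff)

lemma blocks_adj: "blocks h w \<Longrightarrow> w \<in> set (adj (fv h))"
  unfolding blocks_def by (meson in_set_takeD)

lemma full_sel [simp]: "fv (full w a) = w" "fx (full w a) = a"
  by (simp_all add: full_def)

lemma colsI:
  assumes "\<sigma> \<in> (V - pins I) \<rightarrow>\<^sub>E {1..q}"
    and "\<And>u w. u \<in> V - pins I \<Longrightarrow> w \<in> V - pins I \<Longrightarrow> {u, w} \<in> E \<Longrightarrow> \<sigma> u \<noteq> \<sigma> w"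
    and "\<And>h w. h \<in> set I \<Longrightarrow> w \<in> V - pins I \<Longrightarrow> blocks h w \<Longrightarrow> \<sigma> w \<noteq> fx h"
  shows "\<sigma> \<in> cols I"
  using assms by (simp add: cols_def)

lemma colsD:
  assumes "\<sigma> \<in> cols I"
  shows "\<sigma> \<in> (V - pins I) \<rightarrow>\<^sub>E {1..q}"
    and "\<And>u w. u \<in> V - pins I \<Longrightarrow> w \<in> V - pins I \<Longrightarrow> {u, w} \<in> E \<Longrightarrow> \<sigma> u \<noteq> \<sigma> w"
    and "\<And>h w. h \<in> set I \<Longrightarrow> w \<in> V - pins I \<Longrightarrow> blocks h w \<Longrightarrow> \<sigma> w \<noteq> fx h"
  using assms by (simp_all add: cols_def)

text \<open>Erasing the value at \<open>w\<close> and restoring \<open>a\<close> are mutually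
  inverse: the edge constraints lost at \<open>w\<close> are exactly what \<open>full w a\<close>
  imposes on the neighbors.\<close>

lemma card_cols_color:
  assumes w: "w \<in> V" "w \<notin> pins I"
  shows "card {\<sigma> \<in> cols I. \<sigma> w = a} = (if admits I w a then ncol (full w a # I) else 0)"
proof (cases "admits I w a")
  case True
  have "bij_betw (\<lambda>\<sigma>. \<sigma>(w := undefined)) {\<sigma> \<in> cols I. \<sigma> w = a} (cols (full w a # I))"
  proof (rule bij_betw_byWitness[where f' = "\<lambda>\<sigma>. \<sigma>(w := a)"])
    show "\<forall>\<sigma> \<in> {\<sigma> \<in> cols I. \<sigma> w = a}. (\<sigma>(w := undefined))(w := a) = \<sigma>" by auto
    show "\<forall>\<sigma> \<in> cols (full w a # I). (\<sigma>(w := a))(w := undefined) = \<sigma>"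
      by (auto simp: cols_def PiE_def extensional_def fun_eq_iff)
    show "(\<lambda>\<sigma>. \<sigma>(w := undefined)) ` {\<sigma> \<in> cols I. \<sigma> w = a} \<subseteq> cols (full w a # I)"
    proof (clarify)
      fix \<sigma> assume s: "\<sigma> \<in> cols I" and "a = \<sigma> w"
      show "\<sigma>(w := undefined) \<in> cols (full w (\<sigma> w) # I)"
      proof (rule colsI)
        show "\<sigma>(w := undefined) \<in> (V - pins (full w (\<sigma> w) # I)) \<rightarrow>\<^sub>E {1..q}"
          using colsD(1)[OF s] by (auto simp: PiE_def extensional_def Pi_def)
        show "(\<sigma>(w := undefined)) u \<noteq> (\<sigma>(w := undefined)) u'"
          if "u \<in> V - pins (full w (\<sigma> w) # I)" "u' \<in> V - pins (full w (\<sigma> w) # I)" "{u, u'} \<in> E" for u u'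
          using colsD(2)[OF s, of u u'] that by simp
        show "(\<sigma>(w := undefined)) u \<noteq> fx h"
          if "h \<in> set (full w (\<sigma> w) # I)" "u \<in> V - pins (full w (\<sigma> w) # I)" "blocks h u" for h u
        proof (cases "h = full w (\<sigma> w)")
          case True
          then show ?thesis using colsD(2)[OF s, of w u] that w by (simp add: blocks_full)
        next
          case False
          then show ?thesis using colsD(3)[OF s, of h u] that by simp
        qed
      qed
    qed
    show "(\<lambda>\<sigma>. \<sigma>(w := a)) ` cols (full w a # I) \<subseteq> {\<sigma> \<in> cols I. \<sigma> w = a}"
    proof (clarify, intro conjI)
      fix \<sigma> assume s: "\<sigma> \<in> cols (full w a # I)"
      have adj: "\<sigma> u \<noteq> a" if "{w, u} \<in> E" "u \<in> V - pins I" for u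
        using colsD(3)[OF s, of "full w a" u] that edgeD[OF that(1)] by (simp add: blocks_full)
      show "\<sigma>(w := a) \<in> cols I"
      proof (rule colsI)
        show "\<sigma>(w := a) \<in> (V - pins I) \<rightarrow>\<^sub>E {1..q}"
          using colsD(1)[OF s] w True by (auto simp: PiE_def extensional_def Pi_def admits_def)
        show "(\<sigma>(w := a)) u \<noteq> (\<sigma>(w := a)) u'"
          if "u \<in> V - pins I" "u' \<in> V - pins I" "{u, u'} \<in> E" for u u'
          using colsD(2)[OF s, of u u'] adj[of u] adj[of u'] that edgeD(3)[OF that(3)]
          by (auto simp: insert_commute)
        show "(\<sigma>(w := a)) u \<noteq> fx h"
          if "h \<in> set I" "u \<in> V - pins I" "blocks h u" for h u
          using colsD(3)[OF s, of h u] that True by (auto simp: admits_def)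
      qed
      show "(\<sigma>(w := a)) w = a" by simp
    qed
  qed
  then show ?thesis using True by (simp add: bij_betw_same_card ncol_def)
next
  case False
  have "\<not> (\<sigma> \<in> cols I \<and> \<sigma> w = a)" for \<sigma>
  proof
    assume "\<sigma> \<in> cols I \<and> \<sigma> w = a"
    then have s: "\<sigma> \<in> cols I" "\<sigma> w = a" by auto
    have "a \<in> {1..q}" using colsD(1)[OF s(1)] w s(2) by (auto simp: PiE_def Pi_def)
    moreover have "\<forall>h \<in> set I. blocks h w \<longrightarrow> fx h \<noteq> a" using colsD(3)[OF s(1)] w s(2) by blast
    ultimately have "admits I w a" by (simp add: admits_def)
    then show False using False by simp
  qed
  then have "{\<sigma> \<in> cols I. \<sigma> w = a} = {}" by blast
  then show ?thesis using False by (simp only: card.empty if_False)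
qed

text \<open>A frame that blocks \<open>w\<close> sits at a neighbor of \<open>w\<close>, and
  different frames sit at different vertices.\<close>

lemma card_blocked_le:
  assumes "distinct (map fv I)"
  shows "card {fx h | h. h \<in> set I \<and> blocks h w} \<le> deg w"
proof -
  let ?out_prob = "{h \<in> set I. blocks h w}"
  have "{fx h | h. h \<in> set I \<and> blocks h w} = fx ` ?out_prob" by auto
  then have "card {fx h | h. h \<in> set I \<and> blocks h w} \<le> card ?out_prob"
    by (simp add: card_image_le)
  also have "\<dots> = card (fv ` ?out_prob)"
    using assms by (intro card_image[symmetric]) (auto simp: distinct_map inj_on_def)
  also have "\<dots> \<le> card (set (adj w))"
    using blocks_adj adj_sym by (intro card_mono) auto
  also have "\<dots> \<le> deg w" by (rule card_length)
  finally show ?thesis .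
qed

lemma ex_admits:
  assumes "distinct (map fv I)"
  shows "\<exists>a. admits I w a"
proof -
  let ?B = "{fx h | h. h \<in> set I \<and> blocks h w}"
  have fin: "finite ?B" by (rule finite_subset[of _ "fx ` set I"]) auto
  have "card ?B < card {1..q}"
    using card_blocked_le[OF assms, of w] deg_le[of w] colors degree_pos by simp
  then have "\<not> {1..q} \<subseteq> ?B" using card_mono[OF fin] by (meson not_less)
  then show ?thesis by (auto simp: admits_def)
qed

text \<open>Greedy coloring: fewer than \<open>q\<close> colors are blocked at a vertex, and giving
  it a free one leaves an instance of the same kind with one vertex less. This makes the
  denominators of all later quotients positive.\<close>

lemma ncol_pos:
  assumes "distinct (map fv I)"
  shows "ncol I > 0"
  using assms
proof (induction "card (V - pins I)" arbitrary: I)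
  case 0
  then have "V - pins I = {}" using finite_V by simp
  then have "cols I = {\<lambda>_. undefined}" by (auto simp: cols_def)
  then show ?case by (simp add: ncol_def)
next
  case (Suc n)
  have "V - pins I \<noteq> {}" using Suc.hyps(2) by (metis card.empty nat.distinct(1))
  then obtain w where w: "w \<in> V" "w \<notin> pins I" by auto
  obtain a where a: "admits I w a" using ex_admits Suc.prems by blast
  have "V - pins (full w a # I) = (V - pins I) - {w}" by auto
  then have "card (V - pins (full w a # I)) = n"
    using w Suc.hyps(2) finite_V by simp
  then have "ncol (full w a # I) > 0"
    using w Suc.prems by (intro Suc.hyps(1)) (auto simp: pins_def)
  then have "card {\<sigma> \<in> cols I. \<sigma> w = a} > 0" using card_cols_color[OF w] a by simp
  then have "cols I \<noteq> {}" by (metis (no_types, lifting) card_gt_0_iff empty_Collect_eq empty_iff)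
  then show ?case by (simp add: ncol_def card_gt_0_iff)
qed

end

section \<open>The success probability of one round at a vertex\<close>

lemma card_first_occurrence:
  assumes "finite S"
  shows "card {s \<in> S. \<exists>i<(n::nat). P s i} = (\<Sum>i<n. card {s \<in> S. P s i \<and> (\<forall>i'<i. \<not> P s i')})"
proof (induct n)
  case (Suc n)
  have "{s \<in> S. \<exists>i<Suc n. P s i} =
      {s \<in> S. \<exists>i<n. P s i} \<union> {s \<in> S. P s n \<and> (\<forall>i'<n. \<not> P s i')}"
    by (auto simp: less_Suc_eq)
  then have "card {s \<in> S. \<exists>i<Suc n. P s i} =
      card {s \<in> S. \<exists>i<n. P s i} + card {s \<in> S. P s n \<and> (\<forall>i'<n. \<not> P s i')}"
    using assms by (auto intro!: card_Un_disjoint)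
  then show ?case using Suc by simp
qed simp

text \<open>Each index below \<open>d\<close> is the quotient of exactly four numbers, all of them
  below \<open>q\<close>.\<close>

lemma sum_div_4:
  fixes f :: "nat \<Rightarrow> real"
  assumes "4 * d \<le> q" and "\<And>i. i \<ge> d \<Longrightarrow> f i = 0"
  shows "(\<Sum>n<q. f (n div 4)) = 4 * (\<Sum>i<d. f i)"
proof -
  have "(\<Sum>n<q. f (n div 4)) = (\<Sum>n<4*d. f (n div 4))"
    using assms by (intro sum.mono_neutral_right) auto
  also have "\<dots> = 4 * (\<Sum>i<d. f i)"
  proof (induction d)
    case (Suc d)
    have "{..<4 * Suc d} = {..<4 * d} \<union> {4*d, 4*d+1, 4*d+2, 4*d+3}" by auto
    then have "(\<Sum>n<4 * Suc d. f (n div 4)) =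
        (\<Sum>n<4*d. f (n div 4)) + (\<Sum>n\<in>{4*d, 4*d+1, 4*d+2, 4*d+3}. f (n div 4))"
      by (simp add: sum.union_disjoint)
    also have "(\<Sum>n\<in>{4*d, 4*d+1, 4*d+2, 4*d+3}. f (n div 4)) = 4 * f d"
    proof -
      have "(4*d+1) div 4 = d" "(4*d+2) div 4 = d" "(4*d+3) div 4 = d" by auto
      then show ?thesis by simp
    qed
    finally show ?case using Suc by simp
  qed simp
  finally show ?thesis .
qed

context coloring_instance begin

definition unblocked :: "frame list \<Rightarrow> nat \<Rightarrow> nat \<Rightarrow> nat \<Rightarrow> bool" where
  "unblocked I v a n \<longleftrightarrow> (\<forall>i<n. \<forall>h \<in> set I. fv h = adj v ! i \<and> blocks h v \<longrightarrow> fx h \<noteq> a)"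

definition frame_at :: "frame list \<Rightarrow> nat \<Rightarrow> frame option" where
  "frame_at I w = find (\<lambda>h. fv h = w) I"

lemma frame_at_None: "frame_at I w = None \<longleftrightarrow> w \<notin> pins I"
  by (auto simp: frame_at_def find_None_iff pins_def)

lemma frame_at_SomeD: "frame_at I w = Some h \<Longrightarrow> h \<in> set I \<and> fv h = w"
  by (auto simp: frame_at_def find_Some_iff)

lemma frame_at_unique:
  assumes "distinct (map fv I)" "frame_at I w = Some h" "h' \<in> set I" "fv h' = w"
  shows "h' = h"
  using assms frame_at_SomeD[OF assms(2)] by (auto simp: distinct_map inj_on_def)

text \<open>The colors of the random set called \<open>B\<close> in the overview. A removed neighbor
  shows its color only if the check of its own frame has already gone past \<open>v\<close>;
  otherwise it imposes nothing on \<open>v\<close>, hence \<open>None\<close>.\<close>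

definition slot_color :: "frame list \<Rightarrow> nat \<Rightarrow> (nat \<Rightarrow> nat) \<Rightarrow> nat \<Rightarrow> nat option" where
  "slot_color I v \<sigma> i = (case frame_at I (adj v ! i) of
     None \<Rightarrow> Some (\<sigma> (adj v ! i))
   | Some h \<Rightarrow> if blocks h v then Some (fx h) else None)"

definition marg :: "frame list \<Rightarrow> nat \<Rightarrow> nat \<Rightarrow> real" where
  "marg I w a = (if admits I w a then real (ncol (full w a # I)) / real (ncol I) else 0)"

definition accept :: "frame list \<Rightarrow> nat \<Rightarrow> nat \<Rightarrow> real" where
  "accept I w a = real q / 2 * marg I w a"

text \<open>The probability that the check of a frame gets from index \<open>j\<close> to index \<open>n\<close>, and the
  probability that its experiment then succeeds. The factor for the chosen neighbor is \<open>1\<close> if that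
  neighbor has been removed, since \<open>x\<close> is then its color.\<close>

fun pass :: "frame list \<Rightarrow> frame \<Rightarrow> nat \<Rightarrow> real" where
  "pass I (Frame v c x f j) n = (if unblocked I v x n
     then real (ncol (Frame v c x f n # I)) / real (ncol (Frame v c x f j # I)) else 0)"

fun win :: "frame list \<Rightarrow> frame \<Rightarrow> real" where
  "win I (Frame v c x f j) =
     (if f = 0 then pass I (Frame v c x f j) (deg v)
      else pass I (Frame v c x f j) (f - 1) *
        (if adj v ! (f - 1) \<in> pins I then 1
         else accept (Frame v c x f (f - 1) # I) (adj v ! (f - 1)) x) * accept I v c)"

lemma marg_mult:
  assumes "w \<in> V" "w \<notin> pins I" "distinct (map fv I)"
  shows "real (ncol I) * marg I w a = real (card {\<sigma> \<in> cols I. \<sigma> w = a})"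
  using card_cols_color[OF assms(1,2), of a] ncol_pos[OF assms(3)] by (simp add: marg_def)

lemma marg_nonneg: "marg I w a \<ge> 0"
  by (simp add: marg_def)

lemma sum_marg:
  assumes "w \<in> V" "w \<notin> pins I" "distinct (map fv I)"
  shows "(\<Sum>a\<in>{1..q}. marg I w a) = 1"
proof -
  have "\<sigma> w \<in> {1..q}" if "\<sigma> \<in> cols I" for \<sigma>
    using colsD(1)[OF that] assms(1,2) by (meson DiffI PiE_mem)
  then have "cols I = (\<Union>a\<in>{1..q}. {\<sigma> \<in> cols I. \<sigma> w = a})" by blast
  also have "card \<dots> = (\<Sum>a\<in>{1..q}. card {\<sigma> \<in> cols I. \<sigma> w = a})"
    by (rule card_UN_disjoint) auto
  finally have "real (ncol I) = (\<Sum>a\<in>{1..q}. real (card {\<sigma> \<in> cols I. \<sigma> w = a}))"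
    unfolding ncol_def of_nat_sum[symmetric] by (rule arg_cong)
  also have "\<dots> = real (ncol I) * (\<Sum>a\<in>{1..q}. marg I w a)"
    unfolding sum_distrib_left by (rule sum.cong) (simp_all only: marg_mult[OF assms])
  finally have "real (ncol I) = real (ncol I) * (\<Sum>a\<in>{1..q}. marg I w a)" .
  then show ?thesis using ncol_pos[OF assms(3)] by simp
qed

end

locale vertex_instance = coloring_instance +
  fixes I :: "frame list" and v :: nat
  assumes v: "v \<in> V" "v \<notin> pins I" and dist: "distinct (map fv I)"
    and valid: "\<And>h. h \<in> set I \<Longrightarrow> fx h \<in> {1..q}"
begin

lemma distinct_Frame: "distinct (map fv (Frame v c x f j # I))"
  using v(2) dist by (simp add: pins_def)

text \<open>The colorings after deletion of \<open>v\<close>: the sample space on which the slot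
  colors are random.\<close>

abbreviation S0 where "S0 \<equiv> cols (Frame v 0 0 0 0 # I)"

lemma blocks_0 [simp]: "\<not> blocks (Frame v c x f 0) w"
  by (simp add: blocks_def)

lemma cols_Frame:
  "\<sigma> \<in> cols (Frame v c x f j # I) \<longleftrightarrow>
     \<sigma> \<in> S0 \<and> (\<forall>w\<in>set (take j (adj v)). w \<notin> pins I \<longrightarrow> \<sigma> w \<noteq> x)"
  (is "?l \<longleftrightarrow> ?r")
proof
  assume l: ?l
  have "\<sigma> w \<noteq> x" if "w \<in> set (take j (adj v))" "w \<notin> pins I" for w
  proof -
    have "w \<in> set (adj v)" using that(1) by (meson in_set_takeD)
    then have "w \<in> V" "w \<noteq> v" using adj_V by blast+
    then show ?thesis
      using colsD(3)[OF l, of "Frame v c x f j" w] that by (simp add: blocks_def)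
  qed
  moreover have "\<sigma> \<in> S0"
    using colsD[OF l] by (intro colsI) auto
  ultimately show ?r by blast
next
  assume r: ?r
  then have s: "\<sigma> \<in> S0" by blast
  show ?l
    using colsD[OF s] r by (intro colsI) (auto simp: blocks_def)
qed

lemma S0_eq: "cols (Frame v c x f 0 # I) = S0"
  by (rule set_eqI, subst cols_Frame) simp

text \<open>The removed neighbors are taken care of by \<open>unblocked\<close>, so forbidding
  \<open>a\<close> at the free ones means that no slot at all shows \<open>a\<close>.\<close>

lemma cols_unblocked:
  assumes "j \<le> deg v" "unblocked I v a j"
  shows "cols (Frame v c a f j # I) = {\<sigma> \<in> S0. \<forall>i<j. slot_color I v \<sigma> i \<noteq> Some a}"
proof -
  have "(\<forall>w\<in>set (take j (adj v)). w \<notin> pins I \<longrightarrow> \<sigma> w \<noteq> a) \<longleftrightarrow> (\<forall>i<j. slot_color I v \<sigma> i \<noteq> Some a)"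
    (is "?l \<longleftrightarrow> ?r") for \<sigma>
  proof
    assume l: ?l
    show ?r
    proof (intro allI impI)
      fix i assume i: "i < j"
      then have "adj v ! i \<in> set (take j (adj v))"
        using assms(1) by (metis in_set_conv_nth length_take min.absorb2 nth_take)
      then show "slot_color I v \<sigma> i \<noteq> Some a"
        using l assms(2) i frame_at_None[of I "adj v ! i"] frame_at_SomeD[of I "adj v ! i"]
        by (auto simp: slot_color_def unblocked_def split: option.splits)
    qed
  next
    assume r: ?r
    show ?l
    proof (intro ballI impI)
      fix w assume "w \<in> set (take j (adj v))" "w \<notin> pins I"
      then obtain i where "i < j" "w = adj v ! i" "frame_at I w = None"
        using assms(1) frame_at_None by (auto simp: in_set_conv_nth)
      then show "\<sigma> w \<noteq> a" using r by (auto simp: slot_color_def split: option.splits)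
    qed
  qed
  then show ?thesis by (intro set_eqI, subst cols_Frame) simp
qed

lemma not_unblocked_empty:
  assumes "\<not> unblocked I v a j"
  shows "{\<sigma> \<in> S0. \<forall>i<j. slot_color I v \<sigma> i \<noteq> Some a} = {}"
proof -
  obtain i h where *: "i < j" "h \<in> set I" "fv h = adj v ! i" "blocks h v" "fx h = a"
    using assms by (auto simp: unblocked_def)
  then have "adj v ! i \<in> pins I" by (auto simp: pins_def intro!: image_eqI[of _ _ h])
  then obtain h' where "frame_at I (adj v ! i) = Some h'" using frame_at_None by fastforce
  then have "frame_at I (adj v ! i) = Some h" using frame_at_unique[OF dist] * by metis
  then have "slot_color I v \<sigma> i = Some a" for \<sigma> using * by (simp add: slot_color_def)
  then show ?thesis using * by auto
qed

lemma admits_iff_unblocked: "a \<in> {1..q} \<Longrightarrow> admits I v a \<longleftrightarrow> unblocked I v a (deg v)"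
proof -
  assume a: "a \<in> {1..q}"
  have "\<exists>i<deg v. fv h = adj v ! i" if "blocks h v" for h
    using blocks_adj[OF that] adj_sym by (metis in_set_conv_nth)
  then show ?thesis using a unfolding admits_def unblocked_def by blast
qed

definition avail :: "nat \<Rightarrow> real" where
  "avail a = real (card {\<sigma> \<in> S0. \<forall>i<deg v. slot_color I v \<sigma> i \<noteq> Some a})"

definition used :: "nat \<Rightarrow> real" where
  "used a = real (card {\<sigma> \<in> S0. \<exists>i<deg v. slot_color I v \<sigma> i = Some a})"

definition first :: "nat \<Rightarrow> nat \<Rightarrow> real" where
  "first i a = real (card {\<sigma> \<in> S0. slot_color I v \<sigma> i = Some a \<and> (\<forall>i'<i. slot_color I v \<sigma> i' \<noteq> Some a)})"

abbreviation N0 :: real where "N0 \<equiv> real (card S0)"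

lemma N0_pos: "N0 > 0"
  using ncol_pos[OF distinct_Frame[of 0 0 0 0]] by (simp add: ncol_def)

lemma used_first: "used a = (\<Sum>i<deg v. first i a)"
  unfolding used_def first_def by (subst card_first_occurrence) simp_all

lemma avail_used: "avail a = N0 - used a"
proof -
  let ?A = "{\<sigma> \<in> S0. \<forall>i<deg v. slot_color I v \<sigma> i \<noteq> Some a}"
  let ?B = "{\<sigma> \<in> S0. \<exists>i<deg v. slot_color I v \<sigma> i = Some a}"
  have "?A \<union> ?B = S0" by blast
  moreover have "card (?A \<union> ?B) = card ?A + card ?B"
    by (rule card_Un_disjoint) auto
  ultimately have "card S0 = card ?A + card ?B" by simp
  then show ?thesis by (simp add: avail_def used_def)
qed

lemma card_unblocked:
  assumes "j \<le> deg v"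
  shows "(if unblocked I v a j then real (ncol (Frame v c a f j # I)) else 0) =
    real (card {\<sigma> \<in> S0. \<forall>i<j. slot_color I v \<sigma> i \<noteq> Some a})"
proof (cases "unblocked I v a j")
  case True
  then show ?thesis by (simp only: ncol_def cols_unblocked[OF assms True] if_True)
next
  case False
  then show ?thesis by (simp only: not_unblocked_empty[OF False] card.empty if_False)
qed

lemma full_card:
  assumes "a \<in> {1..q}"
  shows "(if admits I v a then real (ncol (full v a # I)) else 0) = avail a"
  using card_unblocked[of "deg v" a a 0] by (simp only: admits_iff_unblocked[OF assms] full_def avail_def order_refl)

lemma marg_avail: "a \<in> {1..q} \<Longrightarrow> marg I v a = avail a / real (ncol I)"
  unfolding marg_def by (simp only: full_card[symmetric] if_distrib[of "\<lambda>x. x / _"] div_0)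

text \<open>A coloring in which \<open>v\<close> is present is a coloring without \<open>v\<close>
  together with a color that is available at \<open>v\<close>.\<close>

lemma sum_avail: "(\<Sum>a\<in>{1..q}. avail a) = real (ncol I)"
proof -
  have "(\<Sum>a\<in>{1..q}. avail a) / real (ncol I) = (\<Sum>a\<in>{1..q}. marg I v a)"
    unfolding sum_divide_distrib by (rule sum.cong) (simp_all only: marg_avail)
  also have "\<dots> = 1" by (rule sum_marg[OF v dist])
  finally show ?thesis using ncol_pos[OF dist] by (simp only: divide_eq_1_iff)
qed

lemma pass_eq:
  assumes "n \<le> deg v"
  shows "pass I (Frame v c a f 0) n = real (card {\<sigma> \<in> S0. \<forall>i<n. slot_color I v \<sigma> i \<noteq> Some a}) / N0"
proof -
  have "pass I (Frame v c a f 0) n = (if unblocked I v a n then real (ncol (Frame v c a f n # I)) else 0) / N0"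
    by (simp add: ncol_def S0_eq[of c a f])
  then show ?thesis by (simp only: card_unblocked[OF assms])
qed

lemma win_final: "win I (Frame v c c 0 0) = avail c / N0"
  by (simp only: win.simps simp_thms if_True pass_eq[OF order_refl] avail_def)

text \<open>The mean success probability of a round without final check that has drawn index
  \<open>i\<close>: a free neighbor is tested for a uniform color, a removed one for its own color,
  and this in only one of the two equally likely outcomes 2 and 3.\<close>

definition slot_value :: "nat \<Rightarrow> nat \<Rightarrow> real" where
  "slot_value c i = (if i \<ge> deg v then 0 else
     case frame_at I (adj v ! i) of
       None \<Rightarrow> (\<Sum>a\<in>{1..q}. win I (Frame v c a (i + 1) 0)) / real q
     | Some h \<Rightarrow> if blocks h v then win I (Frame v c (fx h) (i + 1) 0) / 2 else 0)"

text \<open>At a free neighbor the weight \<open>1 / q\<close> of each color meets the factor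
  \<open>q / 2\<close> of the experiment and leaves 1/2; at a removed neighbor 1/2 is the chance of
  outcome 2. So both kinds of slots count first occurrences with the same factor, and
  \<open>accept I v c\<close> stems from starting over.\<close>

lemma slot_value_eq:
  assumes i: "i < deg v"
  shows "slot_value c i = accept I v c / (2 * N0) * (\<Sum>a\<in>{1..q}. first i a)"
proof (cases "frame_at I (adj v ! i)")
  case None
  let ?w = "adj v ! i"
  have w: "?w \<notin> pins I" "?w \<in> V" "?w \<noteq> v"
    using None frame_at_None i adj_V nth_mem by blast+
  have "win I (Frame v c a (i + 1) 0) = real q * (accept I v c / (2 * N0) * first i a)" for a
  proof (cases "unblocked I v a i")
    case True
    let ?g = "Frame v c a (i + 1) i"
    have "{\<sigma> \<in> cols (?g # I). \<sigma> ?w = a} =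
        {\<sigma> \<in> S0. slot_color I v \<sigma> i = Some a \<and> (\<forall>i'<i. slot_color I v \<sigma> i' \<noteq> Some a)}"
      unfolding cols_unblocked[OF less_imp_le[OF i] True] by (auto simp: slot_color_def[of I v _ i] None)
    then have f: "real (ncol (?g # I)) * marg (?g # I) ?w a = first i a"
      using w by (subst marg_mult[OF _ _ distinct_Frame]) (simp_all add: first_def)
    have "win I (Frame v c a (i + 1) 0) =
        real (ncol (?g # I)) / N0 * (real q / 2 * marg (?g # I) ?w a) * accept I v c"
      using True w by (simp add: ncol_def S0_eq[of c a "Suc i"] accept_def)
    also have "\<dots> = real q * (accept I v c / (2 * N0) * (real (ncol (?g # I)) * marg (?g # I) ?w a))"
      by (simp add: mult_ac)
    finally show ?thesis unfolding f .
  next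
    case False
    have "{\<sigma> \<in> S0. slot_color I v \<sigma> i = Some a \<and> (\<forall>i'<i. slot_color I v \<sigma> i' \<noteq> Some a)} = {}"
      using not_unblocked_empty[OF False] by blast
    then have "first i a = 0" by (simp only: first_def card.empty of_nat_0)
    then show ?thesis using False by simp
  qed
  then have "(\<Sum>a\<in>{1..q}. win I (Frame v c a (i + 1) 0)) =
      real q * (accept I v c / (2 * N0) * (\<Sum>a\<in>{1..q}. first i a))"
    by (simp only: sum_distrib_left)
  then show ?thesis
    using i None q_pos by (simp add: slot_value_def del: win.simps)
next
  case (Some h)
  show ?thesis
  proof (cases "blocks h v")
    case True
    have "adj v ! i \<in> pins I" using Some frame_at_None by (metis option.distinct(1))
    then have w: "win I (Frame v c (fx h) (i + 1) 0) =
        pass I (Frame v c (fx h) (i + 1) 0) i * accept I v c" by simp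
    \<comment> \<open>The slot shows the same color in every coloring, so it is a first occurrence
      exactly when the earlier slots avoid that color.\<close>
    have "first i a = (if a = fx h then pass I (Frame v c (fx h) (i + 1) 0) i * N0 else 0)" for a
    proof -
      have "slot_color I v \<sigma> i = Some (fx h)" for \<sigma> using True Some by (simp add: slot_color_def)
      then show ?thesis unfolding pass_eq[OF less_imp_le[OF i]] first_def using N0_pos by simp
    qed
    then have "(\<Sum>a\<in>{1..q}. first i a) = pass I (Frame v c (fx h) (i + 1) 0) i * N0"
      using valid frame_at_SomeD[OF Some] by (simp del: pass.simps)
    moreover have "S0 \<noteq> {}" using N0_pos by force
    ultimately show ?thesis using i Some True w by (simp add: slot_value_def del: pass.simps win.simps)
  next
    case False
    then have "slot_color I v \<sigma> i = None" for \<sigma> using Some by (simp add: slot_color_def)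
    then have "first i a = 0" for a by (simp add: first_def)
    then show ?thesis using i Some False by (simp add: slot_value_def)
  qed
qed

text \<open>Conditioning on the colors outside \<open>v\<close>, a uniform color is available at \<open>v\<close> with probability
  \<open>ncol I / (q * N0)\<close>; it is unavailable iff some slot is the first one to carry it.\<close>

lemma round_identity:
  assumes c: "c \<in> {1..q}"
  shows "accept I v c = win I (Frame v c c 0 0) / 2 + (\<Sum>n<q. slot_value c (n div 4)) / (2 * real q)"
proof -
  have "4 * deg v \<le> q" using deg_le[of v] colors by simp
  then have "(\<Sum>n<q. slot_value c (n div 4)) = 4 * (\<Sum>i<deg v. slot_value c i)"
    by (rule sum_div_4) (simp add: slot_value_def)
  also have "(\<Sum>i<deg v. slot_value c i) =
      accept I v c / (2 * N0) * (\<Sum>i<deg v. \<Sum>a\<in>{1..q}. first i a)"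
    by (simp add: slot_value_eq sum_distrib_left)
  also have "(\<Sum>i<deg v. \<Sum>a\<in>{1..q}. first i a) = (\<Sum>a\<in>{1..q}. used a)"
    unfolding used_first by (rule sum.swap)
  also have "\<dots> = real q * N0 - real (ncol I)"
    using sum_avail by (simp add: avail_used sum_subtractf)
  finally have s: "(\<Sum>n<q. slot_value c (n div 4)) =
      4 * (accept I v c / (2 * N0) * (real q * N0 - real (ncol I)))" .
  have inn: "accept I v c * real (ncol I) = real q / 2 * avail c"
    using marg_avail[OF c] ncol_pos[OF dist] by (simp add: accept_def)
  have q: "real q \<noteq> 0" "N0 \<noteq> 0" using q_pos N0_pos by auto
  \<comment> \<open>The four representatives of an index cancel both factors 1/2; what remains is
    \<open>accept\<close> times the probability that a uniform color is in use.\<close>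
  have "(\<Sum>n<q. slot_value c (n div 4)) / (2 * real q) =
      accept I v c - accept I v c * real (ncol I) / (real q * N0)"
    unfolding s using q by (simp add: field_simps)
  also have "\<dots> = accept I v c - win I (Frame v c c 0 0) / 2"
    unfolding inn win_final using q by (simp add: field_simps)
  finally show ?thesis by simp
qed

text \<open>In a fixed coloring each slot is the first occurrence of at most one color.\<close>

lemma used_sum_le: "(\<Sum>a\<in>{1..q}. used a) \<le> real \<Delta> * N0"
proof -
  have "(\<Sum>a\<in>{1..q}. used a) = (\<Sum>i<deg v. \<Sum>a\<in>{1..q}. first i a)"
    unfolding used_first by (rule sum.swap)
  also have "\<dots> \<le> (\<Sum>i<deg v. N0)"
  proof (rule sum_mono)
    fix i
    define B where "B a = {\<sigma> \<in> S0. slot_color I v \<sigma> i = Some a \<and> (\<forall>i'<i. slot_color I v \<sigma> i' \<noteq> Some a)}" for a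
    have fin: "finite (B a)" for a unfolding B_def by (rule finite_subset[OF _ finite_cols]) blast
    have disj: "B a \<inter> B b = {}" if "a \<noteq> b" for a b using that unfolding B_def by force
    have "(\<Sum>a\<in>{1..q}. first i a) = real (\<Sum>a\<in>{1..q}. card (B a))"
      by (simp only: first_def B_def of_nat_sum)
    also have "(\<Sum>a\<in>{1..q}. card (B a)) = card (\<Union>a\<in>{1..q}. B a)"
      using fin disj by (intro card_UN_disjoint[symmetric]) simp_all
    also have "\<dots> \<le> card S0" by (intro card_mono finite_cols) (unfold B_def, blast)
    finally show "(\<Sum>a\<in>{1..q}. first i a) \<le> N0" by simp
  qed
  also have "\<dots> \<le> real \<Delta> * N0" using deg_le[of v] by (simp add: mult_right_mono)
  finally show ?thesis .
qed

text \<open>Of the \<open>q * N0\<close> pairs of a coloring without \<open>v\<close> and a color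
  for \<open>v\<close>, at most \<open>\<Delta> * N0\<close> conflict. As \<open>\<Delta>\<close> is
  at most \<open>q / 2\<close>, this leaves \<open>ncol I\<close> at least
  \<open>q / 2 * N0\<close>, while \<open>avail c\<close> is at most \<open>N0\<close>.\<close>

lemma accept_le_1:
  shows "accept I v c \<le> 1"
proof (cases "c \<in> {1..q}")
  case True
  have NI: "real (ncol I) = real q * N0 - (\<Sum>a\<in>{1..q}. used a)"
    using sum_avail by (simp add: avail_used sum_subtractf)
  have "avail c \<le> N0" using avail_used[of c] by (simp add: used_def)
  then have "real q / 2 * avail c \<le> real q / 2 * N0" by (simp add: mult_left_mono)
  also have "\<dots> \<le> real (ncol I)"
  proof -
    have "real \<Delta> * N0 \<le> real q / 2 * N0" using colors N0_pos by (intro mult_right_mono) auto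
    then show ?thesis using NI used_sum_le by simp
  qed
  finally have "real q / 2 * avail c / real (ncol I) \<le> 1"
    using ncol_pos[OF dist] by simp
  then show ?thesis by (simp add: accept_def marg_avail[OF True])
next
  case False
  then show ?thesis by (auto simp: accept_def marg_def admits_def)
qed

end

section \<open>The sampling machine\<close>

text \<open>In \<open>Rnd\<close> the innermost experiment is about to begin a round, in
  \<open>Slt\<close> it examines the neighbor at its current index, in \<open>Ret b\<close> it has
  ended with result \<open>b\<close>.\<close>

datatype mode = Rnd | Slt | Ret bool

type_synonym mstate = "mode \<times> frame list \<times> frame list"
type_synonym draws = "nat \<times> nat \<times> nat"

fun advance :: "frame \<Rightarrow> frame" where
  "advance (Frame v c x f j) = Frame v c x f (j + 1)"

locale sampler = coloring_instance +
  fixes vs :: "nat list"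
  assumes vs: "distinct vs" "set vs \<subseteq> V"
begin

text \<open>The machine holds the frames of the running experiments, innermost first, and the frames of the
  finished vertices. A neighbor must be chosen with probability \<open>2 / q\<close>, and a round without final
  check has probability \<open>1/2\<close>; so each index is represented by four of the \<open>q\<close> values of \<open>n1\<close>.
  A removed neighbor has a known color instead of a uniform one, so it is to be chosen with
  probability \<open>1 / q\<close> only; this is the purpose of \<open>t \<le> 2\<close>.\<close>

fun mstep :: "draws \<Rightarrow> mstate \<Rightarrow> mstate" where
  "mstep (t, n1, n2) (md, [], dn) =
     (if length dn < length vs
      then (Rnd, [Frame (vs ! length dn) (n2 + 1) (n2 + 1) 0 0], dn) else (md, [], dn))"
| "mstep (t, n1, n2) (Rnd, Frame v c x f j # ps, dn) =
     (if t \<le> 1 then (Slt, Frame v c c 0 0 # ps, dn)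
      else if n1 div 4 \<ge> deg v then (Ret False, Frame v c x (n1 div 4 + 1) 0 # ps, dn)
      else case frame_at (ps @ dn) (adj v ! (n1 div 4)) of
          None \<Rightarrow> (Slt, Frame v c (n2 + 1) (n1 div 4 + 1) 0 # ps, dn)
        | Some h \<Rightarrow> if blocks h v \<and> t \<le> 2 then (Slt, Frame v c (fx h) (n1 div 4 + 1) 0 # ps, dn)
            else (Ret False, Frame v c x (n1 div 4 + 1) 0 # ps, dn))"
| "mstep (t, n1, n2) (Slt, Frame v c x f j # ps, dn) =
     (if j \<ge> deg v then (Ret (f = 0), Frame v c x f j # ps, dn)
      else case frame_at (ps @ dn) (adj v ! j) of
          None \<Rightarrow> if f = j + 1 \<or> t = 0
            then (Rnd, Frame (adj v ! j) x x 0 0 # Frame v c x f j # ps, dn)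
            else (Slt, Frame v c x f (j + 1) # ps, dn)
        | Some h \<Rightarrow> if f = j + 1 then (Rnd, Frame v c x f j # ps, dn)
            else if blocks h v \<and> fx h = x then (Ret False, Frame v c x f j # ps, dn)
            else (Slt, Frame v c x f (j + 1) # ps, dn))"
| "mstep (t, n1, n2) (Ret b, [g], dn) = (Rnd, [], if b then g # dn else dn)"
| "mstep (t, n1, n2) (Ret b, h # Frame v c x f j # ps, dn) =
     (if f = j + 1 then (if b then Rnd else Ret False, Frame v c x f j # ps, dn)
      else if b then (Ret False, Frame v c x f j # ps, dn)
      else (Slt, Frame v c x f (j + 1) # ps, dn))"

fun legal :: "frame list \<Rightarrow> bool" where
  "legal [] \<longleftrightarrow> True"
| "legal (Frame v c x f j # I) \<longleftrightarrow> legal I \<and> v \<in> V \<and> v \<notin> pins I \<and> c \<in> {1..q} \<and> x \<in> {1..q} \<and>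
     j \<le> deg v \<and> unblocked I v x j"

text \<open>Either a final check, about the target color, or the chosen neighbor still lies ahead:
  once it is reached, the experiment starts over or fails.\<close>

fun well_placed :: "frame \<Rightarrow> bool" where
  "well_placed (Frame v c x f j) \<longleftrightarrow> f = 0 \<and> x = c \<or> j < f \<and> f \<le> deg v"

text \<open>The neighbor asked about is free with respect to the outer frames; this keeps
  \<open>unblocked\<close> true when a negative answer moves the check to
  \<open>j + 1\<close>.\<close>

fun waits :: "frame list \<Rightarrow> frame list \<Rightarrow> bool" where
  "waits [] dn \<longleftrightarrow> True"
| "waits (Frame v c x f j # ps) dn \<longleftrightarrow> waits ps dn \<and> j < deg v \<and> adj v ! j \<notin> pins (ps @ dn) \<and>
     well_placed (Frame v c x f j)"

definition done_ok :: "frame list \<Rightarrow> bool" where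
  "done_ok dn \<longleftrightarrow> length dn \<le> length vs \<and> map fv dn = rev (take (length dn) vs) \<and>
     (\<forall>h \<in> set dn. fj h = deg (fv h))"

text \<open>Success is reported only at the end of a final check, where the frame has become the
  \<open>full\<close> frame of its target color. It can therefore join the finished vertices
  unchanged.\<close>

fun invar :: "mstate \<Rightarrow> bool" where
  "invar (md, [], dn) \<longleftrightarrow> legal dn \<and> done_ok dn"
| "invar (md, g # ps, dn) \<longleftrightarrow> legal (g # ps @ dn) \<and> done_ok dn \<and> length dn < length vs \<and>
     fv (last (g # ps)) = vs ! length dn \<and> waits ps dn \<and> (md = Slt \<longrightarrow> well_placed g) \<and>
     (md = Ret True \<longrightarrow> g = full (fv g) (fc g))"

lemma legal_distinct: "legal I \<Longrightarrow> distinct (map fv I)"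
  by (induction I rule: legal.induct) (auto simp: pins_def)

lemma legal_color: "legal I \<Longrightarrow> h \<in> set I \<Longrightarrow> fx h \<in> {1..q} \<and> fc h \<in> {1..q} \<and> fv h \<in> V"
  by (induction I rule: legal.induct) auto

lemma unblocked_0 [simp]: "unblocked I v a 0"
  by (simp add: unblocked_def)

lemma unblocked_Suc_None:
  assumes "unblocked I v a j" "adj v ! j \<notin> pins I"
  shows "unblocked I v a (Suc j)"
proof -
  have "fv h \<noteq> adj v ! j" if "h \<in> set I" for h
    using assms(2) that unfolding pins_def by (metis image_eqI)
  then show ?thesis using assms(1) by (auto simp: unblocked_def less_Suc_eq)
qed

lemma unblocked_Suc_Some:
  assumes "unblocked I v a j" "legal I" "frame_at I (adj v ! j) = Some h" "\<not> (blocks h v \<and> fx h = a)"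
  shows "unblocked I v a (Suc j)"
  using assms frame_at_unique[OF legal_distinct[OF assms(2)] assms(3)] by (auto simp: unblocked_def less_Suc_eq)

lemma adj_nth: "j < deg v \<Longrightarrow> adj v ! j \<in> V" "j < deg v \<Longrightarrow> adj v ! j \<noteq> v"
  using adj_V nth_mem by blast+

lemma invar_cases:
  assumes "invar s"
  obtains md dn where "s = (md, [], dn)"
  | v c x f j ps dn where "s = (Rnd, Frame v c x f j # ps, dn)"
  | v c x f j ps dn where "s = (Slt, Frame v c x f j # ps, dn)"
  | b g dn where "s = (Ret b, [g], dn)"
  | b h v c x f j ps dn where "s = (Ret b, h # Frame v c x f j # ps, dn)"
  by (metis frame.exhaust mode.exhaust neq_Nil_conv prod_cases3)

lemma invar_mstep:
  assumes "invar s" "n2 < q"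
  shows "invar (mstep (t, n1, n2) s)"
  using assms(1)
proof (cases rule: invar_cases)
  case (1 md dn)
  show ?thesis
  proof (cases "length dn < length vs")
    case True
    have "map fv dn = rev (take (length dn) vs)"
      using assms 1 by (simp add: done_ok_def)
    then have "pins dn = set (take (length dn) vs)"
      unfolding pins_def by (metis set_map set_rev)
    moreover have "vs ! length dn \<notin> set (take (length dn) vs)"
      using id_take_nth_drop[OF True] vs(1)
      by (metis disjoint_iff distinct_append list.set_intros(1))
    ultimately have "vs ! length dn \<notin> pins dn" by simp
    moreover have "vs ! length dn \<in> V" using True vs(2) by auto
    ultimately show ?thesis using True assms 1 by simp
  qed (use assms 1 in simp)
next
  case (2 v c x f j ps dn)
  have legal: "legal (ps @ dn)" using assms 2 by simp
  show ?thesis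
  proof (cases "frame_at (ps @ dn) (adj v ! (n1 div 4))")
    case None
    then show ?thesis using assms 2 by (auto simp: Suc_le_eq)
  next
    case (Some h)
    then have "fx h \<in> {1..q}" using legal_color[OF legal] frame_at_SomeD by blast
    then show ?thesis using assms 2 Some by (auto simp: Suc_le_eq)
  qed
next
  case (3 v c x f j ps dn)
  have legal: "legal (ps @ dn)" using assms 3 by simp
  show ?thesis
  proof (cases "j < deg v")
    case True
    show ?thesis
    proof (cases "frame_at (ps @ dn) (adj v ! j)")
      case None
      then have "adj v ! j \<notin> pins (ps @ dn)" using frame_at_None by blast
      then show ?thesis
        using assms 3 None True unblocked_Suc_None adj_nth by (auto simp: Suc_le_eq)
    next
      case (Some h)
      then show ?thesis
        using assms 3 True unblocked_Suc_Some[OF _ legal Some] by (auto simp: Suc_le_eq)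
    qed
  next
    case False
    then show ?thesis using assms 3 by (auto simp: full_def)
  qed
next
  case (4 b g dn)
  then obtain v c x f j where g: "g = Frame v c x f j" by (cases g)
  show ?thesis
  proof (cases b)
    case True
    then show ?thesis using assms 4 g
      by (auto simp: done_ok_def full_def take_Suc_conv_app_nth)
  qed (use assms 4 g in auto)
next
  case (5 b h v c x f j ps dn)
  then show ?thesis
    using assms unblocked_Suc_None by (cases h) (auto simp: Suc_le_eq)
qed

section \<open>The success probability of the outermost experiment as a martingale\<close>

definition expect :: "(draws \<Rightarrow> real) \<Rightarrow> real" where
  "expect g = (\<Sum>t<4. \<Sum>n1<q. \<Sum>n2<q. tag_prob q t / (real q)\<^sup>2 * g (t, n1, n2))"

lemma lessThan_4: "{..<4::nat} = {0, 1, 2, 3}" by auto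

lemma tag_prob_nonneg: "tag_prob q t \<ge> 0"
  using colors degree_pos by (auto simp: tag_prob_def field_simps)

lemma expect_mono:
  assumes "\<And>t n1 n2. n1 < q \<Longrightarrow> n2 < q \<Longrightarrow> g (t, n1, n2) \<le> h (t, n1, n2)"
  shows "expect g \<le> expect h"
  unfolding expect_def using assms tag_prob_nonneg by (intro sum_mono mult_left_mono) auto

lemma expect_cong:
  assumes "\<And>t n1 n2. n1 < q \<Longrightarrow> n2 < q \<Longrightarrow> g (t, n1, n2) = h (t, n1, n2)"
  shows "expect g = expect h"
  unfolding expect_def using assms by (intro sum.cong) auto

lemma expect_t: "expect (\<lambda>(t, n1, n2). h t) = (\<Sum>t<4. tag_prob q t * h t)"
  unfolding expect_def using q_pos by (simp add: power2_eq_square)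

lemma expect_n2: "expect (\<lambda>(t, n1, n2). h n2) = (\<Sum>n<q. h n) / real q"
proof -
  have "expect (\<lambda>(t, n1, n2). h n2) = (\<Sum>t<4. tag_prob q t) * (\<Sum>n<q. h n) / real q"
    unfolding expect_def using q_pos
    by (simp add: power2_eq_square sum_distrib_left[symmetric] sum_distrib_right[symmetric]
      sum_divide_distrib[symmetric])
  then show ?thesis by (simp add: lessThan_4 tag_prob_def)
qed

lemma expect_const: "expect (\<lambda>_. c) = c"
  using expect_n2[of "\<lambda>_. c"] q_pos by (simp add: case_prod_unfold)

lemma expect_add: "expect (\<lambda>d. g d + h d) = expect g + expect h"
  by (simp add: expect_def algebra_simps sum.distrib)

lemma expect_cmult: "expect (\<lambda>d. c * g d) = c * expect g"
  by (simp add: expect_def sum_distrib_left mult_ac)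

lemma expect_affine: "expect (\<lambda>d. a + b * g d) = a + b * expect g"
  by (simp add: expect_add expect_cmult expect_const)

text \<open>The success probability of an experiment as a function of the one that it is waiting for.\<close>

fun parent_prob :: "frame list \<Rightarrow> frame \<Rightarrow> real \<Rightarrow> real" where
  "parent_prob I (Frame v c x f j) a =
     (if f = j + 1 then a * accept I v c else (1 - a) * win I (Frame v c x f (j + 1)))"

fun propagate :: "real \<Rightarrow> frame list \<Rightarrow> frame list \<Rightarrow> real" where
  "propagate a [] dn = a"
| "propagate a (g # ps) dn = propagate (parent_prob (ps @ dn) g a) ps dn"

fun top_prob :: "mode \<Rightarrow> frame list \<Rightarrow> frame \<Rightarrow> real" where
  "top_prob Rnd I g = accept I (fv g) (fc g)"
| "top_prob Slt I g = win I g"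
| "top_prob (Ret b) I g = of_bool b"

fun root_prob :: "mstate \<Rightarrow> real" where
  "root_prob (md, [], dn) = 0"
| "root_prob (md, g # ps, dn) = propagate (top_prob md (ps @ dn) g) ps dn"

text \<open>Each waiting level multiplies \<open>a\<close> or \<open>1 - a\<close> by a constant.
  Affinity is what carries an expectation taken at the top of the stack down to the outermost
  experiment.\<close>

lemma propagate_affine: "\<exists>A B. \<forall>a. propagate a ps dn = A + B * a"
proof (induction ps)
  case Nil
  show ?case by (rule exI[of _ 0], rule exI[of _ 1]) simp
next
  case (Cons g ps)
  then obtain A B where AB: "\<And>a. propagate a ps dn = A + B * a" by blast
  obtain v c x f j where g: "g = Frame v c x f j" by (cases g)
  show ?case
  proof (cases "f = j + 1")
    case True
    then show ?thesis using AB g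
      by (intro exI[of _ A] exI[of _ "B * accept (ps @ dn) v c"]) (simp add: mult_ac)
  next
    case False
    let ?w = "win (ps @ dn) (Frame v c x f (j + 1))"
    show ?thesis using AB g False
      by (intro exI[of _ "A + B * ?w"] exI[of _ "- B * ?w"])
        (simp add: algebra_simps del: win.simps)
  qed
qed

lemma expect_propagate: "expect (\<lambda>d. propagate (g d) ps dn) = propagate (expect g) ps dn"
proof -
  obtain A B where "\<And>a. propagate a ps dn = A + B * a" using propagate_affine by blast
  then show ?thesis by (simp add: expect_affine)
qed

lemma legal_vertex_instance:
  assumes "legal (Frame v c x f j # I)"
  shows "vertex_instance V E adj q \<Delta> I v"
proof
  show "v \<in> V" "v \<notin> pins I" using assms by auto
  show "distinct (map fv I)" using assms legal_distinct by auto
  show "\<And>h. h \<in> set I \<Longrightarrow> fx h \<in> {1..q}" using assms legal_color by auto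
qed

end

context vertex_instance begin

lemma ncol_Frame_Suc_pinned:
  assumes "j < deg v" "adj v ! j \<in> pins I"
  shows "ncol (Frame v c x f (Suc j) # I) = ncol (Frame v c x f j # I)"
proof -
  have "cols (Frame v c x f (Suc j) # I) = cols (Frame v c x f j # I)"
    by (rule set_eqI, subst (1 2) cols_Frame) (use assms in \<open>auto simp: take_Suc_conv_app_nth\<close>)
  then show ?thesis by (simp only: ncol_def)
qed

text \<open>Moving the check past a free neighbor discards exactly the colorings that give
  \<open>x\<close> to it.\<close>

lemma ncol_Frame_Suc_free:
  assumes j: "j < deg v" and w: "adj v ! j \<notin> pins I"
  shows "real (ncol (Frame v c x f (Suc j) # I)) =
    real (ncol (Frame v c x f j # I)) * (1 - marg (Frame v c x f j # I) (adj v ! j) x)"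
proof -
  let ?g = "Frame v c x f j" and ?w = "adj v ! j"
  let ?A = "{\<sigma> \<in> cols (?g # I). \<sigma> ?w = x}"
  have w': "?w \<in> V" "?w \<notin> pins (?g # I)" using w adj_V nth_mem[OF j] by auto
  have "cols (Frame v c x f (Suc j) # I) = cols (?g # I) - ?A"
    by (rule set_eqI, unfold Diff_iff mem_Collect_eq, subst (1 2 3) cols_Frame)
      (use assms in \<open>auto simp: take_Suc_conv_app_nth\<close>)
  then have "ncol (Frame v c x f (Suc j) # I) = ncol (?g # I) - card ?A"
    unfolding ncol_def by (simp only:) (rule card_Diff_subset, auto)
  moreover have "card ?A \<le> ncol (?g # I)" unfolding ncol_def by (intro card_mono finite_cols) blast
  ultimately have "real (ncol (Frame v c x f (Suc j) # I)) = real (ncol (?g # I)) - real (card ?A)"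
    by simp
  then show ?thesis
    unfolding marg_mult[OF w' distinct_Frame, symmetric] by (simp add: algebra_simps)
qed

text \<open>The quotients in \<open>pass\<close> telescope. The exception \<open>f = Suc j\<close>
  is the chosen neighbor, which must be tested instead of being passed.\<close>

lemma win_Suc:
  assumes "f \<noteq> Suc j" 
  shows "win I (Frame v c x f j) =
    real (ncol (Frame v c x f (Suc j) # I)) / real (ncol (Frame v c x f j # I)) *
    win I (Frame v c x f (Suc j))"
proof -
  have p: "pass I (Frame v c x f j) n =
    real (ncol (Frame v c x f (Suc j) # I)) / real (ncol (Frame v c x f j # I)) *
    pass I (Frame v c x f (Suc j)) n" for n
    using ncol_pos[OF distinct_Frame[of c x f "Suc j"]] by simp
  show ?thesis
  proof (cases "f = 0")
    case True
    then show ?thesis using p[of "deg v"] by (simp del: pass.simps)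
  next
    case False
    then show ?thesis using p[of "f - 1"] by (simp del: pass.simps add: mult_ac)
  qed
qed

lemma win_forced:
  assumes "unblocked I v x j"
  shows "win I (Frame v c x (Suc j) j) =
    (if adj v ! j \<in> pins I then 1 else accept (Frame v c x (Suc j) j # I) (adj v ! j) x) *
    accept I v c"
  using assms ncol_pos[OF distinct_Frame[of c x "Suc j" j]] by simp

lemma win_final_end:
  assumes "unblocked I v x (deg v)"
  shows "win I (Frame v c x 0 (deg v)) = 1"
  using assms ncol_pos[OF distinct_Frame[of c x 0 "deg v"]] by simp

lemma win_blocked:
  assumes "f = 0 \<or> j < f" "f \<noteq> Suc j" "j < deg v"
    "h \<in> set I" "fv h = adj v ! j" "blocks h v" "fx h = x"
  shows "win I (Frame v c x f j) = 0"
proof -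
  have no: "\<not> unblocked I v x n" if "j < n" for n using assms that by (auto simp: unblocked_def)
  have "f = 0 \<or> j < f - 1" using assms(1,2) by auto
  then show ?thesis using no assms(3) by auto
qed

end

context sampler begin

text \<open>Outcomes 0 and 1 have total probability 1/2 and lead to the final check; the equally
  likely outcomes 2 and 3 average to \<open>slot_value\<close>. The rest is
  \<open>round_identity\<close>.\<close>

lemma expect_round:
  assumes "vertex_instance V E adj q \<Delta> I v" and c: "c \<in> {1..q}"
  shows "expect (\<lambda>(t, n1, n2). if t \<le> 1 then win I (Frame v c c 0 0)
      else if n1 div 4 \<ge> deg v then 0
      else case frame_at I (adj v ! (n1 div 4)) of
          None \<Rightarrow> win I (Frame v c (n2 + 1) (n1 div 4 + 1) 0)
        | Some h \<Rightarrow> if blocks h v \<and> t \<le> 2 then win I (Frame v c (fx h) (n1 div 4 + 1) 0) else 0)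
    = accept I v c" (is "expect (\<lambda>(t, n1, n2). ?F t n1 n2) = _")
proof -
  interpret vertex_instance V E adj q \<Delta> I v by fact
  let ?W = "win I (Frame v c c 0 0)"
  have q: "real q \<noteq> 0" using q_pos by simp
  have "(\<Sum>n2<q. ?F 2 n1 n2) + (\<Sum>n2<q. ?F 3 n1 n2) = 2 * real q * slot_value c (n1 div 4)" for n1
  proof (cases "n1 div 4 \<ge> deg v")
    case True
    then show ?thesis by (simp add: slot_value_def)
  next
    case False
    show ?thesis
    proof (cases "frame_at I (adj v ! (n1 div 4))")
      case None
      then show ?thesis using False q
        by (simp add: slot_value_def sum.atLeast1_atMost_eq del: win.simps)
    next
      case (Some h)
      then show ?thesis using False q by (simp add: slot_value_def del: win.simps)
    qed
  qed
  then have *: "(\<Sum>n1<q. \<Sum>n2<q. ?F 2 n1 n2) + (\<Sum>n1<q. \<Sum>n2<q. ?F 3 n1 n2) =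
      2 * real q * (\<Sum>n1<q. slot_value c (n1 div 4))"
    by (simp only: sum.distrib[symmetric] sum_distrib_left)
  have "expect (\<lambda>(t, n1, n2). ?F t n1 n2) =
      (\<Sum>t<4. tag_prob q t / (real q)\<^sup>2 * (\<Sum>n1<q. \<Sum>n2<q. ?F t n1 n2))"
    unfolding expect_def sum_distrib_left by (simp only: prod.case)
  also have "\<dots> = (tag_prob q 0 + tag_prob q 1) * ?W + (1/4) / (real q)\<^sup>2 *
      ((\<Sum>n1<q. \<Sum>n2<q. ?F 2 n1 n2) + (\<Sum>n1<q. \<Sum>n2<q. ?F 3 n1 n2))"
    unfolding lessThan_4 using q by (simp add: tag_prob_def power2_eq_square field_simps del: win.simps)
  also have "\<dots> = accept I v c"
    unfolding * round_identity[OF c] using q by (simp add: tag_prob_def power2_eq_square field_simps del: win.simps)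
  finally show ?thesis .
qed

text \<open>The return of the outermost experiment is excluded: it empties the stack, where
  \<open>root_prob\<close> is 0 by convention.\<close>

lemma root_prob_mstep:
  assumes invar: "invar (md, g # ps, dn)" and nroot: "\<And>b. md = Ret b \<Longrightarrow> ps \<noteq> []"
  shows "expect (\<lambda>d. root_prob (mstep d (md, g # ps, dn))) = root_prob (md, g # ps, dn)"
  using invar
proof (cases rule: invar_cases)
  case 1
  then show ?thesis by simp
next
  case (2 v c x f j ps' dn')
  then have eq: "md = Rnd" "g = Frame v c x f j" "ps' = ps" "dn' = dn" by auto
  have legal: "legal (Frame v c x f j # ps @ dn)" using invar eq by simp
  let ?I = "ps @ dn"
  have "expect (\<lambda>d. root_prob (mstep d (md, g # ps, dn))) =
    expect (\<lambda>d. propagate ((\<lambda>(t, n1, n2). if t \<le> 1 then win ?I (Frame v c c 0 0)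
      else if n1 div 4 \<ge> deg v then 0
      else case frame_at ?I (adj v ! (n1 div 4)) of
          None \<Rightarrow> win ?I (Frame v c (n2 + 1) (n1 div 4 + 1) 0)
        | Some h \<Rightarrow> if blocks h v \<and> t \<le> 2 then win ?I (Frame v c (fx h) (n1 div 4 + 1) 0) else 0) d)
      ps dn)"
    unfolding eq by (rule expect_cong) (simp split: option.splits del: win.simps)
  also have "\<dots> = propagate (accept ?I v c) ps dn"
    unfolding expect_propagate using expect_round[OF legal_vertex_instance[OF legal]] legal by (simp del: win.simps)
  finally show ?thesis by (simp add: eq)
next
  case (3 v c x f j ps' dn')
  then have eq: "md = Slt" "g = Frame v c x f j" "ps' = ps" "dn' = dn" by auto
  let ?I = "ps @ dn" and ?w = "adj v ! j"
  have legal: "legal (Frame v c x f j # ?I)" and gd: "well_placed (Frame v c x f j)" using invar eq by simp_all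
  interpret vertex_instance V E adj q \<Delta> ?I v by (rule legal_vertex_instance[OF legal])
  have unblocked: "unblocked ?I v x j" and jd: "j \<le> deg v" using legal by simp_all
  show ?thesis
  proof (cases "j < deg v")
    case False
    then have "j = deg v" "f = 0" using jd gd by auto
    then show ?thesis using unblocked win_final_end
      by (simp add: eq case_prod_unfold expect_const del: win.simps)
         (subst expect_cong[where h = "\<lambda>_. propagate 1 ps dn"], auto simp: expect_const simp del: win.simps)
  next
    case True
    show ?thesis
    proof (cases "frame_at ?I ?w")
      case None
      then have w: "?w \<notin> pins ?I" using frame_at_None by blast
      show ?thesis
      proof (cases "f = Suc j")
        case f: True
        have "expect (\<lambda>d. root_prob (mstep d (md, g # ps, dn))) = expect (\<lambda>_. root_prob (md, g # ps, dn))"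
          using True None f w win_forced[OF unblocked]
          by (intro expect_cong) (simp add: eq del: win.simps)
        then show ?thesis by (simp only: expect_const)
      next
        case f: False
        let ?W = "win ?I (Frame v c x f (Suc j))" and ?g = "Frame v c x f j"
        let ?h = "\<lambda>t::nat. if t = 0 then (1 - accept (?g # ?I) ?w x) * ?W else ?W"
        have "expect (\<lambda>d. root_prob (mstep d (md, g # ps, dn))) = expect (\<lambda>d. propagate ((\<lambda>(t, n1, n2). ?h t) d) ps dn)"
          unfolding eq using True None f by (intro expect_cong) (simp del: win.simps)
        also have "\<dots> = propagate (\<Sum>t<4. tag_prob q t * ?h t) ps dn" by (simp only: expect_propagate expect_t)
        \<comment> \<open>The neighbor's experiment is run with probability \<open>2 / q\<close> and
          succeeds with probability \<open>q / 2 * marg\<close>, so a positive answer has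
          probability exactly \<open>marg\<close>.\<close>
        also have "(\<Sum>t<4. tag_prob q t * ?h t) = (1 - marg (?g # ?I) ?w x) * ?W"
          using q_pos by (simp add: lessThan_4 tag_prob_def accept_def field_simps del: win.simps)
        also have "\<dots> = win ?I ?g"
        proof -
          have "distinct (map fv (?g # ?I))" using legal_distinct[OF legal] by simp
          then have "ncol (?g # ?I) > 0" by (rule ncol_pos)
          then show ?thesis
            unfolding win_Suc[OF f] ncol_Frame_Suc_free[OF True w] by (simp del: win.simps)
        qed
        finally show ?thesis by (simp add: eq del: win.simps)
      qed
    next
      case (Some h)
      then have w: "?w \<in> pins ?I" using frame_at_None by (metis option.distinct(1))
      have h: "h \<in> set ?I" "fv h = ?w" using frame_at_SomeD[OF Some] by auto
      have "root_prob (mstep d (md, g # ps, dn)) = root_prob (md, g # ps, dn)" for d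
      proof (cases d)
        case (fields t n1 n2)
        show ?thesis
        proof (cases "f = Suc j")
          case f: True
          then show ?thesis using True Some w win_forced[OF unblocked] fields
            by (simp add: eq del: win.simps)
        next
          case f: False
          show ?thesis
          proof (cases "blocks h v \<and> fx h = x")
            case b: True
            have "f = 0 \<or> j < f" using gd by auto
            then have "win ?I (Frame v c x f j) = 0" using win_blocked[OF _ f True h] b by simp
            then show ?thesis using b True Some f fields by (simp add: eq del: win.simps)
          next
            case b: False
            have "distinct (map fv (Frame v c x f j # ?I))" using legal_distinct[OF legal] by simp
            then have "ncol (Frame v c x f j # ?I) > 0" by (rule ncol_pos)
            then have "win ?I (Frame v c x f j) = win ?I (Frame v c x f (Suc j))"
              unfolding win_Suc[OF f] ncol_Frame_Suc_pinned[OF True w] by (simp del: win.simps)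
            then show ?thesis using True Some f b fields
              by (auto simp: eq simp del: win.simps)
          qed
        qed
      qed
      then show ?thesis by (simp only: expect_const)
    qed
  qed
next
  case (4 b)
  then show ?thesis using nroot by auto
next
  case (5 b h v c x f j ps' dn')
  have "root_prob (mstep d (md, g # ps, dn)) = root_prob (md, g # ps, dn)" for d
    using 5 by (cases d) (simp del: win.simps)
  then show ?thesis by (simp only: expect_const)
qed

lemma accept_nonneg: "accept I v c \<ge> 0"
  by (simp add: accept_def marg_nonneg)

lemma accept_bounds:
  assumes "legal I" "v \<in> V" "v \<notin> pins I"
  shows "0 \<le> accept I v c" "accept I v c \<le> 1"
proof -
  interpret vertex_instance V E adj q \<Delta> I v
    using assms legal_distinct legal_color by unfold_locales auto
  show "0 \<le> accept I v c" "accept I v c \<le> 1" using accept_le_1 by (simp_all add: accept_nonneg)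
qed

lemma ncol_Frame_mono:
  assumes "j \<le> n"
  shows "ncol (Frame v c x f n # I) \<le> ncol (Frame v c x f j # I)"
proof -
  have "set (take j (adj v)) \<subseteq> set (take n (adj v))" using assms by (rule set_take_subset_set_take)
  then have "cols (Frame v c x f n # I) \<subseteq> cols (Frame v c x f j # I)"
    unfolding cols_def by (auto simp: blocks_def)
  then show ?thesis unfolding ncol_def by (intro card_mono) auto
qed

lemma pass_bounds:
  assumes "j \<le> n"
  shows "0 \<le> pass I (Frame v c x f j) n" "pass I (Frame v c x f j) n \<le> 1"
  using ncol_Frame_mono[OF assms, of v c x f I] by (auto simp: divide_le_eq_1)

lemma win_bounds:
  assumes legal: "legal (Frame v c x f j # I)" and gd: "well_placed (Frame v c x f j)"
  shows "0 \<le> win I (Frame v c x f j)" "win I (Frame v c x f j) \<le> 1"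
proof -
  have I: "legal I" "v \<in> V" "v \<notin> pins I" "j \<le> deg v" using legal by auto
  show "0 \<le> win I (Frame v c x f j)"
    using pass_bounds(1)[of j _ I v c x f] I gd accept_nonneg
    by (auto simp del: pass.simps intro!: mult_nonneg_nonneg)
  show "win I (Frame v c x f j) \<le> 1"
  proof (cases "f = 0")
    case True
    then show ?thesis using pass_bounds(2)[OF I(4)] by (simp del: pass.simps)
  next
    case False
    then have f: "j \<le> f - 1" "f - 1 < deg v" using gd by auto
    let ?w = "adj v ! (f - 1)" and ?g = "Frame v c x f (f - 1)"
    let ?a = "if ?w \<in> pins I then 1 else accept (?g # I) ?w x"
    have a: "0 \<le> ?a" "?a \<le> 1" if "unblocked I v x (f - 1)"
    proof -
      have "legal (?g # I)" using legal f that by auto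
      moreover have "?w \<in> V" "?w \<noteq> v" using adj_nth f(2) by auto
      ultimately show "0 \<le> ?a" "?a \<le> 1"
        using accept_bounds[of "?g # I" ?w x] by auto
    qed
    have "pass I (Frame v c x f j) (f - 1) * ?a \<le> 1"
    proof (cases "unblocked I v x (f - 1)")
      case True
      show ?thesis using pass_bounds[OF f(1), of I v c x f] a[OF True]
        by (meson mult_le_one)
    qed simp
    then have "pass I (Frame v c x f j) (f - 1) * ?a * accept I v c \<le> 1"
      using accept_bounds[OF I(1-3), of c] 
      by (meson mult_le_one)
    then show ?thesis using False by (simp del: pass.simps)
  qed
qed

lemma propagate_bounds:
  assumes "waits ps dn" "legal (ps @ dn)" "0 \<le> a" "a \<le> 1"
  shows "0 \<le> propagate a ps dn \<and> propagate a ps dn \<le> 1"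
  using assms
proof (induction ps arbitrary: a)
  case (Cons g ps)
  obtain v c x f j where g: "g = Frame v c x f j" by (cases g)
  have I: "legal (ps @ dn)" "v \<in> V" "v \<notin> pins (ps @ dn)" using Cons.prems g by auto
  have "0 \<le> parent_prob (ps @ dn) g a \<and> parent_prob (ps @ dn) g a \<le> 1"
  proof (cases "f = j + 1")
    case True
    then show ?thesis using accept_bounds[OF I, of c] Cons.prems(3,4) g
      by (auto intro: mult_le_one)
  next
    case False
    have "adj v ! j \<notin> pins (ps @ dn)" using Cons.prems g by simp
    then have "unblocked (ps @ dn) v x (Suc j)" using Cons.prems g unblocked_Suc_None by simp
    then have "legal (Frame v c x f (j + 1) # ps @ dn)" "well_placed (Frame v c x f (j + 1))"
      using Cons.prems g False by auto
    from win_bounds[OF this] show ?thesis using False Cons.prems(3,4) g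
      by (auto intro!: mult_le_one mult_nonneg_nonneg simp del: win.simps)
  qed
  then show ?case using Cons.IH[of "parent_prob (ps @ dn) g a"] Cons.prems g by simp
qed simp

lemma root_prob_bounds:
  assumes "invar (md, g # ps, dn)"
  shows "0 \<le> root_prob (md, g # ps, dn)" "root_prob (md, g # ps, dn) \<le> 1"
proof -
  obtain v c x f j where g: "g = Frame v c x f j" by (cases g)
  have I: "legal (ps @ dn)" "v \<in> V" "v \<notin> pins (ps @ dn)" "waits ps dn" using assms g by auto
  have "0 \<le> top_prob md (ps @ dn) g \<and> top_prob md (ps @ dn) g \<le> 1"
    using accept_bounds[OF I(1-3), of c] win_bounds[of v c x f j "ps @ dn"] assms g
    by (cases md) (auto simp del: win.simps)
  then show "0 \<le> root_prob (md, g # ps, dn)" "root_prob (md, g # ps, dn) \<le> 1"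
    using propagate_bounds[OF I(4,1)] by simp_all
qed

end

section \<open>Expected number of steps\<close>

context sampler begin

text \<open>The price of an experiment, including its return. With the factor 5,
  \<open>2 * \<Delta> + 2\<close> is at most \<open>call_cost - 1\<close> for all
  \<open>\<Delta> \<ge> 1\<close>, with equality at 1; \<open>round_cost\<close> ends with this
  comparison.\<close>

definition call_cost :: real where "call_cost = 5 * real \<Delta>"
text \<open>One step for the slot itself and, with probability \<open>2 / q\<close>, an
  experiment.\<close>

definition slot_cost :: real where "slot_cost = 1 + 2 * call_cost / real q"
text \<open>An attempt consists of one starting step and one experiment; two attempts are needed on
  average.\<close>

definition vertex_cost :: real where "vertex_cost = 2 * (call_cost + 1)"

text \<open>The summand 2 pays for leaving the list of neighbors and for the return;
  \<open>2 * call_cost\<close> pays for the experiment of the chosen neighbor and for starting over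
  after its success.\<close>

fun top_cost :: "mode \<Rightarrow> frame \<Rightarrow> real" where
  "top_cost Rnd g = call_cost"
| "top_cost Slt (Frame v c x f j) =
     (real (deg v) - real j) * slot_cost + 2 + (if f = 0 then 0 else 2 * call_cost)"
| "top_cost (Ret b) g = 1"

fun wait_cost :: "frame \<Rightarrow> real" where
  "wait_cost (Frame v c x f j) =
     (if f = j + 1 then call_cost else top_cost Slt (Frame v c x f (j + 1)))"

fun cost :: "mstate \<Rightarrow> real" where
  "cost (md, [], dn) = 0"
| "cost (md, g # ps, dn) = top_cost md g + (\<Sum>h\<leftarrow>ps. wait_cost h)"

fun terminal :: "mstate \<Rightarrow> bool" where
  "terminal (md, act, dn) \<longleftrightarrow> act = [] \<and> length dn \<ge> length vs"

text \<open>A failed attempt at the current vertex must be repeated at full price, so this price is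
  weighted by the probability of failure.\<close>

fun potential :: "mstate \<Rightarrow> real" where
  "potential (md, [], dn) = (real (length vs) - real (length dn)) * vertex_cost"
| "potential (md, g # ps, dn) = cost (md, g # ps, dn) + vertex_cost * (1 - root_prob (md, g # ps, dn)) +
     (real (length vs) - real (length dn) - 1) * vertex_cost"

lemma expect_le_const:
  assumes "\<And>t n1 n2. n1 < q \<Longrightarrow> n2 < q \<Longrightarrow> g (t, n1, n2) \<le> a"
  shows "expect g \<le> a"
  using expect_mono[of g "\<lambda>_. a"] assms expect_const by simp

lemma expect_slot:
  assumes "k \<le> q"
  shows "expect (\<lambda>(t, n1, n2). if t \<le> 1 then a else if n1 < k then b else 0) =
    a / 2 + b * real k / (2 * real q)"
proof -
  have q: "real q \<noteq> 0" using q_pos by simp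
  have sum: "(\<Sum>n1<q. if n1 < k then b else 0) = (\<Sum>n1<k. b)"
    using assms by (intro sum.mono_neutral_cong_right) auto
  let ?G = "\<lambda>t n1. if t \<le> (1::nat) then a else if n1 < k then b else 0"
  have "expect (\<lambda>(t, n1, n2). ?G t n1) = (\<Sum>t<4. tag_prob q t / (real q)\<^sup>2 * (real q * (\<Sum>n1<q. ?G t n1)))"
    unfolding expect_def sum_distrib_left by (simp add: mult_ac)
  also have "\<dots> = (\<Sum>t<4. tag_prob q t * (if t \<le> 1 then a else b * real k / real q))"
    using q sum by (intro sum.cong) (simp_all add: power2_eq_square)
  also have "\<dots> = a / 2 + b * real k / (2 * real q)"
    by (simp add: lessThan_4 tag_prob_def algebra_simps)
  finally show ?thesis .
qed

lemma call_cost_ge: "call_cost \<ge> 5"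
  using degree_pos by (simp add: call_cost_def)

lemma slot_cost_ge: "slot_cost \<ge> 1"
  using call_cost_ge by (simp add: slot_cost_def)

lemma top_cost_Slt_ge: "j \<le> deg v \<Longrightarrow> top_cost Slt (Frame v c x f j) \<ge> 2"
  using slot_cost_ge call_cost_ge by simp

text \<open>The summands are 1 for a possible immediate return, the final check with probability
  1/2, and a chosen neighbor with probability at most \<open>4 * \<Delta> / (2 * q)\<close>. Only
  the last contains further experiments of this price, and its small weight makes the recursion
  subcritical.\<close>

lemma round_cost: "1 + (real \<Delta> * slot_cost + 2) / 2 +
    (real \<Delta> * slot_cost + 2 + 2 * call_cost) * real (4 * \<Delta>) / (2 * real q) \<le> call_cost - 1"
proof -
  have D: "real \<Delta> \<ge> 1" using degree_pos by simp
  define r where "r = real \<Delta> / real q"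
  have q: "real q > 0" using q_pos by simp
  \<comment> \<open>The lower bound on the number of colors is turned into a numerical one
    here.\<close>
  have r: "0 \<le> r" "r \<le> 1 / 65"
    using colors q by (auto simp: r_def divide_le_eq)
  have s: "real \<Delta> * slot_cost = real \<Delta> + 10 * real \<Delta> * r"
    using q by (simp add: slot_cost_def call_cost_def r_def field_simps)
  have "10 * real \<Delta> * r \<le> 10 * real \<Delta> * (1 / 65)" using r by (intro mult_left_mono) auto
  then have s': "real \<Delta> * slot_cost \<le> 75 / 65 * real \<Delta>" unfolding s by simp
  define X where "X = (real \<Delta> * slot_cost + 2 + 2 * call_cost) * real (4 * \<Delta>) / (2 * real q)"
  have "X = (real \<Delta> * slot_cost + 2 + 2 * call_cost) * (2 * r)"
    using q by (simp add: X_def r_def field_simps)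
  also have "\<dots> \<le> (75 / 65 * real \<Delta> + 2 + 2 * (5 * real \<Delta>)) * (2 * (1 / 65))"
    using s' r by (intro mult_mono) (auto simp: call_cost_def)
  also have "\<dots> \<le> real \<Delta>" using D by simp
  finally have "X \<le> real \<Delta>" .
  moreover have "real \<Delta> * slot_cost \<le> 2 * real \<Delta>" using s' D by simp
  ultimately have "1 + (real \<Delta> * slot_cost + 2) / 2 + X \<le> 1 + (2 * real \<Delta> + 2) / 2 + real \<Delta>"
    by (intro add_mono divide_right_mono) simp_all
  also have "\<dots> \<le> call_cost - 1" using D by (simp add: call_cost_def field_simps)
  finally have "1 + (real \<Delta> * slot_cost + 2) / 2 + X \<le> call_cost - 1" .
  then show ?thesis by (simp only: X_def)
qed

lemma cost_mstep:
  assumes invar: "invar (md, g # ps, dn)" and nroot: "\<And>b. md = Ret b \<Longrightarrow> ps \<noteq> []"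
  shows "expect (\<lambda>d. cost (mstep d (md, g # ps, dn))) \<le> cost (md, g # ps, dn) - 1"
  using invar
proof (cases rule: invar_cases)
  case 1
  then show ?thesis by simp
next
  case (2 v c x f j ps' dn')
  then have eq: "md = Rnd" "g = Frame v c x f j" "ps' = ps" "dn' = dn" by auto
  let ?W = "\<Sum>h\<leftarrow>ps. wait_cost h"
  let ?a = "real \<Delta> * slot_cost + 2" and ?b = "real \<Delta> * slot_cost + 2 + 2 * call_cost"
  have dv: "real (deg v) * slot_cost \<le> real \<Delta> * slot_cost"
    using deg_le slot_cost_ge by (intro mult_right_mono) auto
  have pos: "0 \<le> real \<Delta> * slot_cost" "0 \<le> call_cost" "0 \<le> real (deg v) * slot_cost"
    using slot_cost_ge call_cost_ge by auto
  have k: "4 * \<Delta> \<le> q" using colors by simp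
  have lt: "n div 4 < deg v \<Longrightarrow> n < 4 * \<Delta>" for n using deg_le[of v] by linarith
  \<comment> \<open>All branches are dominated by a function of two thresholds: 1 covers an
    immediate failure, and \<open>deg v\<close> is replaced by \<open>\<Delta>\<close>.\<close>
  have "expect (\<lambda>d. cost (mstep d (md, g # ps, dn))) \<le>
      expect (\<lambda>d. (1 + ?W) + 1 * (\<lambda>(t, n1, n2). if t \<le> 1 then ?a else if n1 < 4 * \<Delta> then ?b else 0) d)"
  proof (rule expect_mono)
    fix t n1 n2 :: nat
    show "cost (mstep (t, n1, n2) (md, g # ps, dn)) \<le>
        (1 + ?W) + 1 * (\<lambda>(t, n1, n2). if t \<le> 1 then ?a else if n1 < 4 * \<Delta> then ?b else 0) (t, n1, n2)"
      using dv pos lt[of n1] by (auto simp: eq split: option.splits)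
  qed
  also have "\<dots> = 1 + ?W + (?a / 2 + ?b * real (4 * \<Delta>) / (2 * real q))"
    by (subst expect_affine) (simp only: expect_slot[OF k] mult_1)
  also have "\<dots> \<le> cost (md, g # ps, dn) - 1" using round_cost by (simp add: eq)
  finally show ?thesis .
next
  case (3 v c x f j ps' dn')
  then have eq: "md = Slt" "g = Frame v c x f j" "ps' = ps" "dn' = dn" by auto
  let ?I = "ps @ dn" and ?w = "adj v ! j" and ?W = "\<Sum>h\<leftarrow>ps. wait_cost h"
  have jd: "j \<le> deg v" and gd: "well_placed (Frame v c x f j)" using invar eq by auto
  note bounds = top_cost_Slt_ge[OF jd, of c x f] call_cost_ge slot_cost_ge
  show ?thesis
  proof (cases "j < deg v")
    case False
    then show ?thesis using bounds by (intro expect_le_const) (simp add: eq)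
  next
    case True
    have nxt: "top_cost Slt (Frame v c x f (Suc j)) = top_cost Slt (Frame v c x f j) - slot_cost"
      by (simp add: algebra_simps)
    have ge: "top_cost Slt (Frame v c x f (Suc j)) \<ge> 2" using True by (intro top_cost_Slt_ge) simp
    show ?thesis
    proof (cases "frame_at ?I ?w")
      case None
      show ?thesis
      proof (cases "f = Suc j")
        case f: True
        have "(real (deg v) - real j) * slot_cost \<ge> 0" using jd slot_cost_ge by simp
        then show ?thesis using True None f bounds by (intro expect_le_const) (simp add: eq)
      next
        case f: False
        let ?S = "top_cost Slt (Frame v c x f (Suc j))"
        have "expect (\<lambda>d. cost (mstep d (md, g # ps, dn))) =
            expect (\<lambda>(t, n1, n2). if t = 0 then call_cost + ?S + ?W else ?S + ?W)"
          using True None f by (intro expect_cong) (simp add: eq del: top_cost.simps(2))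
        also have "\<dots> = (\<Sum>t<4. tag_prob q t * (if t = 0 then call_cost + ?S + ?W else ?S + ?W))"
          by (rule expect_t)
        also have "\<dots> = 2 / real q * call_cost + ?S + ?W"
          using q_pos by (simp add: lessThan_4 tag_prob_def field_simps del: top_cost.simps(2))
        also have "\<dots> = cost (md, g # ps, dn) - 1"
          unfolding nxt by (simp add: eq slot_cost_def del: top_cost.simps(2))
        finally show ?thesis by simp
      qed
    next
      case (Some h)
      have f2: "top_cost Slt (Frame v c x f j) \<ge> 2 + call_cost" if "f = Suc j"
      proof -
        have "(real (deg v) - real j) * slot_cost \<ge> 0" using jd slot_cost_ge by simp
        then show ?thesis using that call_cost_ge by simp
      qed
      show ?thesis
      proof (cases "f = Suc j")
        case f: True
        then show ?thesis using True Some f2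
          by (intro expect_le_const) (simp add: eq del: top_cost.simps(2))
      next
        case f: False
        then show ?thesis using True Some bounds nxt ge
          by (intro expect_le_const) (simp add: eq del: top_cost.simps(2))
      qed
    qed
  qed
next
  case (4 b)
  then show ?thesis using nroot by auto
next
  case (5 b h v c x f j ps' dn')
  then have eq: "md = Ret b" "g = h" "ps = Frame v c x f j # ps'" by auto
  have "j < deg v" using invar eq by simp
  then have ge: "top_cost Slt (Frame v c x f (Suc j)) \<ge> 2" by (intro top_cost_Slt_ge) simp
  show ?thesis
    using ge call_cost_ge by (intro expect_le_const) (simp add: eq del: top_cost.simps(2))
qed

text \<open>Consequently \<open>potential\<close> and \<open>out_prob\<close> depend affinely on
  \<open>cost\<close> and \<open>root_prob\<close>, with coefficients that do not change during the
  step.\<close>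

lemma active_mstep:
  assumes "\<And>b. md = Ret b \<Longrightarrow> ps \<noteq> []"
  obtains md' g' ps' where "mstep d (md, g # ps, dn) = (md', g' # ps', dn)"
    and "fv (last (g' # ps')) = fv (last (g # ps))" "fc (last (g' # ps')) = fc (last (g # ps))"
proof -
  obtain t n1 n2 where d: "d = (t, n1, n2)" by (cases d)
  obtain v c x f j where g: "g = Frame v c x f j" by (cases g)
  have "case mstep d (md, g # ps, dn) of (md', act', dn') \<Rightarrow> act' \<noteq> [] \<and> dn' = dn \<and>
    fv (last act') = fv (last (g # ps)) \<and> fc (last act') = fc (last (g # ps))"
  proof (cases md)
    case Rnd
    then show ?thesis by (simp add: d g split: option.splits)
  next
    case Slt
    then show ?thesis by (simp add: d g split: option.splits)
  next
    case (Ret b)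
    then obtain h ps'' where ps: "ps = h # ps''" using assms by (metis neq_Nil_conv)
    obtain v' c' x' f' j' where h: "h = Frame v' c' x' f' j'" by (cases h)
    show ?thesis by (simp add: d Ret ps h)
  qed
  then show ?thesis using that
    by (cases "mstep d (md, g # ps, dn)") (auto simp: neq_Nil_conv simp del: last.simps)
qed

lemma cost_nonneg:
  assumes "invar (md, g # ps, dn)"
  shows "cost (md, g # ps, dn) \<ge> 0"
proof -
  have "(\<Sum>h\<leftarrow>ps. wait_cost h) \<ge> 0"
  proof -
    have "waits ps dn" using assms by simp
    then have "\<forall>h \<in> set ps. wait_cost h \<ge> 0"
    proof (induction ps)
      case (Cons h ps)
      obtain v c x f j where h: "h = Frame v c x f j" by (cases h)
      have "top_cost Slt (Frame v c x f (j + 1)) \<ge> 2"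
        using Cons.prems h by (intro top_cost_Slt_ge) simp
      then show ?case using Cons h call_cost_ge by (auto simp del: top_cost.simps(2))
    qed simp
    then show ?thesis by (intro sum_list_nonneg) auto
  qed
  moreover have "top_cost md g \<ge> 0"
  proof -
    obtain v c x f j where g: "g = Frame v c x f j" by (cases g)
    then have "j \<le> deg v" using assms by simp
    then show ?thesis using g call_cost_ge top_cost_Slt_ge[of j v c x f]
      by (cases md) (auto simp del: top_cost.simps(2))
  qed
  ultimately show ?thesis by simp
qed

lemma vertex_cost_pos: "vertex_cost > 0"
  using call_cost_ge by (simp add: vertex_cost_def)

lemma potential_nonneg:
  assumes "invar s"
  shows "potential s \<ge> 0"
proof (cases s)
  case (fields md act dn)
  show ?thesis
  proof (cases act)
    case Nil
    then show ?thesis using assms fields vertex_cost_pos by (simp add: done_ok_def)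
  next
    case (Cons g ps)
    then have i: "invar (md, g # ps, dn)" using assms fields by simp
    then have "length dn < length vs" by simp
    then have "(real (length vs) - real (length dn) - 1) * vertex_cost \<ge> 0"
      using vertex_cost_pos by simp
    then show ?thesis using cost_nonneg[OF i] root_prob_bounds[OF i] vertex_cost_pos
      by (simp add: fields Cons del: root_prob.simps cost.simps)
  qed
qed

lemma new_vertex_instance:
  assumes "invar (md, [], dn)" "length dn < length vs"
  shows "vertex_instance V E adj q \<Delta> dn (vs ! length dn)"
proof -
  have "invar (mstep (0, 0, 0) (md, [], dn))" using invar_mstep[OF assms(1) q_pos] .
  then have "legal (Frame (vs ! length dn) (0 + 1) (0 + 1) 0 0 # dn)" using assms(2) by simp
  then show ?thesis by (rule legal_vertex_instance)
qed

text \<open>Starting an attempt saves \<open>vertex_cost / 2\<close> on average, as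
  \<open>accept\<close> has mean 1/2 over the colors; this is \<open>call_cost + 1\<close>, one more
  than the experiment costs. During the attempt \<open>cost\<close> falls by at least 1 and
  \<open>root_prob\<close> has no drift, and at the return \<open>root_prob\<close> is the actual
  result.\<close>

lemma potential_drift:
  assumes invar: "invar s" and nt: "\<not> terminal s"
  shows "expect (\<lambda>d. potential (mstep d s)) \<le> potential s - 1"
proof (cases s)
  case (fields md act dn)
  show ?thesis
  proof (cases act)
    case Nil
    then have len: "length dn < length vs" using nt fields by simp
    let ?v = "vs ! length dn"
    interpret vertex_instance V E adj q \<Delta> dn ?v
      using new_vertex_instance invar len fields Nil by simp
    let ?k = "real (length vs) - real (length dn)"
    have "expect (\<lambda>d. potential (mstep d s)) =
      expect (\<lambda>(t, n1, n2). call_cost + vertex_cost * (1 - accept dn ?v (n2 + 1)) + (?k - 1) * vertex_cost)"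
      using len by (intro expect_cong) (simp add: fields Nil)
    also have "\<dots> = (\<Sum>n<q. call_cost + vertex_cost * (1 - accept dn ?v (n + 1)) + (?k - 1) * vertex_cost) / real q"
      by (rule expect_n2)
    also have "\<dots> = call_cost + vertex_cost + (?k - 1) * vertex_cost -
        vertex_cost * (\<Sum>n<q. accept dn ?v (n + 1)) / real q"
      using q_pos by (simp add: sum.distrib sum_subtractf algebra_simps sum_distrib_left[symmetric]) (simp add: field_simps)
    also have "(\<Sum>n<q. accept dn ?v (n + 1)) = real q / 2 * (\<Sum>c\<in>{1..q}. marg dn ?v c)"
      by (simp add: accept_def sum_distrib_left sum.atLeast1_atMost_eq)
    also have "\<dots> = real q / 2" using sum_marg[OF v dist] by simp
    finally have "expect (\<lambda>d. potential (mstep d s)) = call_cost + ?k * vertex_cost - vertex_cost / 2"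
      using q_pos by (simp add: field_simps)
    then show ?thesis by (simp add: fields Nil vertex_cost_def field_simps)
  next
    case (Cons g ps)
    then have i: "invar (md, g # ps, dn)" using invar fields by simp
    let ?k = "real (length vs) - real (length dn) - 1"
    show ?thesis
    proof (cases "\<exists>b. md = Ret b \<and> ps = []")
      case True
      then obtain b where b: "md = Ret b" "ps = []" by blast
      have "potential (mstep d s) = potential s - 1" for d
        by (cases d) (cases b, simp_all add: fields Cons b algebra_simps)
      then show ?thesis by (simp add: expect_const)
    next
      case False
      then have nroot: "\<And>b. md = Ret b \<Longrightarrow> ps \<noteq> []" by blast
      have "potential (mstep d s) = (?k * vertex_cost + vertex_cost) +
          1 * (cost (mstep d s) + - vertex_cost * root_prob (mstep d s))" for d
      proof -
        obtain md' g' ps' where "mstep d (md, g # ps, dn) = (md', g' # ps', dn)"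
          "fv (last (g' # ps')) = fv (last (g # ps))" "fc (last (g' # ps')) = fc (last (g # ps))"
          by (rule active_mstep[OF nroot])
        then show ?thesis by (simp add: fields Cons algebra_simps del: root_prob.simps cost.simps)
      qed
      then have "expect (\<lambda>d. potential (mstep d s)) = expect (\<lambda>d. (?k * vertex_cost + vertex_cost) +
          1 * (cost (mstep d s) + - vertex_cost * root_prob (mstep d s)))" by (simp only:)
      also have "\<dots> = (?k * vertex_cost + vertex_cost) +
          1 * expect (\<lambda>d. cost (mstep d s) + - vertex_cost * root_prob (mstep d s))"
        by (rule expect_affine)
      also have "expect (\<lambda>d. cost (mstep d s) + - vertex_cost * root_prob (mstep d s)) =
          expect (\<lambda>d. cost (mstep d s)) + - vertex_cost * expect (\<lambda>d. root_prob (mstep d s))"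
        by (subst expect_add, subst expect_cmult) (rule refl)
      finally have "expect (\<lambda>d. potential (mstep d s)) = (?k * vertex_cost + vertex_cost) +
          1 * (expect (\<lambda>d. cost (mstep d s)) + - vertex_cost * expect (\<lambda>d. root_prob (mstep d s)))" .
      then show ?thesis
        using cost_mstep[OF i nroot] root_prob_mstep[OF i nroot]
        by (simp add: fields Cons algebra_simps del: root_prob.simps cost.simps)
    qed
  qed
qed

subsection \<open>Output distribution\<close>

definition matching :: "(nat \<Rightarrow> nat) \<Rightarrow> (nat \<Rightarrow> nat) set" where
  "matching \<tau> = {\<sigma> \<in> proper_colorings V E q. restrict \<sigma> (set vs) = \<tau>}"

definition agrees :: "(nat \<Rightarrow> nat) \<Rightarrow> frame list \<Rightarrow> bool" where
  "agrees \<tau> dn \<longleftrightarrow> (\<forall>h \<in> set dn. fx h = \<tau> (fv h))"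

text \<open>The probability that a uniform extension of the finished frames to a proper coloring
  restricts to \<open>\<tau>\<close>.\<close>

definition match_prob :: "(nat \<Rightarrow> nat) \<Rightarrow> frame list \<Rightarrow> real" where
  "match_prob \<tau> dn = (if agrees \<tau> dn then real (card (matching \<tau>)) / real (ncol dn) else 0)"

text \<open>The conditional probability of the output \<open>\<tau>\<close>: success of the
  outermost experiment fixes the target color at its vertex, failure changes nothing.\<close>

fun out_prob :: "(nat \<Rightarrow> nat) \<Rightarrow> mstate \<Rightarrow> real" where
  "out_prob \<tau> (md, [], dn) = match_prob \<tau> dn"
| "out_prob \<tau> (md, g # ps, dn) =
     root_prob (md, g # ps, dn) * match_prob \<tau> (full (fv (last (g # ps))) (fc (last (g # ps))) # dn) +
     (1 - root_prob (md, g # ps, dn)) * match_prob \<tau> dn"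

lemma cols_Nil: "cols [] = proper_colorings V E q"
proof -
  have "(\<forall>u\<in>V. \<forall>w\<in>V. {u, w} \<in> E \<longrightarrow> \<sigma> u \<noteq> \<sigma> w) \<longleftrightarrow> (\<forall>u w. {u, w} \<in> E \<longrightarrow> \<sigma> u \<noteq> \<sigma> w)" for \<sigma> :: "nat \<Rightarrow> nat"
    using edgeD by metis
  then show ?thesis by (simp add: cols_def proper_colorings_def)
qed

lemma matchingD:
  assumes "\<sigma> \<in> matching \<tau>"
  shows "\<sigma> \<in> V \<rightarrow>\<^sub>E {1..q}" "\<And>u w. {u, w} \<in> E \<Longrightarrow> \<sigma> u \<noteq> \<sigma> w" "\<And>u. u \<in> set vs \<Longrightarrow> \<sigma> u = \<tau> u"
  using assms by (auto simp: matching_def proper_colorings_def)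

lemma finite_matching: "finite (matching \<tau>)"
  using finite_cols[of "[]"] unfolding cols_Nil matching_def by simp

lemma card_matching_le:
  assumes "pins dn \<subseteq> set vs" "agrees \<tau> dn"
  shows "card (matching \<tau>) \<le> ncol dn"
  unfolding ncol_def
proof (rule card_inj_on_le[where f = "\<lambda>\<sigma>. restrict \<sigma> (V - pins dn)"])
  show "inj_on (\<lambda>\<sigma>. restrict \<sigma> (V - pins dn)) (matching \<tau>)"
  proof (rule inj_onI, rule ext)
    fix \<sigma> \<sigma>' u
    assume s: "\<sigma> \<in> matching \<tau>" "\<sigma>' \<in> matching \<tau>"
      and eq: "restrict \<sigma> (V - pins dn) = restrict \<sigma>' (V - pins dn)"
    consider "u \<in> pins dn" | "u \<in> V - pins dn" | "u \<notin> V" by blast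
    then show "\<sigma> u = \<sigma>' u"
    proof cases
      case 1
      then show ?thesis
        using matchingD(3)[OF s(1), of u] matchingD(3)[OF s(2), of u] assms(1) by auto
    next
      case 2
      then show ?thesis using fun_cong[OF eq, of u] by simp
    next
      case 3
      then show ?thesis using matchingD(1)[OF s(1)] matchingD(1)[OF s(2)] by (metis PiE_arb)
    qed
  qed
  show "(\<lambda>\<sigma>. restrict \<sigma> (V - pins dn)) ` matching \<tau> \<subseteq> cols dn"
  proof (rule image_subsetI)
    fix \<sigma> assume s: "\<sigma> \<in> matching \<tau>"
    show "restrict \<sigma> (V - pins dn) \<in> cols dn"
    proof (rule colsI)
      show "restrict \<sigma> (V - pins dn) \<in> (V - pins dn) \<rightarrow>\<^sub>E {1..q}"
        using matchingD(1)[OF s] by (auto simp: PiE_def Pi_def extensional_def restrict_def)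
      show "restrict \<sigma> (V - pins dn) u \<noteq> restrict \<sigma> (V - pins dn) w"
        if "u \<in> V - pins dn" "w \<in> V - pins dn" "{u, w} \<in> E" for u w
        using matchingD(2)[OF s that(3)] that by simp
      show "restrict \<sigma> (V - pins dn) w \<noteq> fx h"
        if "h \<in> set dn" "w \<in> V - pins dn" "blocks h w" for h w
      proof -
        have "{fv h, w} \<in> E" using blocks_adj[OF that(3)] adj_iff by blast
        moreover have "\<sigma> (fv h) = fx h"
          using matchingD(3)[OF s, of "fv h"] assms that(1) by (auto simp: agrees_def pins_def)
        ultimately show ?thesis using matchingD(2)[OF s, of "fv h" w] that(2) by auto
      qed
    qed
  qed
qed simp

text \<open>Frames are listed with the latest first. The earlier of two adjacent vertices has a
  complete frame and so blocks the later one, whose color was checked against it by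
  \<open>unblocked\<close>.\<close>

lemma legal_adjacent_colors:
  assumes "legal I" "\<forall>h\<in>set I. fj h = deg (fv h)" "h \<in> set I" "h' \<in> set I" "{fv h, fv h'} \<in> E"
  shows "fx h \<noteq> fx h'"
  using assms
proof (induction I rule: legal.induct)
  case (2 v c x f j I)
  have *: "fx h \<noteq> x" if h: "h \<in> set I" "{v, fv h} \<in> E" for h
  proof -
    have "fv h \<in> set (adj v)" "v \<in> set (adj (fv h))"
      using h(2) adj_iff adj_sym by blast+
    then obtain i where "i < deg v" "adj v ! i = fv h" by (metis in_set_conv_nth)
    moreover have "blocks h v" using \<open>v \<in> set (adj (fv h))\<close> 2(3) h(1) by (simp add: blocks_def)
    moreover have "j = deg v" using 2(3) by simp
    ultimately show ?thesis using 2(2) h(1) by (auto simp: unblocked_def)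
  qed
  show ?case
  proof (cases "h = Frame v c x f j")
    case True
    then have "h' \<in> set I" using 2(5,6) edgeD(3)[of v v] by auto
    then show ?thesis using * 2(6) True by auto
  next
    case False
    show ?thesis
    proof (cases "h' = Frame v c x f j")
      case True
      then show ?thesis using *[of h] 2(4,6) False by (auto simp: insert_commute)
    next
      case F: False
      then show ?thesis using 2 False by auto
    qed
  qed
qed simp

text \<open>Filling in \<open>\<tau>\<close> gives a proper coloring: edges inside \<open>vs\<close>
  are settled by \<open>legal_adjacent_colors\<close>, edges leaving \<open>vs\<close> by the
  complete frames. Together with \<open>card_matching_le\<close> this makes
  \<open>match_prob\<close> equal to 1 at the end of a run that agrees with
  \<open>\<tau>\<close>.\<close>

lemma card_matching_ge:
  assumes legal: "legal dn" and full: "\<forall>h\<in>set dn. fj h = deg (fv h)" and pins: "pins dn = set vs"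
    and ag: "agrees \<tau> dn" and \<tau>: "\<tau> \<in> set vs \<rightarrow>\<^sub>E {1..q}"
  shows "ncol dn \<le> card (matching \<tau>)"
  unfolding ncol_def
proof (rule card_inj_on_le[where f = "\<lambda>\<sigma> u. if u \<in> set vs then \<tau> u else \<sigma> u"])
  show "inj_on (\<lambda>\<sigma> u. if u \<in> set vs then \<tau> u else \<sigma> u) (cols dn)"
  proof (rule inj_onI, rule ext)
    fix \<sigma> \<sigma>' u
    assume s: "\<sigma> \<in> cols dn" "\<sigma>' \<in> cols dn"
      and eq: "(\<lambda>u. if u \<in> set vs then \<tau> u else \<sigma> u) = (\<lambda>u. if u \<in> set vs then \<tau> u else \<sigma>' u)"
    show "\<sigma> u = \<sigma>' u"
    proof (cases "u \<in> set vs")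
      case True
      then show ?thesis
        using colsD(1)[OF s(1)] colsD(1)[OF s(2)] pins by (metis DiffE PiE_arb)
    next
      case False
      then show ?thesis using fun_cong[OF eq, of u] by simp
    qed
  qed
  have frame: "\<exists>h\<in>set dn. fv h = u \<and> fx h = \<tau> u" if "u \<in> set vs" for u
    using that ag unfolding pins[symmetric] pins_def agrees_def by blast
  show "(\<lambda>\<sigma> u. if u \<in> set vs then \<tau> u else \<sigma> u) ` cols dn \<subseteq> matching \<tau>"
  proof (rule image_subsetI)
    fix \<sigma> assume s: "\<sigma> \<in> cols dn"
    let ?g = "\<lambda>u. if u \<in> set vs then \<tau> u else \<sigma> u"
    have 1: "?g \<in> V \<rightarrow>\<^sub>E {1..q}"
      using colsD(1)[OF s] \<tau> vs(2) unfolding pins by (auto simp: PiE_def Pi_def extensional_def)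
    have half: "\<sigma> w \<noteq> \<tau> u" if e: "{u, w} \<in> E" and uw: "u \<in> set vs" "w \<notin> set vs" for u w
    proof -
      obtain h where h: "h \<in> set dn" "fv h = u" "fx h = \<tau> u" using frame[OF uw(1)] by blast
      have "blocks h w" using h e full adj_iff by (simp add: blocks_def)
      moreover have "w \<in> V" using edgeD(2)[OF e] .
      ultimately show ?thesis using colsD(3)[OF s h(1), of w] h(3) uw(2) pins by simp
    qed
    have 2: "?g u \<noteq> ?g w" if e: "{u, w} \<in> E" for u w
    proof -
      consider "u \<in> set vs" "w \<in> set vs" | "u \<in> set vs" "w \<notin> set vs" | "u \<notin> set vs" "w \<in> set vs"
        | "u \<notin> set vs" "w \<notin> set vs" by blast
      then show ?thesis
      proof cases
        case 1
        obtain h h' where "h \<in> set dn" "fv h = u" "fx h = \<tau> u" "h' \<in> set dn" "fv h' = w" "fx h' = \<tau> w"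
          using frame 1 by meson
        then show ?thesis using legal_adjacent_colors[OF legal full, of h h'] e 1 by simp
      next
        case 2
        then show ?thesis using half[OF e] by simp
      next
        case 3
        then show ?thesis using half[of w u] e by (simp add: insert_commute)
      next
        case 4
        then show ?thesis using colsD(2)[OF s _ _ e] edgeD[OF e] pins by simp
      qed
    qed
    have "restrict ?g (set vs) = \<tau>"
      using \<tau> by (auto simp: PiE_def extensional_def fun_eq_iff restrict_def)
    then show "?g \<in> matching \<tau>" using 1 2 by (simp add: matching_def proper_colorings_def)
  qed
qed (rule finite_matching)

lemma match_prob_bounds:
  assumes "pins dn \<subseteq> set vs"
  shows "0 \<le> match_prob \<tau> dn" "match_prob \<tau> dn \<le> 1"
  using card_matching_le[OF assms, of \<tau>] by (auto simp: match_prob_def divide_le_eq_1)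

lemma done_ok_pins: "done_ok dn \<Longrightarrow> pins dn = set (take (length dn) vs)"
  unfolding done_ok_def pins_def by (metis set_map set_rev)

lemma out_prob_bounds:
  assumes "invar s"
  shows "0 \<le> out_prob \<tau> s" "out_prob \<tau> s \<le> 1"
proof -
  obtain md act dn where s: "s = (md, act, dn)" by (cases s)
  have "done_ok dn" using assms s by (cases act) auto
  then have pd: "pins dn \<subseteq> set vs" using done_ok_pins set_take_subset by metis
  have "0 \<le> out_prob \<tau> s \<and> out_prob \<tau> s \<le> 1"
  proof (cases act)
    case Nil
    then show ?thesis using match_prob_bounds[OF pd] s by simp
  next
    case (Cons g ps)
    then have i: "invar (md, g # ps, dn)" using assms s by simp
    let ?r = "full (fv (last (g # ps))) (fc (last (g # ps)))"
    have "fv (last (g # ps)) \<in> set vs" using i by simp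
    then have "pins (?r # dn) \<subseteq> set vs" using pd by simp
    note h = match_prob_bounds[OF this, of \<tau>] match_prob_bounds[OF pd, of \<tau>]
    have "root_prob (md, g # ps, dn) * match_prob \<tau> (?r # dn) + (1 - root_prob (md, g # ps, dn)) * match_prob \<tau> dn \<le> 1"
      using h root_prob_bounds[OF i] by (intro convex_bound_le) auto
    then show ?thesis using h root_prob_bounds[OF i] s Cons by (simp del: root_prob.simps)
  qed
  then show "0 \<le> out_prob \<tau> s" "out_prob \<tau> s \<le> 1" by auto
qed

text \<open>Total probability over the color of \<open>v\<close>. Only \<open>c = \<tau> v\<close>
  contributes, and there \<open>ncol (full v c # dn)\<close> cancels; if this color is blocked, no
  proper coloring matches \<open>\<tau>\<close>.\<close>

lemma sum_marg_match_prob: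
  assumes inst: "vertex_instance V E adj q \<Delta> dn v" and vvs: "v \<in> set vs" and pins: "pins dn \<subseteq> set vs"
    and \<tau>: "\<tau> \<in> set vs \<rightarrow>\<^sub>E {1..q}"
  shows "(\<Sum>c\<in>{1..q}. marg dn v c * match_prob \<tau> (full v c # dn)) = match_prob \<tau> dn"
proof (cases "agrees \<tau> dn")
  case False
  then have "\<not> agrees \<tau> (full v c # dn)" for c by (simp add: agrees_def)
  then show ?thesis using False by (simp add: match_prob_def)
next
  case True
  interpret vertex_instance V E adj q \<Delta> dn v by fact
  have tv: "\<tau> v \<in> {1..q}" using \<tau> vvs by (rule PiE_mem)
  have "marg dn v c * match_prob \<tau> (full v c # dn) =
      (if c = \<tau> v then marg dn v c * real (card (matching \<tau>)) / real (ncol (full v c # dn)) else 0)" for c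
  proof -
    have "agrees \<tau> (full v c # dn) \<longleftrightarrow> c = \<tau> v" using True by (simp add: agrees_def)
    then show ?thesis by (simp add: match_prob_def)
  qed
  then have "(\<Sum>c\<in>{1..q}. marg dn v c * match_prob \<tau> (full v c # dn)) =
      marg dn v (\<tau> v) * real (card (matching \<tau>)) / real (ncol (full v (\<tau> v) # dn))"
    using tv by simp
  also have "\<dots> = real (card (matching \<tau>)) / real (ncol dn)"
  proof (cases "admits dn v (\<tau> v)")
    case ok: True
    have "distinct (map fv (full v (\<tau> v) # dn))"
      using vertex_instance.dist[OF inst] vertex_instance.v(2)[OF inst] by (simp add: pins_def)
    then have "ncol (full v (\<tau> v) # dn) > 0" by (rule ncol_pos)
    then show ?thesis using ok by (simp add: marg_def)
  next
    case ok: False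
    then obtain h where h: "h \<in> set dn" "blocks h v" "fx h = \<tau> v" using tv by (auto simp: admits_def)
    have "matching \<tau> = {}"
    proof (rule ccontr)
      assume "matching \<tau> \<noteq> {}"
      then obtain \<sigma> where s: "\<sigma> \<in> matching \<tau>" by blast
      have "{fv h, v} \<in> E" using blocks_adj[OF h(2)] adj_iff by blast
      moreover have "fv h \<in> set vs" using h(1) pins by (auto simp: pins_def)
      ultimately have "\<tau> (fv h) \<noteq> \<tau> v"
        using matchingD(2)[OF s, of "fv h" v] matchingD(3)[OF s, of "fv h"] matchingD(3)[OF s vvs]
        by simp
      then show False using True h by (auto simp: agrees_def)
    qed
    then show ?thesis by simp
  qed
  finally show ?thesis using True by (simp add: match_prob_def)
qed

lemma out_prob_mstep:
  assumes invar: "invar s" and \<tau>: "\<tau> \<in> set vs \<rightarrow>\<^sub>E {1..q}"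
  shows "expect (\<lambda>d. out_prob \<tau> (mstep d s)) = out_prob \<tau> s"
proof (cases s)
  case (fields md act dn)
  show ?thesis
  proof (cases act)
    case Nil
    show ?thesis
    proof (cases "length dn < length vs")
      case False
      have "mstep d s = s" for d using False by (cases d) (simp add: fields Nil)
      then show ?thesis by (simp add: expect_const)
    next
      case True
      let ?v = "vs ! length dn"
      interpret vertex_instance V E adj q \<Delta> dn ?v
        using new_vertex_instance invar True fields Nil by simp
      have "done_ok dn" using invar fields Nil by simp
      then have pd: "pins dn \<subseteq> set vs" using done_ok_pins set_take_subset by metis
      have vv: "?v \<in> set vs" using True by simp
      have "expect (\<lambda>d. out_prob \<tau> (mstep d s)) = expect (\<lambda>(t, n1, n2).
          accept dn ?v (n2 + 1) * match_prob \<tau> (full ?v (n2 + 1) # dn) + (1 - accept dn ?v (n2 + 1)) * match_prob \<tau> dn)"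
        using True by (intro expect_cong) (simp add: fields Nil)
      also have "\<dots> = (\<Sum>n<q. accept dn ?v (n + 1) * match_prob \<tau> (full ?v (n + 1) # dn) +
          (1 - accept dn ?v (n + 1)) * match_prob \<tau> dn) / real q" by (rule expect_n2)
      also have "(\<Sum>n<q. accept dn ?v (n + 1) * match_prob \<tau> (full ?v (n + 1) # dn) +
          (1 - accept dn ?v (n + 1)) * match_prob \<tau> dn) =
          (\<Sum>c\<in>{1..q}. accept dn ?v c * match_prob \<tau> (full ?v c # dn) + (1 - accept dn ?v c) * match_prob \<tau> dn)"
        by (simp add: sum.atLeast1_atMost_eq)
      \<comment> \<open>The terms are arranged so that the last two sums cancel: both equal
        \<open>q / 2 * match_prob \<tau> dn\<close>.\<close>
      also have "\<dots> = (\<Sum>c\<in>{1..q}. match_prob \<tau> dn +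
          real q / 2 * (marg dn ?v c * match_prob \<tau> (full ?v c # dn)) - real q / 2 * match_prob \<tau> dn * marg dn ?v c)"
        by (intro sum.cong) (simp_all add: accept_def algebra_simps)
      also have "\<dots> = real q * match_prob \<tau> dn +
          real q / 2 * (\<Sum>c\<in>{1..q}. marg dn ?v c * match_prob \<tau> (full ?v c # dn)) -
          real q / 2 * match_prob \<tau> dn * (\<Sum>c\<in>{1..q}. marg dn ?v c)"
        by (simp only: sum.distrib sum_subtractf sum_distrib_left[symmetric] sum_constant
          card_atLeastAtMost) simp
      also have "\<dots> = real q * match_prob \<tau> dn"
        unfolding sum_marg[OF v dist] sum_marg_match_prob[OF vertex_instance_axioms vv pd \<tau>]
        by (simp add: algebra_simps)
      finally show ?thesis using q_pos by (simp add: fields Nil)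
    qed
  next
    case (Cons g ps)
    then have i: "invar (md, g # ps, dn)" using invar fields by simp
    show ?thesis
    proof (cases "\<exists>b. md = Ret b \<and> ps = []")
      case True
      then obtain b where b: "md = Ret b" "ps = []" by blast
      have "out_prob \<tau> (mstep d s) = out_prob \<tau> s" for d
      proof (cases d, cases b)
        fix t n1 n2 assume d: "d = (t, n1, n2)"
        assume b': b
        \<comment> \<open>By the invariant, the frame added to the finished ones is the very frame
          that \<open>out_prob\<close> anticipates.\<close>
        then have "g = full (fv g) (fc g)" "fv g = vs ! length dn" using i b by auto
        then have "full (vs ! length dn) (fc g) = g" "fv g = vs ! length dn" by metis+
        then show ?thesis using d b' by (simp add: fields Cons b)
      next
        fix t n1 n2 assume "d = (t, n1, n2)" "\<not> b"
        then show ?thesis by (simp add: fields Cons b)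
      qed
      then show ?thesis by (simp add: expect_const)
    next
      case False
      then have nroot: "\<And>b. md = Ret b \<Longrightarrow> ps \<noteq> []" by blast
      let ?h = "match_prob \<tau> (full (fv (last (g # ps))) (fc (last (g # ps))) # dn)"
      have "out_prob \<tau> (mstep d s) = match_prob \<tau> dn + (?h - match_prob \<tau> dn) * root_prob (mstep d s)" for d
      proof -
        obtain md' g' ps' where "mstep d (md, g # ps, dn) = (md', g' # ps', dn)"
          "fv (last (g' # ps')) = fv (last (g # ps))" "fc (last (g' # ps')) = fc (last (g # ps))"
          by (rule active_mstep[OF nroot])
        then show ?thesis by (simp add: fields Cons algebra_simps del: root_prob.simps last.simps)
      qed
      then have "expect (\<lambda>d. out_prob \<tau> (mstep d s)) = match_prob \<tau> dn + (?h - match_prob \<tau> dn) * expect (\<lambda>d. root_prob (mstep d s))"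
        by (simp only: expect_affine)
      then show ?thesis
        using root_prob_mstep[OF i nroot]
        by (simp add: fields Cons algebra_simps del: root_prob.simps last.simps)
    qed
  qed
qed

lemma out_prob_terminal:
  assumes "invar s" "terminal s" and \<tau>: "\<tau> \<in> set vs \<rightarrow>\<^sub>E {1..q}"
  shows "out_prob \<tau> s = of_bool (agrees \<tau> (snd (snd s)))"
proof -
  obtain md dn where s: "s = (md, [], dn)" "length dn \<ge> length vs" using assms(2) by (cases s) auto
  have d: "done_ok dn" "legal dn" using assms(1) s by auto
  then have pins: "pins dn = set vs" using done_ok_pins s(2) by simp
  show ?thesis
  proof (cases "agrees \<tau> dn")
    case True
    have "ncol dn = card (matching \<tau>)"
      using card_matching_ge[OF d(2) _ pins True \<tau>] card_matching_le[OF _ True] pins d(1)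
      by (simp add: done_ok_def le_antisym)
    moreover have "ncol dn > 0" using ncol_pos legal_distinct[OF d(2)] by blast
    ultimately show ?thesis using True s by (simp add: match_prob_def)
  qed (use s in \<open>simp add: match_prob_def\<close>)
qed

lemma out_prob_initial:
  assumes \<tau>: "\<tau> \<in> set vs \<rightarrow>\<^sub>E {1..q}"
  shows "out_prob \<tau> (md, [], []) = marginal V q (uniform_coloring V E q) (set vs) \<tau>"
proof -
  let ?P = "proper_colorings V E q"
  have ne: "?P \<noteq> {}" "finite ?P" using ncol_pos[of "[]"] finite_cols[of "[]"] unfolding ncol_def cols_Nil by auto
  let ?S = "{\<sigma> \<in> V \<rightarrow>\<^sub>E {1..q}. restrict \<sigma> (set vs) = \<tau>}"
  have fin: "finite ?S" using finite_V by (intro finite_subset[OF _ finite_PiE[of V "\<lambda>_. {1..q}"]]) auto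
  have "marginal V q (uniform_coloring V E q) (set vs) \<tau> = (\<Sum>\<sigma>\<in>?S. indicator ?P \<sigma> / real (card ?P))"
    unfolding marginal_def uniform_coloring_def using ne by (intro sum.cong) (simp_all add: pmf_of_set)
  also have "\<dots> = (\<Sum>\<sigma>\<in>?S. if \<sigma> \<in> ?P then 1 / real (card ?P) else 0)"
    by (intro sum.cong) (auto simp: indicator_def)
  also have "\<dots> = (\<Sum>\<sigma>\<in>?S \<inter> ?P. 1 / real (card ?P))"
    by (rule sum.inter_restrict[OF fin, symmetric])
  also have "\<dots> = (\<Sum>\<sigma>\<in>matching \<tau>. 1 / real (card ?P))"
  proof -
    have "?S \<inter> ?P = matching \<tau>" by (auto simp: matching_def proper_colorings_def)
    then show ?thesis by simp
  qed
  also have "\<dots> = real (card (matching \<tau>)) / real (card ?P)" by simp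
  finally show ?thesis by (simp add: match_prob_def agrees_def ncol_def cols_Nil)
qed

end

section \<open>Runs of the machine\<close>

context sampler begin

text \<open>The recursion takes the first draw off the tape, so that in inductions
  \<open>nn_integral_draw3\<close> applies to it.\<close>

fun chain :: "mstate \<Rightarrow> real stream \<Rightarrow> nat \<Rightarrow> mstate" where
  "chain s \<omega> 0 = s"
| "chain s \<omega> (Suc n) = chain (mstep (draw3 q \<omega>) s) (stl3 \<omega>) n"

lemma measurable_chain [measurable]:
  "(\<lambda>\<omega>. chain s \<omega> n) \<in> measurable tape_space (count_space UNIV)"
proof (induction n arbitrary: s)
  case (Suc n)
  have "(\<lambda>\<omega>. chain (mstep d s) (stl3 \<omega>) n) \<in> measurable tape_space (count_space UNIV)" for d
    by (rule measurable_compose[OF measurable_stl3 Suc])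
  then show ?case unfolding chain.simps
    by (rule measurable_compose_countable[OF _ measurable_draw3])
qed simp

lemma invar_draw: "invar s \<Longrightarrow> invar (mstep (draw3 q \<omega>) s)"
  unfolding draw3_def by (rule invar_mstep) (simp_all add: uniform_index_less q_pos)

lemma invar_chain: "invar s \<Longrightarrow> invar (chain s \<omega> n)"
  by (induction n arbitrary: s \<omega>) (simp_all add: invar_draw)

lemma terminal_mstep: "terminal s \<Longrightarrow> mstep d s = s"
  by (cases s; cases d) auto

lemma terminal_chain: "terminal s \<Longrightarrow> chain s \<omega> n = s"
  by (induction n arbitrary: \<omega>) (simp_all add: terminal_mstep)

lemma chain_add: "chain s \<omega> (m + n) = chain (chain s \<omega> m) ((stl3 ^^ m) \<omega>) n"
  by (induction m arbitrary: s \<omega>) (simp_all add: funpow_swap1)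

lemma terminal_chain_mono:
  assumes "terminal (chain s \<omega> m)" "m \<le> n"
  shows "chain s \<omega> n = chain s \<omega> m"
  using chain_add[of s \<omega> m "n - m"] terminal_chain[OF assms(1)] assms(2) by simp

lemma q_ge_4: "q \<ge> 4" using colors degree_pos by simp

lemma ennreal_expect:
  assumes "\<And>t n1 n2. n1 < q \<Longrightarrow> n2 < q \<Longrightarrow> 0 \<le> g (t, n1, n2)"
  shows "ennreal (expect g) =
    (\<Sum>t<4. \<Sum>n1<q. \<Sum>n2<q. ennreal (tag_prob q t / (real q)\<^sup>2) * ennreal (g (t, n1, n2)))"
proof -
  have w: "0 \<le> tag_prob q t / (real q)\<^sup>2" for t
    using tag_prob_nonneg[of t] by simp
  then have nn: "0 \<le> tag_prob q t / (real q)\<^sup>2 * g (t, n1, n2)" if "n1 < q" "n2 < q" for t n1 n2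
    using assms that by (intro mult_nonneg_nonneg) auto
  have "(\<Sum>t<4. \<Sum>n1<q. \<Sum>n2<q. ennreal (tag_prob q t / (real q)\<^sup>2) * ennreal (g (t, n1, n2))) =
      (\<Sum>t<4. \<Sum>n1<q. \<Sum>n2<q. ennreal (tag_prob q t / (real q)\<^sup>2 * g (t, n1, n2)))"
    using w assms by (intro sum.cong refl ennreal_mult[symmetric]) auto
  also have "\<dots> = ennreal (\<Sum>t<4. \<Sum>n1<q. \<Sum>n2<q. tag_prob q t / (real q)\<^sup>2 * g (t, n1, n2))"
  proof -
    have "(\<Sum>n1<q. \<Sum>n2<q. ennreal (tag_prob q t / (real q)\<^sup>2 * g (t, n1, n2))) =
        (\<Sum>n1<q. ennreal (\<Sum>n2<q. tag_prob q t / (real q)\<^sup>2 * g (t, n1, n2)))" for t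
      by (intro sum.cong refl sum_ennreal) (use nn in auto)
    moreover have "(\<Sum>n1<q. ennreal (\<Sum>n2<q. tag_prob q t / (real q)\<^sup>2 * g (t, n1, n2))) =
        ennreal (\<Sum>n1<q. \<Sum>n2<q. tag_prob q t / (real q)\<^sup>2 * g (t, n1, n2))" for t
      by (intro sum_ennreal sum_nonneg) (use nn in auto)
    ultimately show ?thesis
      by (simp only:) (intro sum_ennreal sum_nonneg, use nn in auto)
  qed
  finally show ?thesis unfolding expect_def by simp
qed

lemma nn_integral_draw_le:
  assumes "\<And>d. F d \<in> borel_measurable tape_space"
    and "\<And>t n1 n2. n1 < q \<Longrightarrow> n2 < q \<Longrightarrow>
      0 \<le> g (t, n1, n2) \<and> (\<integral>\<^sup>+ \<omega>. F (t, n1, n2) \<omega> \<partial>tape_space) \<le> ennreal (g (t, n1, n2))"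
  shows "(\<integral>\<^sup>+ \<omega>. F (draw3 q \<omega>) (stl3 \<omega>) \<partial>tape_space) \<le> ennreal (expect g)"
proof -
  have "(\<integral>\<^sup>+ \<omega>. F (draw3 q \<omega>) (stl3 \<omega>) \<partial>tape_space) \<le>
    (\<Sum>t<4. \<Sum>n1<q. \<Sum>n2<q. ennreal (tag_prob q t / (real q)\<^sup>2) * ennreal (g (t, n1, n2)))"
    unfolding nn_integral_draw3[of q F, OF q_ge_4 assms(1)]
    by (intro sum_mono mult_left_mono) (use assms(2) in auto)
  also have "\<dots> = ennreal (expect g)" using assms(2) by (intro ennreal_expect[symmetric]) auto
  finally show ?thesis .
qed

lemma nn_integral_draw_eq:
  assumes "\<And>d. F d \<in> borel_measurable tape_space"
    and "\<And>t n1 n2. n1 < q \<Longrightarrow> n2 < q \<Longrightarrow>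
      0 \<le> g (t, n1, n2) \<and> (\<integral>\<^sup>+ \<omega>. F (t, n1, n2) \<omega> \<partial>tape_space) = ennreal (g (t, n1, n2))"
  shows "(\<integral>\<^sup>+ \<omega>. F (draw3 q \<omega>) (stl3 \<omega>) \<partial>tape_space) = ennreal (expect g)"
proof -
  have "(\<integral>\<^sup>+ \<omega>. F (draw3 q \<omega>) (stl3 \<omega>) \<partial>tape_space) =
    (\<Sum>t<4. \<Sum>n1<q. \<Sum>n2<q. ennreal (tag_prob q t / (real q)\<^sup>2) * ennreal (g (t, n1, n2)))"
    unfolding nn_integral_draw3[of q F, OF q_ge_4 assms(1)]
    by (intro sum.cong refl) (use assms(2) in auto)
  also have "\<dots> = ennreal (expect g)" using assms(2) by (intro ennreal_expect[symmetric]) auto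
  finally show ?thesis .
qed

definition running :: "mstate \<Rightarrow> ennreal" where
  "running s = (if terminal s then 0 else 1)"

lemma measurable_running [measurable]:
  "(\<lambda>\<omega>. running (chain s \<omega> n)) \<in> borel_measurable tape_space"
  by (rule measurable_compose[OF measurable_chain]) simp

text \<open>The drift pays for each step that starts in a nonterminal state. Truncation at
  \<open>n\<close> allows an induction that presupposes no termination.\<close>

lemma nn_integral_running_partial:
  assumes "invar s"
  shows "(\<integral>\<^sup>+ \<omega>. (\<Sum>i<n. running (chain s \<omega> i)) \<partial>tape_space) \<le> ennreal (potential s)"
  using assms
proof (induction n arbitrary: s)
  case (Suc n)
  show ?case
  proof (cases "terminal s")
    case True
    then have "running (chain s \<omega> i) = 0" for \<omega> i by (simp add: terminal_chain running_def)
    then show ?thesis by simp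
  next
    case False
    let ?F = "\<lambda>d \<omega>. \<Sum>i<n. running (chain (mstep d s) \<omega> i)"
    have "(\<integral>\<^sup>+ \<omega>. (\<Sum>i<Suc n. running (chain s \<omega> i)) \<partial>tape_space) =
        (\<integral>\<^sup>+ \<omega>. 1 + ?F (draw3 q \<omega>) (stl3 \<omega>) \<partial>tape_space)"
      unfolding sum.lessThan_Suc_shift using False by (simp add: running_def)
    also have "\<dots> = 1 + (\<integral>\<^sup>+ \<omega>. ?F (draw3 q \<omega>) (stl3 \<omega>) \<partial>tape_space)"
    proof -
      have "(\<lambda>\<omega>. ?F d (stl3 \<omega>)) \<in> borel_measurable tape_space" for d
        by (rule measurable_compose[OF measurable_stl3]) measurable
      then have "(\<lambda>\<omega>. ?F (draw3 q \<omega>) (stl3 \<omega>)) \<in> borel_measurable tape_space"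
        by (rule measurable_compose_countable[OF _ measurable_draw3])
      then show ?thesis
        using prob_space.emeasure_space_1[OF prob_space_tape]
        by (subst nn_integral_add) auto
    qed
    also have "\<dots> \<le> 1 + ennreal (expect (\<lambda>d. potential (mstep d s)))"
      using Suc invar_mstep potential_nonneg
      by (intro add_left_mono nn_integral_draw_le) auto
    also have "\<dots> = ennreal (1 + expect (\<lambda>d. potential (mstep d s)))"
    proof -
      have "expect (\<lambda>_. 0) \<le> expect (\<lambda>d. potential (mstep d s))"
        using Suc.prems invar_mstep potential_nonneg by (intro expect_mono) auto
      then show ?thesis by (simp add: expect_const)
    qed
    also have "\<dots> \<le> ennreal (potential s)"
      using potential_drift[OF Suc.prems False] by (intro ennreal_leI) simp
    finally show ?thesis .
  qed
qed simp

lemma nn_integral_running: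
  assumes "invar s"
  shows "(\<integral>\<^sup>+ \<omega>. (\<Sum>i. running (chain s \<omega> i)) \<partial>tape_space) \<le> ennreal (potential s)"
proof -
  have "(\<integral>\<^sup>+ \<omega>. (\<Sum>i. running (chain s \<omega> i)) \<partial>tape_space) =
      (\<Sum>i. \<integral>\<^sup>+ \<omega>. running (chain s \<omega> i) \<partial>tape_space)"
    by (rule nn_integral_suminf) measurable
  also have "\<dots> = (SUP n. \<Sum>i<n. \<integral>\<^sup>+ \<omega>. running (chain s \<omega> i) \<partial>tape_space)"
    by (rule suminf_eq_SUP)
  also have "\<dots> \<le> ennreal (potential s)"
    using nn_integral_running_partial[OF assms]
    by (intro SUP_least) (simp add: nn_integral_sum)
  finally show ?thesis .
qed

lemma nn_integral_out_prob:
  assumes "invar s" and \<tau>: "\<tau> \<in> set vs \<rightarrow>\<^sub>E {1..q}"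
  shows "(\<integral>\<^sup>+ \<omega>. ennreal (out_prob \<tau> (chain s \<omega> n)) \<partial>tape_space) = ennreal (out_prob \<tau> s)"
  using assms(1)
proof (induction n arbitrary: s)
  case 0
  then show ?case using prob_space.emeasure_space_1[OF prob_space_tape] by simp
next
  case (Suc n)
  have "(\<integral>\<^sup>+ \<omega>. ennreal (out_prob \<tau> (chain (mstep (draw3 q \<omega>) s) (stl3 \<omega>) n)) \<partial>tape_space) =
      ennreal (expect (\<lambda>d. out_prob \<tau> (mstep d s)))"
  proof (rule nn_integral_draw_eq)
    show "(\<lambda>\<omega>. ennreal (out_prob \<tau> (chain (mstep d s) \<omega> n))) \<in> borel_measurable tape_space" for d
      by (rule measurable_compose[OF measurable_chain]) simp
    show "0 \<le> out_prob \<tau> (mstep (t, n1, n2) s) \<and>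
        (\<integral>\<^sup>+ \<omega>. ennreal (out_prob \<tau> (chain (mstep (t, n1, n2) s) \<omega> n)) \<partial>tape_space) =
        ennreal (out_prob \<tau> (mstep (t, n1, n2) s))" if "n1 < q" "n2 < q" for t n1 n2
      using Suc.IH out_prob_bounds(1) invar_mstep[OF Suc.prems that(2)] by blast
  qed
  then show ?case using out_prob_mstep[OF Suc.prems \<tau>] by simp
qed

definition outcome :: "(nat \<Rightarrow> nat) \<Rightarrow> mstate \<Rightarrow> bool" where
  "outcome \<tau> s \<longleftrightarrow> terminal s \<and> agrees \<tau> (snd (snd s))"

lemma outcome_set [measurable]: "{\<omega>. outcome \<tau> (chain s \<omega> n)} \<in> sets tape_space"
proof -
  have "(\<lambda>\<omega>. chain s \<omega> n) -` {s. outcome \<tau> s} \<inter> space tape_space \<in> sets tape_space"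
    by (rule measurable_sets[OF measurable_chain]) simp
  then show ?thesis by (simp add: vimage_def)
qed

lemma outcome_bounds:
  assumes "invar s" and \<tau>: "\<tau> \<in> set vs \<rightarrow>\<^sub>E {1..q}"
  shows "of_bool (outcome \<tau> s) \<le> ennreal (out_prob \<tau> s)" "ennreal (out_prob \<tau> s) \<le> of_bool (outcome \<tau> s) + running s"
  using out_prob_terminal[OF assms(1) _ \<tau>] out_prob_bounds[OF assms(1), of \<tau>]
  by (auto simp: outcome_def running_def)

lemma outcome_Union:
  "{\<omega>. \<exists>n. outcome \<tau> (chain s \<omega> n)} = (\<Union>n. {\<omega>. outcome \<tau> (chain s \<omega> n)})"
  by auto

lemma outcome_measurable: "{\<omega>. \<exists>n. outcome \<tau> (chain s \<omega> n)} \<in> sets tape_space"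
  unfolding outcome_Union by measurable

text \<open>\<open>out_prob\<close> has constant expectation and equals the indicator of the outcome
  except in states still running. The probabilities of the latter have a bounded sum, so they become
  arbitrarily small.\<close>

lemma emeasure_outcome:
  assumes invar: "invar s" and \<tau>: "\<tau> \<in> set vs \<rightarrow>\<^sub>E {1..q}"
  shows "emeasure tape_space {\<omega>. \<exists>n. outcome \<tau> (chain s \<omega> n)} = ennreal (out_prob \<tau> s)"
proof -
  let ?P = "\<lambda>n. emeasure tape_space {\<omega>. outcome \<tau> (chain s \<omega> n)}"
  let ?e = "\<lambda>n. \<integral>\<^sup>+ \<omega>. running (chain s \<omega> n) \<partial>tape_space"
  have P: "?P n = (\<integral>\<^sup>+ \<omega>. of_bool (outcome \<tau> (chain s \<omega> n)) \<partial>tape_space)" for n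
  proof -
    have "(\<integral>\<^sup>+ \<omega>. of_bool (outcome \<tau> (chain s \<omega> n)) \<partial>tape_space) =
        (\<integral>\<^sup>+ \<omega>. indicator {\<omega>. outcome \<tau> (chain s \<omega> n)} \<omega> \<partial>tape_space)"
      by (intro nn_integral_cong) (auto simp: indicator_def)
    then show ?thesis by (simp add: nn_integral_indicator[OF outcome_set])
  qed
  have le: "?P n \<le> ennreal (out_prob \<tau> s)" for n
    unfolding P nn_integral_out_prob[OF invar \<tau>, of n, symmetric]
    using outcome_bounds(1)[OF invar_chain[OF invar] \<tau>] by (intro nn_integral_mono) auto
  have ge: "ennreal (out_prob \<tau> s) \<le> ?P n + ?e n" for n
  proof -
    have "ennreal (out_prob \<tau> s) \<le>
        (\<integral>\<^sup>+ \<omega>. of_bool (outcome \<tau> (chain s \<omega> n)) + running (chain s \<omega> n) \<partial>tape_space)"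
      unfolding nn_integral_out_prob[OF invar \<tau>, of n, symmetric]
      using outcome_bounds(2)[OF invar_chain[OF invar] \<tau>] by (intro nn_integral_mono) auto
    also have "\<dots> = ?P n + ?e n"
    proof -
      have "(\<lambda>\<omega>. of_bool (outcome \<tau> (chain s \<omega> n)) :: ennreal) \<in> borel_measurable tape_space"
        by (rule measurable_compose[OF measurable_chain]) simp
      then show ?thesis unfolding P by (subst nn_integral_add) auto
    qed
    finally show ?thesis .
  qed
  have "emeasure tape_space {\<omega>. \<exists>n. outcome \<tau> (chain s \<omega> n)} = (SUP n. ?P n)"
    unfolding outcome_Union
  proof (rule SUP_emeasure_incseq[symmetric])
    show "incseq (\<lambda>n. {\<omega>. outcome \<tau> (chain s \<omega> n)})"
    proof (rule incseq_SucI, rule subsetI)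
      fix n \<omega> assume "\<omega> \<in> {\<omega>. outcome \<tau> (chain s \<omega> n)}"
      then show "\<omega> \<in> {\<omega>. outcome \<tau> (chain s \<omega> (Suc n))}"
        using terminal_chain_mono[of s \<omega> n "Suc n"] by (simp add: outcome_def del: chain.simps)
    qed
  qed auto
  also have "\<dots> = ennreal (out_prob \<tau> s)"
  proof (rule antisym)
    show "(SUP n. ?P n) \<le> ennreal (out_prob \<tau> s)" using le by (intro SUP_least)
    show "ennreal (out_prob \<tau> s) \<le> (SUP n. ?P n)"
    proof (rule ennreal_le_epsilon)
      fix e :: real assume e: "0 < e"
      \<comment> \<open>Otherwise \<open>n\<close> of these expectations would add up to at least
        \<open>n * e\<close> and finally exceed the potential.\<close>
      have "\<exists>n. ?e n \<le> ennreal e"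
      proof (rule ccontr)
        assume "\<not> (\<exists>n. ?e n \<le> ennreal e)"
        then have all: "ennreal e \<le> ?e n" for n by (meson linear)
        obtain n :: nat where n: "potential s < real n * e" using reals_Archimedean3[OF e] by blast
        have "ennreal (real n * e) = (\<Sum>i<n. ennreal e)" using e by (simp add: ennreal_mult ennreal_of_nat_eq_real_of_nat)
        also have "\<dots> \<le> (\<Sum>i<n. ?e i)" by (intro sum_mono all)
        also have "\<dots> = (\<integral>\<^sup>+ \<omega>. (\<Sum>i<n. running (chain s \<omega> i)) \<partial>tape_space)"
          by (rule nn_integral_sum[symmetric]) measurable
        also have "\<dots> \<le> ennreal (potential s)" by (rule nn_integral_running_partial[OF invar])
        finally show False using n potential_nonneg[OF invar] by (simp add: ennreal_le_iff)
      qed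
      then obtain n where n: "?e n \<le> ennreal e" by blast
      have "ennreal (out_prob \<tau> s) \<le> ?P n + ?e n" by (rule ge)
      also have "\<dots> \<le> (SUP n. ?P n) + ennreal e" using n by (intro add_mono SUP_upper) auto
      finally show "ennreal (out_prob \<tau> s) \<le> (SUP n. ?P n) + ennreal e" .
    qed
  qed
  finally show ?thesis .
qed

end

section \<open>The program\<close>

text \<open>A step-counting evaluator for loop-free code, written so that simplification can run the
  loop body symbolically; \<open>exec_step\<close> connects it with \<open>step\<close>.\<close>

fun exec :: "(nat \<Rightarrow> nat list) \<Rightarrow> cmd list \<Rightarrow> store \<Rightarrow> real stream \<Rightarrow> nat \<times> store \<times> real stream" where
  "exec adj [] s \<omega> = (0, s, \<omega>)"
| "exec adj (If t c c' # cs) s \<omega> = apfst Suc (exec adj ((if holds s t then c else c') @ cs) s \<omega>)"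
| "exec adj (While t c # cs) s \<omega> = undefined"
| "exec adj (Assign x e # cs) s \<omega> = apfst Suc (exec adj cs (set_reg x (eval s e) s) \<omega>)"
| "exec adj (Insert d ks e # cs) s \<omega> =
     apfst Suc (exec adj cs (set_dict d (map (eval s) ks) (Some (eval s e)) s) \<omega>)"
| "exec adj (Delete d ks # cs) s \<omega> = apfst Suc (exec adj cs (set_dict d (map (eval s) ks) None s) \<omega>)"
| "exec adj (Probe x a b # cs) s \<omega> =
     apfst Suc (exec adj cs (set_reg x (probe adj (eval s a) (eval s b)) s) \<omega>)"
| "exec adj (DrawUnit x # cs) s \<omega> = apfst Suc (exec adj cs (set_reg x (shd \<omega>) s) (stl \<omega>))"
| "exec adj (DrawList x d e # cs) s \<omega> =
     apfst Suc (exec adj cs (set_reg x (case dict s d [real (uniform_index (nat \<lfloor>eval s e\<rfloor>) (shd \<omega>))] of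
       None \<Rightarrow> 0 | Some r \<Rightarrow> r) s) (stl \<omega>))"

fun loop_free :: "cmd \<Rightarrow> bool" where
  "loop_free (If t c c') \<longleftrightarrow> list_all loop_free c \<and> list_all loop_free c'"
| "loop_free (While t c) \<longleftrightarrow> False"
| "loop_free _ \<longleftrightarrow> True"

lemma exec_step:
  assumes "list_all loop_free cs" "exec adj cs s \<omega> = (n, s', \<omega>')"
  shows "(step adj ^^ n) (cs @ rest, s, \<omega>) = (rest, s', \<omega>')"
  using assms
proof (induction adj cs s \<omega> arbitrary: n rule: exec.induct)
  case (2 adj t c c' cs s \<omega>)
  then obtain m where m: "n = Suc m"
    "exec adj ((if holds s t then c else c') @ cs) s \<omega> = (m, s', \<omega>')"
    by (auto simp: apfst_def map_prod_def split: prod.splits)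
  have "list_all loop_free ((if holds s t then c else c') @ cs)" using 2(2) by auto
  from 2(1)[OF this m(2)] show ?case by (simp add: m(1) funpow_swap1 del: funpow.simps) (simp add: funpow_swap1)
qed (auto simp: apfst_def map_prod_def funpow_swap1 split: prod.splits)

definition get :: "store \<Rightarrow> string \<Rightarrow> real list \<Rightarrow> real" where
  "get s d ks = (case dict s d ks of None \<Rightarrow> 0 | Some r \<Rightarrow> r)"

lemma get_set [simp]:
  "get (set_dict d k (Some r) s) d' k' = (if d' = d \<and> k' = k then r else get s d' k')"
  "get (set_reg x r s) d' k' = get s d' k'"
  "reg (set_dict d k r' s) y = reg s y"
  "reg (set_reg x r s) y = (if y = x then r else reg s y)"
  "dict (set_reg x r s) = dict s"
  "dict (set_dict d k r' s) d' = (if d' = d then (dict s d)(k := r') else dict s d')"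
  by (simp_all add: get_def set_dict_def set_reg_def)

lemma eval_Lookup: "eval s (Lookup d ks) = get s d (map (eval s) ks)"
  by (simp add: get_def)

lemma probe_nat: "probe adj (real v) (real j) = (if j < length (adj v) then real (adj v ! j) else -1)"
  by (simp add: probe_def)

lemma exec_DrawList: "exec adj (DrawList x d e # cs) s \<omega> =
   apfst Suc (exec adj cs (set_reg x (get s d [real (uniform_index (nat \<lfloor>eval s e\<rfloor>) (shd \<omega>))]) s) (stl \<omega>))"
  by (simp add: get_def)

text \<open>\<open>pos\<close> at \<open>(w, v)\<close> is one more than the index of
  \<open>v\<close> among the neighbors of \<open>w\<close>, or 0 if unknown; the test asks whether
  that index is below the check index of \<open>w\<close>.\<close>

definition blocks_test :: test where
  "blocks_test = Conj (Neg (Equal (Lookup ''pos'' [Reg ''w'', Reg ''v'']) (Num 0)))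
     (Neg (Less (Lookup ''idx'' [Reg ''w'']) (Lookup ''pos'' [Reg ''w'', Reg ''v''])))"

definition forced_test :: test where
  "forced_test = Equal (Lookup ''frc'' [Reg ''v'']) (Plus (Lookup ''idx'' [Reg ''v'']) (Num 1))"

definition pinned_test :: test where
  "pinned_test = Equal (Lookup ''pin'' [Reg ''w'']) (Num 1)"

text \<open>The value -1 signals both a probe beyond the last neighbor and the missing parent of the
  outermost frame.\<close>

definition none_test :: test where
  "none_test = Equal (Reg ''w'') (Num (-1))"

definition open_frame :: "cmd list" where
  "open_frame =
    [Insert ''tgt'' [Reg ''v''] (Reg ''b''), Insert ''col'' [Reg ''v''] (Reg ''b''),
     Insert ''frc'' [Reg ''v''] (Num 0), Insert ''idx'' [Reg ''v''] (Num 0),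
     Insert ''pin'' [Reg ''v''] (Num 1), Assign ''d'' (Num 1)]"

definition next_slot :: "cmd list" where
  "next_slot =
    [Insert ''pos'' [Reg ''v'', Reg ''w''] (Plus (Lookup ''idx'' [Reg ''v'']) (Num 1)),
     Insert ''idx'' [Reg ''v''] (Plus (Lookup ''idx'' [Reg ''v'']) (Num 1)), Assign ''d'' (Num 2)]"

definition new_body :: "cmd list" where
  "new_body =
    [Assign ''v'' (Lookup ''Lambda'' [Reg ''k'']), Insert ''par'' [Reg ''v''] (Num (-1))] @ open_frame"

text \<open>\<open>idx\<close> and \<open>frc\<close> are written even when the round fails at once,
  which is why \<open>mstep\<close> updates the frame in that case, too.\<close>

definition round_body :: "cmd list" where
  "round_body =
    [Insert ''idx'' [Reg ''v''] (Num 0),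
     If (Less (Times (Num 2) (Reg ''u'')) (Num 1))
       [Insert ''frc'' [Reg ''v''] (Num 0),
        Insert ''col'' [Reg ''v''] (Lookup ''tgt'' [Reg ''v'']), Assign ''d'' (Num 2)]
       [Probe ''w'' (Reg ''v'') (Reg ''a''),
        Insert ''frc'' [Reg ''v''] (Plus (Reg ''a'') (Num 1)),
        If none_test [Assign ''d'' (Num 3)]
          [If pinned_test
            [If (Conj blocks_test (Less (Times (Num 4) (Reg ''u'')) (Num 3)))
              [Insert ''col'' [Reg ''v''] (Lookup ''col'' [Reg ''w'']), Assign ''d'' (Num 2)]
              [Assign ''d'' (Num 3)]]
            [Insert ''col'' [Reg ''v''] (Reg ''b''), Assign ''d'' (Num 2)]]]]"

text \<open>Tests have no disjunction, whence the negated conjunction that expresses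
  \<open>f = j + 1 \<or> t = 0\<close>.\<close>

definition slot_body :: "cmd list" where
  "slot_body =
    [Probe ''w'' (Reg ''v'') (Lookup ''idx'' [Reg ''v'']),
     If none_test
       [If (Equal (Lookup ''frc'' [Reg ''v'']) (Num 0)) [Assign ''d'' (Num 4)] [Assign ''d'' (Num 3)]]
       [If pinned_test
         [If forced_test [Assign ''d'' (Num 1)]
           [If (Conj blocks_test (Equal (Lookup ''col'' [Reg ''w'']) (Lookup ''col'' [Reg ''v''])))
             [Assign ''d'' (Num 3)] next_slot]]
         [If (Neg (Conj (Neg forced_test) (Neg (Less (Times (Reg ''u'') (Reg ''q'')) (Num 2)))))
           ([Insert ''par'' [Reg ''w''] (Reg ''v''), Assign ''b'' (Lookup ''col'' [Reg ''v'']),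
             Assign ''v'' (Reg ''w'')] @ open_frame)
           next_slot]]]"

text \<open>\<open>w\<close> first holds the parent. The final probe recovers the neighbor asked
  about, whose position \<open>next_slot\<close> has to record.\<close>

definition return_body :: "cmd list" where
  "return_body =
    [Assign ''w'' (Lookup ''par'' [Reg ''v'']),
     If none_test
       [If (Equal (Reg ''d'') (Num 4))
         [Insert ''out'' [Reg ''v''] (Lookup ''col'' [Reg ''v'']), Assign ''k'' (Plus (Reg ''k'') (Num 1))]
         [Insert ''pin'' [Reg ''v''] (Num 0)],
        Assign ''d'' (Num 0)]
       [Insert ''pin'' [Reg ''v''] (Num 0), Assign ''v'' (Reg ''w''),
        If forced_test
          [If (Equal (Reg ''d'') (Num 4)) [Assign ''d'' (Num 1)] [Assign ''d'' (Num 3)]]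
          [If (Equal (Reg ''d'') (Num 4)) [Assign ''d'' (Num 3)]
            ([Probe ''w'' (Reg ''v'') (Lookup ''idx'' [Reg ''v''])] @ next_slot)]]]"

definition main_body :: "cmd list" where
  "main_body =
    [DrawUnit ''u'', DrawList ''a'' ''S'' (Reg ''q''), DrawList ''b'' ''C'' (Reg ''q''),
     If (Equal (Reg ''d'') (Num 0)) new_body
       [If (Equal (Reg ''d'') (Num 1)) round_body
         [If (Equal (Reg ''d'') (Num 2)) slot_body return_body]]]"

definition main_loop :: cmd where
  "main_loop = While (Less (Reg ''k'') (Reg ''m'')) main_body"

text \<open>\<open>r\<close> and \<open>t\<close> count remainder and quotient of \<open>i\<close>
  modulo 4, as no rounding is available.\<close>

definition init_loop :: cmd where
  "init_loop = While (Less (Reg ''i'') (Reg ''q''))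
    [Insert ''C'' [Reg ''i''] (Plus (Reg ''i'') (Num 1)), Insert ''S'' [Reg ''i''] (Reg ''t''),
     Assign ''i'' (Plus (Reg ''i'') (Num 1)), Assign ''r'' (Plus (Reg ''r'') (Num 1)),
     If (Equal (Reg ''r'') (Num 4)) [Assign ''r'' (Num 0), Assign ''t'' (Plus (Reg ''t'') (Num 1))] []]"

definition program :: "cmd list" where
  "program = [init_loop, main_loop]"

fun parent_of :: "frame list \<Rightarrow> real" where
  "parent_of [] = -1"
| "parent_of (h # ps) = real (fv h)"

text \<open>No vertex occurs in two frames at once, so frames are stored under their vertices and
  the stack is a linked list along \<open>par\<close>.\<close>

fun parents :: "(nat \<Rightarrow> real) \<Rightarrow> frame list \<Rightarrow> bool" where
  "parents p [] \<longleftrightarrow> True"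
| "parents p (g # ps) \<longleftrightarrow> p (fv g) = parent_of ps \<and> parents p ps"

lemma parents_if [simp]:
  "w \<notin> pins act \<Longrightarrow> parents (\<lambda>x. if x = w then r else p x) act = parents p act"
  by (induction act) auto

lemma pins_append [simp]: "pins (I @ J) = pins I \<union> pins J"
  by (auto simp: pins_def)

fun mode_code :: "mode \<Rightarrow> real" where
  "mode_code Rnd = 1"
| "mode_code Slt = 2"
| "mode_code (Ret False) = 3"
| "mode_code (Ret True) = 4"

context sampler begin

text \<open>The entry of \<open>pos\<close> at \<open>v\<close> and its neighbor of index \<open>i\<close> is \<open>i + 1\<close> once it has been written, so
  it never has to be undone, and it is always present for the neighbors below the current index.\<close>

definition globals :: "store \<Rightarrow> bool" where
  "globals st \<longleftrightarrow> reg st ''q'' = real q \<and> reg st ''m'' = real (length vs) \<and>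
     (\<forall>i<length vs. get st ''Lambda'' [real i] = real (vs ! i)) \<and>
     (\<forall>i<q. get st ''C'' [real i] = real (i + 1)) \<and> (\<forall>i<q. get st ''S'' [real i] = real (i div 4)) \<and>
     (\<forall>v i. i < deg v \<longrightarrow> get st ''pos'' [real v, real (adj v ! i)] \<in> {0, real (i + 1)})"

definition frame_rel :: "store \<Rightarrow> frame \<Rightarrow> bool" where
  "frame_rel st h \<longleftrightarrow> get st ''tgt'' [real (fv h)] = real (fc h) \<and>
     get st ''col'' [real (fv h)] = real (fx h) \<and> get st ''frc'' [real (fv h)] = real (ff h) \<and>
     get st ''idx'' [real (fv h)] = real (fj h) \<and>
     (\<forall>i<fj h. get st ''pos'' [real (fv h), real (adj (fv h) ! i)] = real (i + 1))"

fun rel :: "mstate \<Rightarrow> store \<Rightarrow> bool" where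
  "rel (md, act, dn) st \<longleftrightarrow> globals st \<and> reg st ''k'' = real (length dn) \<and>
     reg st ''d'' = (if act = [] then 0 else mode_code md) \<and>
     (act \<noteq> [] \<longrightarrow> reg st ''v'' = real (fv (hd act))) \<and>
     (\<forall>w. get st ''pin'' [real w] = (if w \<in> pins (act @ dn) then 1 else 0)) \<and>
     (\<forall>h \<in> set (act @ dn). frame_rel st h) \<and>
     parents (\<lambda>w. get st ''par'' [real w]) act \<and>
     dict st ''out'' = map_of (map (\<lambda>h. ([real (fv h)], real (fx h))) dn)"

lemma blocks_iff:
  assumes "i < deg (fv h)" "fj h \<le> deg (fv h)"
  shows "blocks h (adj (fv h) ! i) \<longleftrightarrow> i < fj h"
proof
  assume "blocks h (adj (fv h) ! i)"
  then obtain k where "k < fj h" "k < deg (fv h)" "adj (fv h) ! k = adj (fv h) ! i"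
    by (auto simp: blocks_def in_set_conv_nth)
  then show "i < fj h" using distinct_adj[of "fv h"] assms nth_eq_iff_index_eq by metis
next
  assume "i < fj h"
  then show "blocks h (adj (fv h) ! i)"
    using assms by (auto simp: blocks_def in_set_conv_nth)
qed

lemma legal_fj: "legal I \<Longrightarrow> h \<in> set I \<Longrightarrow> fj h \<le> deg (fv h)"
  by (induction I rule: legal.induct) auto

lemma blocks_correct:
  assumes "globals st" "frame_rel st h" "v \<in> set (adj (fv h))" "fj h \<le> deg (fv h)"
    "reg st ''w'' = real (fv h)" "reg st ''v'' = real v"
  shows "holds st blocks_test \<longleftrightarrow> blocks h v"
proof -
  obtain i where i: "i < deg (fv h)" "v = adj (fv h) ! i"
    using assms(3) by (metis in_set_conv_nth)
  have "get st ''pos'' [real (fv h), real v] \<in> {0, real (i + 1)}"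
    "i < fj h \<Longrightarrow> get st ''pos'' [real (fv h), real v] = real (i + 1)"
    "get st ''idx'' [real (fv h)] = real (fj h)"
    using assms(1,2) i by (auto simp: globals_def frame_rel_def)
  then show ?thesis
    using blocks_iff[OF i(1) assms(4)] i(2) assms(5,6)
    by (auto simp: blocks_test_def eval_Lookup simp del: eval.simps(3))
qed

end

section \<open>Simulation of one machine step by the loop body\<close>

lemma tag_le: assumes "q \<ge> 4"
  shows "tag q u = 0 \<longleftrightarrow> u * real q < 2" "tag q u \<le> 1 \<longleftrightarrow> 2 * u < 1" "tag q u \<le> 2 \<longleftrightarrow> 4 * u < 3"
proof -
  have "2 * u < 1" if "u * real q < 2"
  proof (rule ccontr)
    assume "\<not> 2 * u < 1"
    then have "1 / 2 * real 4 \<le> u * real q" using assms by (intro mult_mono) auto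
    then show False using that by simp
  qed
  then show "tag q u = 0 \<longleftrightarrow> u * real q < 2" "tag q u \<le> 1 \<longleftrightarrow> 2 * u < 1" "tag q u \<le> 2 \<longleftrightarrow> 4 * u < 3"
    by (auto simp: tag_def)
qed

definition dispatch :: "cmd list" where
  "dispatch = [If (Equal (Reg ''d'') (Num 0)) new_body
     [If (Equal (Reg ''d'') (Num 1)) round_body
       [If (Equal (Reg ''d'') (Num 2)) slot_body return_body]]]"

context sampler begin

lemma globals_set_reg [simp]: "x \<noteq> ''q'' \<Longrightarrow> x \<noteq> ''m'' \<Longrightarrow> globals (set_reg x r st) = globals st"
  by (simp add: globals_def)

lemma get_set_other: "d' \<noteq> d \<Longrightarrow> get (set_dict d k (Some r) st) d' k' = get st d' k'"
  by simp

lemma globals_set_dict [simp]: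
  assumes "d \<notin> {''Lambda'', ''C'', ''S'', ''pos''}"
  shows "globals (set_dict d k (Some r) st) = globals st"
proof -
  have "''Lambda'' \<noteq> d" "''C'' \<noteq> d" "''S'' \<noteq> d" "''pos'' \<noteq> d" using assms by auto
  then show ?thesis by (simp only: globals_def get_set_other get_set(3) not_False_eq_True)
qed

lemma adj_inject: "i < deg v \<Longrightarrow> j < deg v \<Longrightarrow> adj v ! i = adj v ! j \<longleftrightarrow> i = j"
  using distinct_adj nth_eq_iff_index_eq by blast

lemma globals_set_pos [simp]:
  assumes "globals st" "j < deg v"
  shows "globals (set_dict ''pos'' [real v, real (adj v ! j)] (Some (real j + 1)) st)"
  using assms by (auto simp: globals_def adj_inject)

lemma frame_rel_set_reg [simp]: "frame_rel (set_reg x r st) h = frame_rel st h"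
  by (simp add: frame_rel_def)

lemma frame_rel_set_dict [simp]:
  assumes "d \<notin> {''tgt'', ''col'', ''frc'', ''idx'', ''pos''}"
  shows "frame_rel (set_dict d k (Some r) st) h = frame_rel st h"
proof -
  have "''tgt'' \<noteq> d" "''col'' \<noteq> d" "''frc'' \<noteq> d" "''idx'' \<noteq> d" "''pos'' \<noteq> d" using assms by auto
  then show ?thesis by (simp only: frame_rel_def get_set_other not_False_eq_True)
qed

lemma frame_rel_set_vertex [simp]:
  "d \<noteq> ''pos'' \<Longrightarrow> fv h \<noteq> v \<Longrightarrow> frame_rel (set_dict d [real v] (Some r) st) h = frame_rel st h"
  "fv h \<noteq> v \<Longrightarrow> frame_rel (set_dict ''pos'' [real v, y] (Some r) st) h = frame_rel st h"
  by (simp_all add: frame_rel_def)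

text \<open>The step count is common to all stores that represent the state. Running time thus
  becomes a function of machine states and draws.\<close>

definition simulates :: "mstate \<Rightarrow> draws \<Rightarrow> nat \<Rightarrow> bool" where
  "simulates s d k \<longleftrightarrow> (\<forall>st \<omega>. rel s st \<and> tag q (reg st ''u'') = fst d \<and>
     reg st ''a'' = real (fst (snd d) div 4) \<and> reg st ''b'' = real (snd (snd d) + 1) \<longrightarrow>
     (\<exists>st'. exec adj dispatch st \<omega> = (k, st', \<omega>) \<and> rel (mstep d s) st'))"

lemmas prog_defs = dispatch_def new_body_def round_body_def slot_body_def return_body_def
  open_frame_def next_slot_def forced_test_def pinned_test_def none_test_def

declare eval.simps(3) [simp del]
declare eval_Lookup [simp]

lemma simI:
  assumes "\<And>st \<omega>. rel s st \<Longrightarrow> tag q (reg st ''u'') = t \<Longrightarrow> reg st ''a'' = real (n1 div 4) \<Longrightarrow>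
    reg st ''b'' = real (n2 + 1) \<Longrightarrow>
    \<exists>st'. exec adj dispatch st \<omega> = (k, st', \<omega>) \<and> rel (mstep (t, n1, n2) s) st'"
    and "k \<le> 25"
  shows "\<exists>k\<le>25. simulates s (t, n1, n2) k"
  unfolding simulates_def using assms by (intro exI[of _ k]) simp

lemmas frame_rel_Frame = frame_rel_def[of _ "Frame _ _ _ _ _"]

lemma pins_neq: "w \<notin> pins I \<Longrightarrow> h \<in> set I \<Longrightarrow> fv h \<noteq> w"
  unfolding pins_def by (metis image_eqI)

lemma simulates_new:
  assumes "length dn < length vs" "vs ! length dn \<notin> pins dn"
  shows "\<exists>k\<le>25. simulates (md, [], dn) (t, n1, n2) k"
proof (rule simI[where k = 9], goal_cases)
  case (1 st \<omega>)
  then have L: "get st ''Lambda'' [real (length dn)] = real (vs ! length dn)"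
    using assms by (simp add: globals_def)
  have ne: "fv h \<noteq> vs ! length dn" if "h \<in> set dn" for h
    using pins_neq[OF assms(2) that] .
  show ?case using 1 assms L ne by (simp add: prog_defs frame_rel_Frame)
qed simp

lemma frame_at_facts:
  assumes "legal (Frame v c x f j # I)" "frame_at I w = Some h" "w \<in> set (adj v)"
  shows "h \<in> set I" "fv h = w" "w \<in> pins I" "v \<in> set (adj (fv h))" "fj h \<le> deg (fv h)"
  using frame_at_SomeD[OF assms(2)] legal_fj[of I h] assms(1,3) adj_sym[of w v] frame_at_None[of I w] assms(2) by auto

lemma simulates_round:
  assumes invar: "invar (Rnd, Frame v c x f j # ps, dn)"
  shows "\<exists>k\<le>25. simulates (Rnd, Frame v c x f j # ps, dn) (t, n1, n2) k"
proof -
  let ?I = "ps @ dn" and ?i = "n1 div 4"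
  have legal: "legal (Frame v c x f j # ?I)" using invar by simp
  have ne: "fv h \<noteq> v" if "h \<in> set ?I" for h using pins_neq[OF _ that] legal by simp
  have vp: "v \<notin> pins ps" using legal by simp
  show ?thesis
  proof (cases "t \<le> 1")
    case True
    show ?thesis
    proof (rule simI[where k = 7], goal_cases)
      case (1 st \<omega>)
      then have "2 * reg st ''u'' < 1" using tag_le(2)[OF q_ge_4] True by blast
      then show ?case using 1 True ne vp by (simp add: prog_defs frame_rel_Frame)
    qed simp
  next
    case False
    have u: "\<not> 2 * reg st ''u'' < 1" if "tag q (reg st ''u'') = t" for st
      using that tag_le(2)[OF q_ge_4, of "reg st ''u''"] False by blast
    have u2: "4 * reg st ''u'' < 3 \<longleftrightarrow> t \<le> 2" if "tag q (reg st ''u'') = t" for st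
      using that tag_le(3)[OF q_ge_4, of "reg st ''u''"] by blast
    show ?thesis
    proof (cases "?i < deg v")
      case i: False
      show ?thesis
      proof (rule simI[where k = 8], goal_cases)
        case (1 st \<omega>)
        show ?case using 1 u[OF 1(2)] False i ne vp
          by (simp add: prog_defs frame_rel_Frame probe_nat)
      qed simp
    next
      case i: True
      let ?w = "adj v ! ?i"
      have w: "?w \<in> set (adj v)" "?w \<noteq> v" using i adj_nth by auto
      show ?thesis
      proof (cases "frame_at ?I ?w")
        case None
        then have wp: "?w \<notin> pins ps" "?w \<notin> pins dn" using frame_at_None[of ?I ?w] by auto
        show ?thesis
        proof (rule simI[where k = 10], goal_cases)
          case (1 st \<omega>)
          then have "get st ''pin'' [real ?w] = 0" using w wp by simp
          then show ?case using 1 u[OF 1(2)] False i ne vp None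
            by (simp add: prog_defs frame_rel_Frame probe_nat)
        qed simp
      next
        case (Some h)
        note h = frame_at_facts[OF legal Some w(1)]
        have h1: "h \<in> set ps \<union> set dn" using h(1) by simp
        have fr: "frame_rel st h" if "rel (Rnd, Frame v c x f j # ps, dn) st" for st
          using that h(1) by simp
        have pin: "get st ''pin'' [real ?w] = 1" "frame_rel st h" "get st ''col'' [real ?w] = real (fx h)"
          if "rel (Rnd, Frame v c x f j # ps, dn) st" for st
          using that h(3) fr[OF that] fr[OF that, unfolded frame_rel_def] h(2) by simp_all
        note bt = blocks_correct[where h = h and v = v, OF _ _ h(4,5)]
        show ?thesis
        proof (cases "blocks h v \<and> t \<le> 2")
          case b: True
          show ?thesis
          proof (rule simI[where k = 11], goal_cases)
            case (1 st \<omega>)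
            show ?case using 1 u[OF 1(2)] u2[OF 1(2)] pin[OF 1(1)] False i ne vp Some b h(2) ne[OF h(1)]
              by (simp add: prog_defs frame_rel_Frame probe_nat bt)
          qed simp
        next
          case b: False
          show ?thesis
          proof (rule simI[where k = 10], goal_cases)
            case (1 st \<omega>)
            show ?case using 1 u[OF 1(2)] u2[OF 1(2)] pin[OF 1(1)] False i ne vp Some b h(2) ne[OF h(1)]
              by (simp add: prog_defs frame_rel_Frame probe_nat bt)
          qed simp
        qed
      qed
    qed
  qed
qed

lemma simulates_slot:
  assumes invar: "invar (Slt, Frame v c x f j # ps, dn)"
  shows "\<exists>k\<le>25. simulates (Slt, Frame v c x f j # ps, dn) (t, n1, n2) k"
proof -
  let ?I = "ps @ dn" and ?w = "adj v ! j" and ?s = "(Slt, Frame v c x f j # ps, dn)"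
  have legal: "legal (Frame v c x f j # ?I)" using invar by simp
  have ne: "fv h \<noteq> v" if "h \<in> set ?I" for h using pins_neq[OF _ that] legal by simp
  have vp: "v \<notin> pins ps" using legal by simp
  show ?thesis
  proof (cases "j < deg v")
    case False
    show ?thesis
    proof (rule simI[where k = 7], goal_cases)
      case (1 st \<omega>)
      then show ?case using False ne vp
        by (simp add: prog_defs frame_rel_Frame probe_nat)
    qed simp
  next
    case j: True
    have w: "?w \<in> set (adj v)" "?w \<noteq> v" "v \<noteq> ?w" using j adj_nth(2)[OF j] by auto
    show ?thesis
    proof (cases "frame_at ?I ?w")
      case None
      then have wp: "?w \<notin> pins ps" "?w \<notin> pins dn" using frame_at_None[of ?I ?w] by auto
      have wn: "fv h \<noteq> ?w" if "h \<in> set ps \<union> set dn" for h using pins_neq[of ?w ?I h] that wp by simp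
      have pin: "get st ''pin'' [real ?w] = 0" if "rel ?s st" for st using that w wp by simp
      have u: "reg st ''u'' * real q < 2 \<longleftrightarrow> t = 0" if "tag q (reg st ''u'') = t" for st
        unfolding that[symmetric] by (rule tag_le(1)[OF q_ge_4, symmetric])
      have q: "reg st ''q'' = real q" if "rel ?s st" for st using that by (simp add: globals_def)
      show ?thesis
      proof (cases "f = j + 1 \<or> t = 0")
        case True
        show ?thesis
        proof (rule simI[where k = 16], goal_cases)
          case (1 st \<omega>)
          then show ?case using True j ne vp None w wp wn pin[OF 1(1)] u[OF 1(2)] q[OF 1(1)]
            by (auto simp: prog_defs frame_rel_Frame probe_nat)
        qed simp
      next
        case False
        show ?thesis
        proof (rule simI[where k = 10], goal_cases)
          case (1 st \<omega>)
          then show ?case using False j ne vp None w wp pin[OF 1(1)] u[OF 1(2)] q[OF 1(1)]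
            by (auto simp: prog_defs frame_rel_Frame probe_nat adj_inject less_Suc_eq)
        qed simp
      qed
    next
      case (Some h)
      note h = frame_at_facts[OF legal Some w(1)]
      have fr: "frame_rel st h" if "rel ?s st" for st using that h(1) by simp
      have pin: "get st ''pin'' [real ?w] = 1" "frame_rel st h" "get st ''col'' [real ?w] = real (fx h)"
        if "rel ?s st" for st
        using that h(3) fr[OF that] fr[OF that, unfolded frame_rel_def] h(2) by simp_all
      note bt = blocks_correct[where h = h and v = v, OF _ _ h(4,5)]
      consider (forced) "f = j + 1" | (blocked) "f \<noteq> j + 1" "blocks h v \<and> fx h = x"
        | (free) "f \<noteq> j + 1" "\<not> (blocks h v \<and> fx h = x)" by blast
      then show ?thesis
      proof cases
        case forced
        show ?thesis
        proof (rule simI[where k = 8], goal_cases)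
          case (1 st \<omega>)
          then show ?case using forced j ne vp Some pin[OF 1(1)]
            by (simp add: prog_defs frame_rel_Frame probe_nat)
        qed simp
      next
        case blocked
        show ?thesis
        proof (rule simI[where k = 9], goal_cases)
          case (1 st \<omega>)
          then show ?case using blocked j ne vp Some pin[OF 1(1)] h(2)
            by (simp add: prog_defs frame_rel_Frame probe_nat bt)
        qed simp
      next
        case free
        show ?thesis
        proof (rule simI[where k = 11], goal_cases)
          case (1 st \<omega>)
          then show ?case using free j ne vp Some pin[OF 1(1)] h(2)
            by (auto simp: prog_defs frame_rel_Frame probe_nat bt adj_inject less_Suc_eq)
        qed simp
      qed
    qed
  qed
qed

lemma simulates_root_return:
  assumes invar: "invar (Ret b, [g], dn)"
  shows "\<exists>k\<le>25. simulates (Ret b, [g], dn) (t, n1, n2) k"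
proof -
  obtain v c x f j where g: "g = Frame v c x f j" by (cases g)
  have vp: "v \<notin> pins dn" using invar g by auto
  have ne: "fv h \<noteq> v" if "h \<in> set dn" for h using pins_neq[OF vp that] .
  show ?thesis
  proof (cases b)
    case True
    show ?thesis
    proof (rule simI[where k = 9], goal_cases)
      case (1 st \<omega>)
      then show ?case using True g vp ne
        by (simp add: prog_defs frame_rel_Frame)
    qed simp
  next
    case False
    show ?thesis
    proof (rule simI[where k = 8], goal_cases)
      case (1 st \<omega>)
      then show ?case using False g vp ne
        by (auto simp: prog_defs frame_rel_Frame)
    qed simp
  qed
qed

lemma simulates_return:
  assumes invar: "invar (Ret b, h # Frame v c x f j # ps, dn)"
  shows "\<exists>k\<le>25. simulates (Ret b, h # Frame v c x f j # ps, dn) (t, n1, n2) k"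
proof -
  let ?I = "ps @ dn" and ?s = "(Ret b, h # Frame v c x f j # ps, dn)"
  obtain v' c' x' f' j' where h: "h = Frame v' c' x' f' j'" by (cases h)
  have legal: "legal (Frame v c x f j # ?I)" "v' \<noteq> v" "v \<noteq> v'" "v' \<notin> pins ps" "v' \<notin> pins dn" "v \<notin> pins ps"
    and j: "j < deg v" using invar h by auto
  have ne: "fv h \<noteq> v" if "h \<in> set ?I" for h using pins_neq[OF _ that] legal by simp
  have ne': "fv h \<noteq> v'" if "h \<in> set ?I" for h using pins_neq[of v' ?I, OF _ that] legal by simp
  show ?thesis
  proof (cases "f = j + 1 \<or> b")
    case True
    show ?thesis
    proof (rule simI[where k = 10], goal_cases)
      case (1 st \<omega>)
      then show ?case using True h legal(2-) ne ne' j
        by (cases b) (auto simp: prog_defs frame_rel_Frame)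
    qed simp
  next
    case False
    show ?thesis
    proof (rule simI[where k = 13], goal_cases)
      case (1 st \<omega>)
      then show ?case using False h legal(2-) ne ne' j
        by (auto simp: prog_defs frame_rel_Frame probe_nat adj_inject less_Suc_eq)
    qed simp
  qed
qed

end

section \<open>Halting and output\<close>

lemma step_Nil: "fst c = [] \<Longrightarrow> (step adj ^^ n) c = c"
  by (cases c, induction n) auto

text \<open>The finished frames list the vertices in reverse order; as the keys are distinct, the
  order does not affect the dictionary and only the values matter.\<close>

lemma map_of_pairs_eq_iff:
  fixes f :: "'a \<Rightarrow> 'k" and g :: "'a \<Rightarrow> 'b"
  assumes "map f xs = rev (map h ys)" "distinct (map h ys)"
  shows "map_of (map (\<lambda>x. (f x, g x)) xs) = map_of (map (\<lambda>y. (h y, k (h y))) ys) \<longleftrightarrow>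
    (\<forall>x \<in> set xs. g x = k (f x))"
proof -
  have d: "distinct (map fst (map (\<lambda>x. (f x, g x)) xs))" "distinct (map fst (map (\<lambda>y. (h y, k (h y))) ys))"
    using assms by (simp_all add: comp_def)
  have keys: "f ` set xs = h ` set ys" using assms(1) by (metis set_map set_rev)
  have l: "map_of (map (\<lambda>x. (f x, g x)) xs) (f x) = Some (g x)" if "x \<in> set xs" for x
    using map_of_is_SomeI[OF d(1), of "f x" "g x"] that by auto
  have r: "map_of (map (\<lambda>y. (h y, k (h y))) ys) (f x) = Some (k (f x))" if "x \<in> set xs" for x
    using map_of_is_SomeI[OF d(2), of "f x" "k (f x)"] that keys by fastforce
  show ?thesis
  proof
    assume "map_of (map (\<lambda>x. (f x, g x)) xs) = map_of (map (\<lambda>y. (h y, k (h y))) ys)"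
    then show "\<forall>x \<in> set xs. g x = k (f x)" using l r by (metis option.inject)
  next
    assume "\<forall>x \<in> set xs. g x = k (f x)"
    then show "map_of (map (\<lambda>x. (f x, g x)) xs) = map_of (map (\<lambda>y. (h y, k (h y))) ys)"
    proof (intro map_of_eqI)
      show "set (map fst (map (\<lambda>x. (f x, g x)) xs)) = set (map fst (map (\<lambda>y. (h y, k (h y))) ys))"
        using keys by (simp add: image_image)
    qed (use l r in auto)
  qed
qed

context sampler begin

lemma simulates_ex:
  assumes invar: "invar s" and nt: "\<not> terminal s"
  shows "\<exists>k\<le>25. simulates s d k"
proof -
  obtain t n1 n2 where d: "d = (t, n1, n2)" by (cases d)
  show ?thesis using invar
  proof (cases rule: invar_cases)
    case (1 md dn)
    then have "length dn < length vs" using nt by simp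
    then show ?thesis
      using vertex_instance.v(2)[OF new_vertex_instance] invar 1 simulates_new d by blast
  next
    case 2
    then show ?thesis using simulates_round invar d by blast
  next
    case 3
    then show ?thesis using simulates_slot invar d by blast
  next
    case 4
    then show ?thesis using simulates_root_return invar d by blast
  next
    case 5
    then show ?thesis using simulates_return invar d by blast
  qed
qed

lemma rel_set_reg:
  "x \<notin> {''q'', ''m'', ''k'', ''d'', ''v''} \<Longrightarrow> rel s (set_reg x r st) = rel s st"
  by (cases s) auto

lemma loop_free_main: "list_all loop_free main_body"
  by (simp add: main_body_def prog_defs)

text \<open>The four additional steps are the loop test and the three draws.\<close>

lemma step_iteration:
  assumes rel: "rel s st" and invar: "invar s" and nt: "\<not> terminal s" and simulates: "simulates s (draw3 q \<omega>) k"
  shows "\<exists>st'. (step adj ^^ (k + 4)) ([main_loop], st, \<omega>) = ([main_loop], st', stl3 \<omega>) \<and>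
    rel (mstep (draw3 q \<omega>) s) st'"
proof -
  obtain md act dn where s: "s = (md, act, dn)" by (cases s)
  have g: "globals st" "reg st ''k'' = real (length dn)" using rel s by auto
  have "length dn < length vs" using invar nt s by (cases act) auto
  then have cond: "holds st (Less (Reg ''k'') (Reg ''m''))" using g by (simp add: globals_def)
  let ?n1 = "uniform_index q (shd (stl \<omega>))" and ?n2 = "uniform_index q (shd (stl (stl \<omega>)))"
  have n: "?n1 < q" "?n2 < q" using q_pos by (simp_all add: uniform_index_less)
  let ?st = "set_reg ''b'' (real (?n2 + 1)) (set_reg ''a'' (real (?n1 div 4)) (set_reg ''u'' (shd \<omega>) st))"
  have "rel s ?st" using rel by (simp add: rel_set_reg del: rel.simps)
  then obtain st' where st': "exec adj dispatch ?st (stl3 \<omega>) = (k, st', stl3 \<omega>)"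
    "rel (mstep (draw3 q \<omega>) s) st'"
  proof -
    have "rel s ?st \<and> tag q (reg ?st ''u'') = fst (draw3 q \<omega>) \<and>
        reg ?st ''a'' = real (fst (snd (draw3 q \<omega>)) div 4) \<and>
        reg ?st ''b'' = real (snd (snd (draw3 q \<omega>)) + 1)"
      using \<open>rel s ?st\<close> by (simp add: draw3_def del: rel.simps)
    then show ?thesis using simulates that unfolding simulates_def by blast
  qed
  have main: "main_body = [DrawUnit ''u'', DrawList ''a'' ''S'' (Reg ''q''), DrawList ''b'' ''C'' (Reg ''q'')] @ dispatch"
    by (simp add: main_body_def dispatch_def)
  then have "exec adj main_body st \<omega> = (k + 3, st', stl3 \<omega>)"
    unfolding main using g(1) n st'(1)
    by (simp add: exec_DrawList globals_def stl3_def del: exec.simps(9))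
  then have "(step adj ^^ (k + 3)) (main_body @ [main_loop], st, \<omega>) = ([main_loop], st', stl3 \<omega>)"
    by (rule exec_step[OF loop_free_main])
  moreover have "step adj ([main_loop], st, \<omega>) = (main_body @ [main_loop], st, \<omega>)"
    using cond by (simp add: main_loop_def)
  ultimately have "(step adj ^^ Suc (k + 3)) ([main_loop], st, \<omega>) = ([main_loop], st', stl3 \<omega>)"
    by (simp only: funpow_Suc_right o_apply)
  then show ?thesis using st'(2) by (simp add: eval_nat_numeral del: funpow.simps)
qed

text \<open>An arbitrary choice, but depending on state and draws only; this makes
  \<open>elapsed\<close> measurable.\<close>

definition duration :: "mstate \<Rightarrow> draws \<Rightarrow> nat" where
  "duration s d = (SOME k. k \<le> 25 \<and> simulates s d k) + 4"

lemma duration: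
  assumes "invar s" "\<not> terminal s"
  shows "duration s d \<le> 29" "duration s d \<ge> 4" "simulates s d (duration s d - 4)"
  using someI_ex[OF simulates_ex[OF assms, of d]] by (auto simp: duration_def)

fun elapsed :: "mstate \<Rightarrow> real stream \<Rightarrow> nat \<Rightarrow> nat" where
  "elapsed s \<omega> 0 = 0"
| "elapsed s \<omega> (Suc n) = duration s (draw3 q \<omega>) + elapsed (mstep (draw3 q \<omega>) s) (stl3 \<omega>) n"

lemma measurable_elapsed [measurable]:
  "(\<lambda>\<omega>. elapsed s \<omega> n) \<in> measurable tape_space (count_space UNIV)"
proof (induction n arbitrary: s)
  case (Suc n)
  have "(\<lambda>\<omega>. duration s d + elapsed (mstep d s) (stl3 \<omega>) n) \<in> measurable tape_space (count_space UNIV)" for d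
  proof -
    have "(\<lambda>\<omega>. elapsed (mstep d s) (stl3 \<omega>) n) \<in> measurable tape_space (count_space UNIV)"
      by (rule measurable_compose[OF measurable_stl3 Suc])
    then show ?thesis by measurable
  qed
  then show ?case unfolding elapsed.simps
    by (rule measurable_compose_countable[OF _ measurable_draw3])
qed simp

lemma elapsed_add:
  "elapsed s \<omega> (m + n) = elapsed s \<omega> m + elapsed (chain s \<omega> m) ((stl3 ^^ m) \<omega>) n"
  by (induction m arbitrary: s \<omega>) (simp_all add: funpow_swap1)

lemma elapsed_mono: "m \<le> n \<Longrightarrow> elapsed s \<omega> m \<le> elapsed s \<omega> n"
  using elapsed_add[of s \<omega> m "n - m"] by simp

lemma elapsed_bounds:
  assumes "invar s" "\<And>i. i < n \<Longrightarrow> \<not> terminal (chain s \<omega> i)"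
  shows "n \<le> elapsed s \<omega> n" "elapsed s \<omega> n \<le> 29 * n"
proof -
  have "n \<le> elapsed s \<omega> n \<and> elapsed s \<omega> n \<le> 29 * n"
    using assms
  proof (induction n arbitrary: s \<omega>)
    case (Suc n)
    have nt: "\<not> terminal s" using Suc.prems(2)[of 0] by simp
    have "\<not> terminal (chain (mstep (draw3 q \<omega>) s) (stl3 \<omega>) i)" if "i < n" for i
      using Suc.prems(2)[of "Suc i"] that by simp
    then have "n \<le> elapsed (mstep (draw3 q \<omega>) s) (stl3 \<omega>) n \<and>
        elapsed (mstep (draw3 q \<omega>) s) (stl3 \<omega>) n \<le> 29 * n"
      using Suc.IH[OF invar_draw[OF Suc.prems(1)]] by blast
    then show ?case using duration[OF Suc.prems(1) nt, of "draw3 q \<omega>"] by simp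
  qed simp
  then show "n \<le> elapsed s \<omega> n" "elapsed s \<omega> n \<le> 29 * n" by auto
qed

lemma step_chain:
  assumes "rel s st" "invar s" "\<And>i. i < n \<Longrightarrow> \<not> terminal (chain s \<omega> i)"
  shows "\<exists>st'. (step adj ^^ elapsed s \<omega> n) ([main_loop], st, \<omega>) = ([main_loop], st', (stl3 ^^ n) \<omega>) \<and>
    rel (chain s \<omega> n) st'"
  using assms
proof (induction n arbitrary: s st \<omega>)
  case (Suc n)
  have nt: "\<not> terminal s" using Suc.prems(3)[of 0] by simp
  let ?d = "draw3 q \<omega>"
  have dur: "duration s ?d - 4 + 4 = duration s ?d"
    using duration(2)[OF Suc.prems(2) nt, of ?d] by simp
  obtain st1 where st1: "(step adj ^^ duration s ?d) ([main_loop], st, \<omega>) = ([main_loop], st1, stl3 \<omega>)"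
    "rel (mstep ?d s) st1"
    using step_iteration[OF Suc.prems(1,2) nt, of \<omega> "duration s ?d - 4"]
      duration(3)[OF Suc.prems(2) nt, of ?d] unfolding dur by blast
  have "\<not> terminal (chain (mstep ?d s) (stl3 \<omega>) i)" if "i < n" for i
    using Suc.prems(3)[of "Suc i"] that by simp
  then obtain st' where st': "(step adj ^^ elapsed (mstep ?d s) (stl3 \<omega>) n) ([main_loop], st1, stl3 \<omega>) =
      ([main_loop], st', (stl3 ^^ n) (stl3 \<omega>))" "rel (chain (mstep ?d s) (stl3 \<omega>) n) st'"
    using Suc.IH[OF st1(2) invar_draw[OF Suc.prems(2)]] by blast
  have "(step adj ^^ elapsed s \<omega> (Suc n)) ([main_loop], st, \<omega>) = ([main_loop], st', (stl3 ^^ Suc n) \<omega>)"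
  proof -
    have "elapsed s \<omega> (Suc n) = elapsed (mstep ?d s) (stl3 \<omega>) n + duration s ?d" by simp
    then show ?thesis using st1(1) st'(1) by (simp only: funpow_add o_apply funpow_Suc_right)
  qed
  then show ?case using st'(2) by (simp only: chain.simps) blast
qed simp

lemma step_terminal:
  assumes "rel s st" "terminal s"
  shows "step adj ([main_loop], st, \<omega>) = ([], st, \<omega>)"
  using assms by (cases s) (auto simp: main_loop_def globals_def)

section \<open>Setting up the tables for the draws\<close>

definition init_rel :: "nat \<Rightarrow> store \<Rightarrow> bool" where
  "init_rel i st \<longleftrightarrow>
    reg st ''i'' = real i \<and> reg st ''r'' = real (i mod 4) \<and> reg st ''t'' = real (i div 4) \<and>
    (\<forall>x. x \<notin> {''i'', ''r'', ''t''} \<longrightarrow> reg st x = reg (initial_store q vs) x) \<and>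
    (\<forall>k<i. get st ''C'' [real k] = real (k + 1) \<and> get st ''S'' [real k] = real (k div 4)) \<and>
    (\<forall>d. d \<notin> {''C'', ''S''} \<longrightarrow> dict st d = dict (initial_store q vs) d)"

lemma init_iterations:
  assumes "i \<le> q"
  shows "\<exists>n st. n \<le> 8 * i \<and> init_rel i st \<and>
    (\<forall>\<omega>. (step adj ^^ n) (program, initial_store q vs, \<omega>) = (program, st, \<omega>))"
  using assms
proof (induction i)
  case 0
  show ?case
    by (intro exI[of _ 0] exI[of _ "initial_store q vs"]) (simp add: init_rel_def initial_store_def)
next
  case (Suc i)
  then obtain n st where n: "n \<le> 8 * i" and rel: "init_rel i st"
    and st: "\<And>\<omega>. (step adj ^^ n) (program, initial_store q vs, \<omega>) = (program, st, \<omega>)" by auto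
  define body where "body =
    [Insert ''C'' [Reg ''i''] (Plus (Reg ''i'') (Num 1)), Insert ''S'' [Reg ''i''] (Reg ''t''),
     Assign ''i'' (Plus (Reg ''i'') (Num 1)), Assign ''r'' (Plus (Reg ''r'') (Num 1)),
     If (Equal (Reg ''r'') (Num 4)) [Assign ''r'' (Num 0), Assign ''t'' (Plus (Reg ''t'') (Num 1))] []]"
  have body: "step adj (program, st, \<omega>) = (body @ program, st, \<omega>)" for \<omega>
    using rel Suc.prems by (simp add: init_rel_def initial_store_def program_def init_loop_def body_def)
  let ?st = "set_reg ''r'' (real (i mod 4) + 1) (set_reg ''i'' (real i + 1)
    (set_dict ''S'' [real i] (Some (real (i div 4))) (set_dict ''C'' [real i] (Some (real i + 1)) st)))"
  \<comment> \<open>Five commands, and two more when the remainder wraps around; the loop test makes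
    it at most 8 steps per entry.\<close>
  have "\<exists>k st'. k \<le> 7 \<and> init_rel (Suc i) st' \<and> (\<forall>\<omega>. exec adj body st \<omega> = (k, st', \<omega>))"
  proof (cases "i mod 4 = 3")
    case True
    then have m: "Suc i mod 4 = 0" "Suc i div 4 = Suc (i div 4)" by presburger+
    show ?thesis
      by (rule exI[of _ 7], rule exI[of _ "set_reg ''t'' (real (i div 4) + 1) (set_reg ''r'' 0 ?st)"])
        (use rel True in \<open>auto simp: init_rel_def body_def m less_Suc_eq\<close>)
  next
    case False
    then have m: "Suc i mod 4 = Suc (i mod 4)" "Suc i div 4 = i div 4" by presburger+
    have "real (i mod 4) + 1 \<noteq> 4" using False by linarith
    then show ?thesis
      by (intro exI[of _ 5] exI[of _ ?st])
        (use rel False in \<open>auto simp: init_rel_def body_def m less_Suc_eq\<close>)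
  qed
  then obtain k st' where k: "k \<le> 7" "init_rel (Suc i) st'"
    and ex: "\<And>\<omega>. exec adj body st \<omega> = (k, st', \<omega>)" by blast
  have "(step adj ^^ (k + Suc n)) (program, initial_store q vs, \<omega>) = (program, st', \<omega>)" for \<omega>
  proof -
    have "(step adj ^^ Suc n) (program, initial_store q vs, \<omega>) = (body @ program, st, \<omega>)"
      using body[of \<omega>] st[of \<omega>] by simp
    moreover have "(step adj ^^ k) (body @ program, st, \<omega>) = (program, st', \<omega>)"
      by (rule exec_step[OF _ ex]) (simp add: body_def)
    ultimately show ?thesis by (simp only: funpow_add o_apply)
  qed
  then show ?case using n k by (intro exI[of _ "k + Suc n"] exI[of _ st'] conjI) simp_all
qed

definition start :: mstate where "start = (Rnd, [], [])"

lemma invar_start: "invar start"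
  by (simp add: start_def done_ok_def)

lemma init_phase:
  "\<exists>n st. n \<le> 8 * q + 1 \<and> rel start st \<and>
    (\<forall>\<omega>. (step adj ^^ n) (program, initial_store q vs, \<omega>) = ([main_loop], st, \<omega>))"
proof -
  obtain n st where n: "n \<le> 8 * q" and rel: "init_rel q st"
    and st: "\<And>\<omega>. (step adj ^^ n) (program, initial_store q vs, \<omega>) = (program, st, \<omega>)"
    using init_iterations[OF order_refl] by auto
  have i: "reg st ''i'' = real q"
    and rx: "\<And>x. x \<notin> {''i'', ''r'', ''t''} \<Longrightarrow> reg st x = reg (initial_store q vs) x"
    and cs: "\<forall>k<q. get st ''C'' [real k] = real (k + 1) \<and> get st ''S'' [real k] = real (k div 4)"
    and dx: "\<And>d. d \<notin> {''C'', ''S''} \<Longrightarrow> dict st d = dict (initial_store q vs) d"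
    using rel by (simp_all add: init_rel_def)
  have "(step adj ^^ Suc n) (program, initial_store q vs, \<omega>) = ([main_loop], st, \<omega>)" for \<omega>
    using st[of \<omega>] i rx[of "''q''"] by (simp add: program_def init_loop_def initial_store_def)
  moreover have "rel start st"
  proof -
    have L: "get st ''Lambda'' [real k] = real (vs ! k)" if "k < length vs" for k
    proof -
      have "map_of (map (\<lambda>i. ([real i], real (vs ! i))) [0..<length vs]) [real k] = Some (real (vs ! k))"
        using that by (intro map_of_is_SomeI) (auto simp: comp_def distinct_map inj_on_def)
      then show ?thesis using dx[of "''Lambda''"] by (simp add: get_def initial_store_def)
    qed
    have "get st d ks = 0" if "d \<notin> {''C'', ''S'', ''Lambda''}" for d ks
      using dx[of d] that by (auto simp: get_def initial_store_def)
    moreover have "dict st ''out'' = Map.empty" using dx[of "''out''"] by (simp add: initial_store_def)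
    ultimately show ?thesis
      using cs L rx by (simp add: start_def globals_def initial_store_def)
  qed
  ultimately show ?thesis using n by (intro exI[of _ "Suc n"] exI[of _ st]) auto
qed

text \<open>The initialization draws nothing, so one choice of time and store serves all
  tapes.\<close>

definition init_time :: nat where
  "init_time = (SOME n. \<exists>st. n \<le> 8 * q + 1 \<and> rel start st \<and>
    (\<forall>\<omega>. (step adj ^^ n) (program, initial_store q vs, \<omega>) = ([main_loop], st, \<omega>)))"

definition init_store :: store where
  "init_store = (SOME st. init_time \<le> 8 * q + 1 \<and> rel start st \<and>
    (\<forall>\<omega>. (step adj ^^ init_time) (program, initial_store q vs, \<omega>) = ([main_loop], st, \<omega>)))"

lemma init:
  "init_time \<le> 8 * q + 1" "rel start init_store"
  "config_after program adj q vs \<omega> init_time = ([main_loop], init_store, \<omega>)"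
  using someI_ex[OF someI_ex[OF init_phase, folded init_time_def], folded init_store_def]
  by (simp_all add: config_after_def)

section \<open>Halting time and output of the program\<close>

abbreviation "conf \<equiv> config_after program adj q vs"

lemma conf_add: "conf \<omega> (m + n) = (step adj ^^ n) (conf \<omega> m)"
  unfolding config_after_def by (simp add: funpow_add[of n m, symmetric, THEN fun_cong, simplified] add.commute)

lemma conf_stays: "fst (conf \<omega> m) = [] \<Longrightarrow> m \<le> n \<Longrightarrow> conf \<omega> n = conf \<omega> m"
  using conf_add[of \<omega> m "n - m"] step_Nil[of "conf \<omega> m"] by simp

lemma conf_chain:
  assumes "\<And>i. i < n \<Longrightarrow> \<not> terminal (chain start \<omega> i)"
  shows "\<exists>st. conf \<omega> (init_time + elapsed start \<omega> n) = ([main_loop], st, (stl3 ^^ n) \<omega>) \<and>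
    rel (chain start \<omega> n) st"
  using step_chain[OF init(2) invar_start assms] by (simp add: conf_add init(3))

lemma conf_terminal:
  assumes "\<And>i. i < n \<Longrightarrow> \<not> terminal (chain start \<omega> i)" "terminal (chain start \<omega> n)"
  shows "\<exists>st \<omega>'. conf \<omega> (init_time + elapsed start \<omega> n + 1) = ([], st, \<omega>') \<and> rel (chain start \<omega> n) st"
proof -
  obtain st where st: "conf \<omega> (init_time + elapsed start \<omega> n) = ([main_loop], st, (stl3 ^^ n) \<omega>)"
    "rel (chain start \<omega> n) st" using conf_chain[OF assms(1)] by blast
  have "conf \<omega> (init_time + elapsed start \<omega> n + 1) = step adj (conf \<omega> (init_time + elapsed start \<omega> n))"
    by (subst conf_add) simp
  then have "conf \<omega> (init_time + elapsed start \<omega> n + 1) = ([], st, (stl3 ^^ n) \<omega>)"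
    by (simp only: st(1) step_terminal[OF st(2) assms(2)])
  then show ?thesis using st(2) by blast
qed

definition first_terminal :: "real stream \<Rightarrow> nat \<Rightarrow> bool" where
  "first_terminal \<omega> n \<longleftrightarrow> terminal (chain start \<omega> n) \<and> (\<forall>i<n. \<not> terminal (chain start \<omega> i))"

lemma ex_first_terminal:
  assumes "terminal (chain start \<omega> m)"
  obtains n where "first_terminal \<omega> n" "n \<le> m"
proof -
  let ?n = "LEAST i. terminal (chain start \<omega> i)"
  have "first_terminal \<omega> ?n" unfolding first_terminal_def
    using LeastI[of "\<lambda>i. terminal (chain start \<omega> i)", OF assms] not_less_Least by blast
  moreover have "?n \<le> m" using assms by (rule Least_le)
  ultimately show ?thesis using that by blast
qed

text \<open>The program halts exactly by the failing loop test after the first terminal state, which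
  accounts for the additional step.\<close>

lemma halted_iff:
  "fst (conf \<omega> n) = [] \<longleftrightarrow> (\<exists>m. first_terminal \<omega> m \<and> init_time + elapsed start \<omega> m + 1 \<le> n)"
proof
  assume halted: "fst (conf \<omega> n) = []"
  have late: "k < n" if "fst (conf \<omega> k) \<noteq> []" for k
    using that conf_stays[OF halted, of k] halted by (metis not_le)
  show "\<exists>m. first_terminal \<omega> m \<and> init_time + elapsed start \<omega> m + 1 \<le> n"
  proof (cases "\<exists>m. terminal (chain start \<omega> m)")
    case True
    then obtain m where m: "first_terminal \<omega> m" using ex_first_terminal by blast
    then have "fst (conf \<omega> (init_time + elapsed start \<omega> m)) \<noteq> []"
      using conf_chain[of m \<omega>] by (auto simp: first_terminal_def)
    then show ?thesis using late m by fastforce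
  next
    case False
    then have "fst (conf \<omega> (init_time + elapsed start \<omega> n)) \<noteq> []"
      using conf_chain[of n \<omega>] by auto
    then have "init_time + elapsed start \<omega> n < n" by (rule late)
    \<comment> \<open>Each iteration takes at least one step, so \<open>n\<close> iterations cannot
      end before time \<open>n\<close>: a contradiction.\<close>
    then show ?thesis using elapsed_bounds(1)[OF invar_start, of n \<omega>] False by auto
  qed
next
  assume "\<exists>m. first_terminal \<omega> m \<and> init_time + elapsed start \<omega> m + 1 \<le> n"
  then obtain m where m: "first_terminal \<omega> m" "init_time + elapsed start \<omega> m + 1 \<le> n" by blast
  then have "fst (conf \<omega> (init_time + elapsed start \<omega> m + 1)) = []"
    using conf_terminal[of m \<omega>] by (auto simp: first_terminal_def)
  then show "fst (conf \<omega> n) = []" using conf_stays m(2) by metis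
qed

lemma outputs_iff: "outputs program adj q vs \<omega> \<tau> \<longleftrightarrow> (\<exists>n. outcome \<tau> (chain start \<omega> n))"
proof -
  have out: "dict st ''out'' = map_of (map (\<lambda>v. ([real v], real (\<tau> v))) vs) \<longleftrightarrow> outcome \<tau> (chain start \<omega> m)"
    if rel: "rel (chain start \<omega> m) st" and t: "terminal (chain start \<omega> m)" for st m
  proof -
    obtain md dn where c: "chain start \<omega> m = (md, [], dn)" "length dn \<ge> length vs"
      using t by (cases "chain start \<omega> m") auto
    have "done_ok dn" using invar_chain[OF invar_start, of \<omega> m] c by simp
    then have fv: "map fv dn = rev vs" using c(2) by (simp add: done_ok_def)
    have keys: "map (\<lambda>h. [real (fv h)]) dn = rev (map (\<lambda>v. [real v]) vs)"
    proof -
      have "map (\<lambda>h. [real (fv h)]) dn = map (\<lambda>v. [real v]) (map fv dn)" by simp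
      then show ?thesis by (simp only: fv rev_map)
    qed
    have "distinct (map (\<lambda>v. [real v]) vs)" using vs(1) by (simp add: distinct_map inj_on_def)
    \<comment> \<open>Values must be given as a function of the key, so \<open>\<tau>\<close> is
      composed with the decoding of singleton keys.\<close>
    from map_of_pairs_eq_iff[OF keys this, of "\<lambda>h. real (fx h)" "\<lambda>ks. real (\<tau> (nat \<lfloor>hd ks\<rfloor>))"]
    have "map_of (map (\<lambda>h. ([real (fv h)], real (fx h))) dn) = map_of (map (\<lambda>v. ([real v], real (\<tau> v))) vs) \<longleftrightarrow>
      (\<forall>h\<in>set dn. fx h = \<tau> (fv h))" by simp
    then show ?thesis using rel t c by (simp add: outcome_def agrees_def)
  qed
  show ?thesis
  proof
    assume "outputs program adj q vs \<omega> \<tau>"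
    then obtain n st \<omega>' where n: "conf \<omega> n = ([], st, \<omega>')"
      "dict st ''out'' = map_of (map (\<lambda>v. ([real v], real (\<tau> v))) vs)"
      by (auto simp: outputs_def)
    then obtain m where m: "first_terminal \<omega> m" "init_time + elapsed start \<omega> m + 1 \<le> n"
      using halted_iff[of \<omega> n] by auto
    obtain st1 \<omega>1 where st1: "conf \<omega> (init_time + elapsed start \<omega> m + 1) = ([], st1, \<omega>1)"
      "rel (chain start \<omega> m) st1"
      using conf_terminal[of m \<omega>] m(1) by (auto simp: first_terminal_def)
    then have "st1 = st" using conf_stays[OF _ m(2), of \<omega>] n(1) by simp
    then show "\<exists>n. outcome \<tau> (chain start \<omega> n)"
      using out[OF st1(2)] m(1) n(2) by (auto simp: first_terminal_def)
  next
    assume "\<exists>n. outcome \<tau> (chain start \<omega> n)"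
    then obtain n where n: "outcome \<tau> (chain start \<omega> n)" by blast
    then obtain m where m: "first_terminal \<omega> m" "m \<le> n"
      using ex_first_terminal by (auto simp: outcome_def)
    then have t: "terminal (chain start \<omega> m)" by (simp add: first_terminal_def)
    then have o: "outcome \<tau> (chain start \<omega> m)" using n terminal_chain_mono[OF t m(2)] by simp
    obtain st1 \<omega>1 where st1: "conf \<omega> (init_time + elapsed start \<omega> m + 1) = ([], st1, \<omega>1)"
      "rel (chain start \<omega> m) st1"
      using conf_terminal[of m \<omega>] m(1) by (auto simp: first_terminal_def)
    then show "outputs program adj q vs \<omega> \<tau>"
      using out[OF st1(2) t] o unfolding outputs_def by blast
  qed
qed

definition halting_time :: "real stream \<Rightarrow> nat \<Rightarrow> ennreal" where
  "halting_time \<omega> m = (if terminal (chain start \<omega> m)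
     then of_nat (init_time + elapsed start \<omega> m + 1) else top)"

text \<open>A countable infimum over machine steps, from which measurability is immediate. Later
  terminal states do not lower it because \<open>elapsed\<close> is monotone.\<close>

lemma running_time_eq: "running_time program adj q vs \<omega> = (INF m. halting_time \<omega> m)"
  unfolding running_time_def halted_iff
proof (rule antisym)
  let ?T = "{n. \<exists>m. first_terminal \<omega> m \<and> init_time + elapsed start \<omega> m + 1 \<le> n}"
  show "(INF n \<in> ?T. of_nat n)
      \<le> (INF m. halting_time \<omega> m)"
  proof (rule INF_greatest)
    fix m
    show "(INF n \<in> ?T. of_nat n)
      \<le> halting_time \<omega> m"
    proof (cases "terminal (chain start \<omega> m)")
      case True
      then obtain n where "first_terminal \<omega> n" "n \<le> m" using ex_first_terminal by blast
      then have "\<exists>m'. first_terminal \<omega> m' \<and> init_time + elapsed start \<omega> m' + 1 \<le> init_time + elapsed start \<omega> m + 1"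
        using elapsed_mono by (intro exI[of _ n]) simp
      then show ?thesis using True unfolding halting_time_def if_P[OF True]
        by (intro INF_lower) simp
    qed (simp add: halting_time_def)
  qed
  show "(INF m. halting_time \<omega> m)
      \<le> (INF n \<in> ?T. of_nat n)"
  proof (rule INF_greatest)
    fix n assume "n \<in> ?T"
    then obtain m where m: "first_terminal \<omega> m" "init_time + elapsed start \<omega> m + 1 \<le> n" by blast
    have "(INF m. halting_time \<omega> m) \<le> halting_time \<omega> m" by (rule INF_lower) simp
    also have "\<dots> = of_nat (init_time + elapsed start \<omega> m + 1)"
      using m(1) by (simp add: halting_time_def first_terminal_def)
    also have "\<dots> \<le> of_nat n" using m(2) by (simp only: of_nat_le_iff)
    finally show "(INF m. halting_time \<omega> m) \<le> of_nat n" .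
  qed
qed

lemma measurable_running_time: "running_time program adj q vs \<in> borel_measurable tape_space"
proof -
  have "(\<lambda>\<omega>. halting_time \<omega> m) \<in> borel_measurable tape_space" for m
  proof -
    have [measurable]: "Measurable.pred tape_space (\<lambda>\<omega>. terminal (chain start \<omega> m))"
      by (rule measurable_compose[OF measurable_chain]) simp
    have "(\<lambda>\<omega>. of_nat (init_time + elapsed start \<omega> m + 1) :: ennreal) \<in> borel_measurable tape_space"
      by (rule measurable_compose[OF measurable_elapsed]) simp
    then show ?thesis unfolding halting_time_def by measurable
  qed
  then have "(\<lambda>\<omega>. INF m. halting_time \<omega> m) \<in> borel_measurable tape_space" by measurable
  moreover have "running_time program adj q vs = (\<lambda>\<omega>. INF m. halting_time \<omega> m)"
    by (rule ext) (rule running_time_eq)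
  ultimately show ?thesis by (simp only:)
qed

lemma running_time_le:
  "running_time program adj q vs \<omega> \<le> of_nat (init_time + 1) + 29 * (\<Sum>i. running (chain start \<omega> i))"
proof (cases "\<exists>m. terminal (chain start \<omega> m)")
  case True
  then obtain m where m: "first_terminal \<omega> m" using ex_first_terminal by blast
  have "running_time program adj q vs \<omega> \<le> halting_time \<omega> m"
    unfolding running_time_eq by (rule INF_lower) simp
  also have "\<dots> = of_nat (init_time + elapsed start \<omega> m + 1)"
    using m by (simp add: halting_time_def first_terminal_def)
  also have "\<dots> \<le> of_nat (init_time + 1 + 29 * m)"
    using elapsed_bounds(2)[OF invar_start, of m \<omega>] m by (intro of_nat_mono) (simp add: first_terminal_def)
  also have "\<dots> = of_nat (init_time + 1) + 29 * of_nat m" by simp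
  also have "of_nat m = (\<Sum>i<m. running (chain start \<omega> i))"
    using m by (simp add: running_def first_terminal_def)
  also have "\<dots> \<le> (\<Sum>i. running (chain start \<omega> i))" by (rule sum_le_suminf) auto
  finally show ?thesis by (simp add: add_left_mono mult_left_mono)
next
  case False
  \<comment> \<open>A run that never halts has an infinite sum, which makes the bound
    trivial.\<close>
  have "of_nat n \<le> (\<Sum>i. running (chain start \<omega> i))" for n :: nat
  proof -
    have "of_nat n = (\<Sum>i<n. running (chain start \<omega> i))" using False by (simp add: running_def)
    also have "\<dots> \<le> (\<Sum>i. running (chain start \<omega> i))" by (rule sum_le_suminf) auto
    finally show ?thesis .
  qed
  then have "(SUP n. of_nat n :: ennreal) \<le> (\<Sum>i. running (chain start \<omega> i))" by (intro SUP_least)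
  then have "(\<Sum>i. running (chain start \<omega> i)) = top"
    by (simp add: ennreal_SUP_of_nat_eq_top top_unique)
  then show ?thesis by (simp add: ennreal_mult_top)
qed

lemma expected_running_time:
  assumes "vs \<noteq> []"
  shows "(\<integral>\<^sup>+ \<omega>. running_time program adj q vs \<omega> \<partial>tape_space)
    \<le> ennreal (400 * real \<Delta> ^ 2 * real q * real (length vs))"
proof -
  have "(\<integral>\<^sup>+ \<omega>. running_time program adj q vs \<omega> \<partial>tape_space) \<le>
      (\<integral>\<^sup>+ \<omega>. of_nat (init_time + 1) + 29 * (\<Sum>i. running (chain start \<omega> i)) \<partial>tape_space)"
    using running_time_le by (intro nn_integral_mono) auto
  also have "\<dots> = of_nat (init_time + 1) + 29 * (\<integral>\<^sup>+ \<omega>. (\<Sum>i. running (chain start \<omega> i)) \<partial>tape_space)"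
    using prob_space.emeasure_space_1[OF prob_space_tape]
    by (subst nn_integral_add) (auto simp: nn_integral_cmult)
  also have "\<dots> \<le> of_nat (init_time + 1) + 29 * ennreal (potential start)"
    using nn_integral_running[OF invar_start] by (intro add_left_mono mult_left_mono) auto
  also have "\<dots> = ennreal (real (init_time + 1) + 29 * potential start)"
    using potential_nonneg[OF invar_start] by (simp add: ennreal_of_nat_eq_real_of_nat ennreal_mult)
  also have "\<dots> \<le> ennreal (400 * real \<Delta> ^ 2 * real q * real (length vs))"
  proof (rule ennreal_leI)
    define x where "x = real \<Delta> ^ 2 * real q * real (length vs)"
    have D: "real \<Delta> \<ge> 1" and q: "real q \<ge> 1" and l: "real (length vs) \<ge> 1"
      using degree_pos q_pos assms by (simp_all add: Suc_le_eq)
    have "real q \<le> x"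
    proof -
      have "1 * real q * 1 \<le> x" unfolding x_def using D q l by (intro mult_mono) auto
      then show ?thesis by simp
    qed
    moreover have "real \<Delta> * real (length vs) \<le> x"
    proof -
      have "real \<Delta> * 1 * real (length vs) \<le> real \<Delta> * (real \<Delta> * real q) * real (length vs)"
        using D q l mult_mono[of 1 "real \<Delta>" 1 "real q"] by (intro mult_mono) auto
      then show ?thesis by (simp add: x_def power2_eq_square mult_ac)
    qed
    moreover have "potential start \<le> 12 * (real \<Delta> * real (length vs))"
    proof -
      have "vertex_cost \<le> 12 * real \<Delta>" using D by (simp add: vertex_cost_def call_cost_def)
      then have "real (length vs) * vertex_cost \<le> real (length vs) * (12 * real \<Delta>)"
        by (rule mult_left_mono) simp
      then show ?thesis by (simp add: start_def mult_ac)
    qed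
    moreover have "real (init_time + 1) \<le> 10 * real q" using init(1) q by simp
    \<comment> \<open>The constant comes from \<open>10 + 29 * 12 = 358\<close>, rounded up to
      400.\<close>
    ultimately have "real (init_time + 1) + 29 * potential start \<le> 400 * x" using q by linarith
    then show "real (init_time + 1) + 29 * potential start \<le> 400 * real \<Delta> ^ 2 * real q * real (length vs)"
      by (simp only: x_def mult.assoc)
  qed
  finally show ?thesis .
qed

end

theorem theorem1p4:
  "\<exists>(P :: cmd list) (C :: real). \<forall>V E adj \<Delta> q \<Lambda> vs.
     simple_graph V E \<and> adjacency_lists E adj \<and>
     \<Delta> = max_degree V E \<and> \<Delta> \<ge> 1 \<and> q \<ge> 65 * \<Delta> \<and>
     \<Lambda> \<subseteq> V \<and> \<Lambda> \<noteq> {} \<and> distinct vs \<and> set vs = \<Lambda> \<longrightarrow>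
     (\<forall>\<tau> \<in> \<Lambda> \<rightarrow>\<^sub>E {1..q}.
        {\<omega> \<in> space tape_space. outputs P adj q vs \<omega> \<tau>} \<in> sets tape_space \<and>
        measure tape_space {\<omega> \<in> space tape_space. outputs P adj q vs \<omega> \<tau>}
          = marginal V q (uniform_coloring V E q) \<Lambda> \<tau>) \<and>
     running_time P adj q vs \<in> borel_measurable tape_space \<and>
     (\<integral>\<^sup>+ \<omega>. running_time P adj q vs \<omega> \<partial>tape_space)
       \<le> ennreal (C * real \<Delta> ^ 2 * real q * real (card \<Lambda>))"
proof (intro exI[of _ program] exI[of _ 400] allI impI conjI ballI)
  fix V E adj \<Delta> q \<Lambda> vs
  assume *: "simple_graph V E \<and> adjacency_lists E adj \<and>
     \<Delta> = max_degree V E \<and> \<Delta> \<ge> 1 \<and> q \<ge> 65 * \<Delta> \<and>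
     \<Lambda> \<subseteq> V \<and> \<Lambda> \<noteq> {} \<and> distinct vs \<and> set vs = \<Lambda>"
  then interpret sampler V E adj q \<Delta> vs by unfold_locales auto
  have vs': "vs \<noteq> []" "card \<Lambda> = length vs" using * distinct_card by auto
  show "running_time program adj q vs \<in> borel_measurable tape_space"
    by (rule measurable_running_time)
  show "(\<integral>\<^sup>+ \<omega>. running_time program adj q vs \<omega> \<partial>tape_space)
      \<le> ennreal (400 * real \<Delta> ^ 2 * real q * real (card \<Lambda>))"
    unfolding vs'(2) by (rule expected_running_time[OF vs'(1)])
  fix \<tau> assume "\<tau> \<in> \<Lambda> \<rightarrow>\<^sub>E {1..q}"
  then have \<tau>: "\<tau> \<in> set vs \<rightarrow>\<^sub>E {1..q}" using * by simp
  let ?S = "{\<omega> \<in> space tape_space. outputs program adj q vs \<omega> \<tau>}"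
  have eq: "?S = {\<omega>. \<exists>n. outcome \<tau> (chain start \<omega> n)}" by (simp add: outputs_iff)
  show "?S \<in> sets tape_space" unfolding eq by (rule outcome_measurable)
  have "emeasure tape_space ?S = ennreal (out_prob \<tau> start)"
    unfolding eq by (rule emeasure_outcome[OF invar_start \<tau>])
  then have "measure tape_space ?S = out_prob \<tau> start"
    using out_prob_bounds(1)[OF invar_start] by (intro measure_eq_emeasure_eq_ennreal)
  then show "measure tape_space ?S = marginal V q (uniform_coloring V E q) \<Lambda> \<tau>"
    using out_prob_initial[OF \<tau>] * by (simp add: start_def)
qed

end
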